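(* Let $k$ be a field of characteristic $0$. Let $H$ be a connected $\Gamma$-graded Hopf algebra over $k$, where $\Gamma$ is a nontrivial abelian monoid that has admissible well orders. Let $A\supseteq B$ be homogeneous left (resp. right) coideal subalgebras of $H$. Then there exist a family $\{z_\xi\}_{\xi\in\Xi}$ of homogeneous elements of $A_+$ and a total order $\vartriangleleft$ on $\Xi$ such that: (1) $(\{z_\xi\}_{\xi\in\Xi},<)$ is a system of PBW generators of $A$ over $B$ for each total order $<$ on $\Xi$. (2) For each $\xi\in\Xi$, the subalgebra $A^{\trianglelefteq\xi}$ of $A$ generated by $\{z_\eta:\eta\in\Xi,\ \eta\trianglelefteq\xi\}$ over $B$ has $$\{z_{\xi_1}^{r_1}\cdots z_{\xi_m}^{r_m}: m\ge0,\ \xi_1\vartriangleleft\cdots\vartriangleleft\xi_m\trianglelefteq\xi,\ \xi_i\in\Xi,\ r_i\ge0,\ i=1,\ldots,m\}$$ as a basis of left $B$-module as well as of right $B$-module. (3) For each $\xi\in\Xi$, the subalgebra $A^{\trianglelefteq\xi}$ is a left (resp. right) coideal of $H$, and it is a Hopf subalgebra of $H$ in the case that $A,B$ are both Hopf subalgebras of $H$. (4) For all $\xi,\eta\in\Xi$ with $\eta\vartriangleleft\xi$, one has $[z_\xi,z_\eta]=z_\xi z_\eta-z_\eta z_\xi\in\bigcup_{\delta\vartriangleleft\xi}A^{\trianglelefteq\delta}$.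
   Context: All algebras, coalgebras and tensor products are over $k$; $\mathbb{N}$ includes $0$. An admissible well order on an abelian monoid $(\Gamma,+)$ is a well order $<$ such that $\gamma_1<\gamma_2$ implies $\gamma+\gamma_1<\gamma+\gamma_2$ for all $\gamma_1,\gamma_2,\gamma\in\Gamma$. A $\Gamma$-graded Hopf algebra is graded both as an algebra and as a coalgebra; it is connected if its degree-$0$ component is one-dimensional. For a $\Gamma$-graded space $V$, $V_+=\bigoplus_{\gamma\ne0}V_\gamma$. A left (resp. right) coideal subalgebra of $H$ is a subalgebra $K$ with $\Delta_H(K)\subseteq H\otimes K$ (resp. $\Delta_H(K)\subseteq K\otimes H$). For an algebra $A$ and a subalgebra $B$, a pair $(\{z_\xi\}_{\xi\in\Xi},<)$ consisting of a family of elements of $A$ and a total order on $\Xi$ is a system of PBW generators of $A$ over $B$ if $\{z_{\xi_1}^{r_1}\cdots z_{\xi_m}^{r_m}: m\ge0,\ \xi_1<\cdots<\xi_m,\ \xi_i\in\Xi,\ r_i\in\mathbb{N}\}$ is a basis of $A$ both as a left and as a right $B$-module. Here $\eta\trianglelefteq\xi$ means $\eta\vartriangleleft\xi$ or $\eta=\xi$. In these sets, an element is identified with its expression with zero exponents removed. *)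

theory Defs
  imports Complex_Main "HOL-Library.Poly_Mapping"
begin

section \<open>Free vector spaces and tensor products\<close>

text \<open>
  The free \<open>k\<close>-vector space on a type \<open>'a\<close> is \<open>'a \<Rightarrow>\<^sub>0 'k\<close>. The tensor products
  \<open>H \<otimes> H\<close> and \<open>H \<otimes> H \<otimes> H\<close> are the quotients of the free vector spaces on \<open>H \<times> H\<close> and
  \<open>H \<times> H \<times> H\<close> by the multilinearity relations. As the scalar multiplication is a parameter,
  these quotients are not types of their own: a tensor is given by a representative in the free
  space, and equality of tensors is congruence modulo the relations
  (\<open>tensor2_eq\<close>, \<open>tensor3_eq\<close>).
\<close>

definition free_scale :: "'k::field \<Rightarrow> ('a \<Rightarrow>\<^sub>0 'k) \<Rightarrow> ('a \<Rightarrow>\<^sub>0 'k)"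
  where "free_scale c t = Poly_Mapping.map ((*) c) t"

definition basis_vec :: "'a \<Rightarrow> ('a \<Rightarrow>\<^sub>0 'k::field)"
  where "basis_vec a = Poly_Mapping.single a 1"

lemma lookup_free_scale: "Poly_Mapping.lookup (free_scale c t) a = c * Poly_Mapping.lookup t a"
  by (simp add: free_scale_def Poly_Mapping.map.rep_eq when_def)

lemma vector_space_free_scale: "vector_space (free_scale :: 'k::field \<Rightarrow> ('a \<Rightarrow>\<^sub>0 'k) \<Rightarrow> _)"
  by unfold_locales
    (auto intro!: poly_mapping_eqI simp: lookup_free_scale lookup_add algebra_simps)

text \<open>The linear extension of \<open>f\<close> from basis vectors to the free space.\<close>

definition lin_ext :: "('k::field \<Rightarrow> 'v \<Rightarrow> 'v::ab_group_add) \<Rightarrow> ('a \<Rightarrow> 'v) \<Rightarrow> ('a \<Rightarrow>\<^sub>0 'k) \<Rightarrow> 'v"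
  where "lin_ext scl f t = (\<Sum>a\<in>Poly_Mapping.keys t. scl (Poly_Mapping.lookup t a) (f a))"

text \<open>Relations expressing linearity of \<open>x \<mapsto> basis_vec (\<iota> x)\<close>, where \<open>\<iota>\<close> inserts \<open>x\<close> in one
  tensor factor and leaves the other factors fixed.\<close>

definition slot_rels :: "('k::field \<Rightarrow> 'h \<Rightarrow> 'h::ab_group_add) \<Rightarrow> ('h \<Rightarrow> 'a) \<Rightarrow> ('a \<Rightarrow>\<^sub>0 'k) set"
  where "slot_rels scale \<iota> =
    {basis_vec (\<iota> (x + y)) - basis_vec (\<iota> x) - basis_vec (\<iota> y) | x y. True} \<union>
    {basis_vec (\<iota> (scale c x)) - free_scale c (basis_vec (\<iota> x)) | c x. True}"

definition tensor2_null :: "('k::field \<Rightarrow> 'h \<Rightarrow> 'h::ab_group_add) \<Rightarrow> ('h \<times> 'h \<Rightarrow>\<^sub>0 'k) set"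
  where "tensor2_null scale = module.span free_scale
    (\<Union>b. slot_rels scale (\<lambda>x. (x, b)) \<union> slot_rels scale (\<lambda>x. (b, x)))"

definition tensor3_null :: "('k::field \<Rightarrow> 'h \<Rightarrow> 'h::ab_group_add) \<Rightarrow> ('h \<times> 'h \<times> 'h \<Rightarrow>\<^sub>0 'k) set"
  where "tensor3_null scale = module.span free_scale
    (\<Union>b c. slot_rels scale (\<lambda>x. (x, b, c)) \<union> slot_rels scale (\<lambda>x. (b, x, c))
       \<union> slot_rels scale (\<lambda>x. (b, c, x)))"

definition tensor2_eq ::
    "('k::field \<Rightarrow> 'h \<Rightarrow> 'h::ab_group_add) \<Rightarrow> ('h \<times> 'h \<Rightarrow>\<^sub>0 'k) \<Rightarrow> ('h \<times> 'h \<Rightarrow>\<^sub>0 'k) \<Rightarrow> bool"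
  where "tensor2_eq scale t u \<longleftrightarrow> t - u \<in> tensor2_null scale"

definition tensor3_eq ::
    "('k::field \<Rightarrow> 'h \<Rightarrow> 'h::ab_group_add) \<Rightarrow>
     ('h \<times> 'h \<times> 'h \<Rightarrow>\<^sub>0 'k) \<Rightarrow> ('h \<times> 'h \<times> 'h \<Rightarrow>\<^sub>0 'k) \<Rightarrow> bool"
  where "tensor3_eq scale t u \<longleftrightarrow> t - u \<in> tensor3_null scale"

text \<open>The subspace of \<open>H \<otimes> H\<close> spanned by the pure tensors \<open>a \<otimes> b\<close> with \<open>(a, b) \<in> P\<close>. For
  subspaces \<open>U\<close>, \<open>W\<close> of \<open>H\<close>, \<open>tensor_span scale (U \<times> W)\<close> is \<open>U \<otimes> W\<close> inside \<open>H \<otimes> H\<close>.\<close>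

definition tensor_span ::
    "('k::field \<Rightarrow> 'h \<Rightarrow> 'h::ab_group_add) \<Rightarrow> ('h \<times> 'h) set \<Rightarrow> ('h \<times> 'h \<Rightarrow>\<^sub>0 'k) set"
  where "tensor_span scale P = {t. \<exists>u. tensor2_eq scale t u \<and> Poly_Mapping.keys u \<subseteq> P}"

text \<open>The product of \<open>H \<otimes> H\<close>: \<open>(a \<otimes> b) (c \<otimes> d) = ac \<otimes> bd\<close>.\<close>

definition tensor_mult ::
    "('h::ring_1 \<times> 'h \<Rightarrow>\<^sub>0 'k::field) \<Rightarrow> ('h \<times> 'h \<Rightarrow>\<^sub>0 'k) \<Rightarrow> ('h \<times> 'h \<Rightarrow>\<^sub>0 'k)"
  where "tensor_mult t u =
    lin_ext free_scale (\<lambda>(a, b). lin_ext free_scale (\<lambda>(c, d). basis_vec (a * c, b * d)) u) t"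


section \<open>Hopf algebras\<close>

locale algebra_over_field = vector_space scale
  for scale :: "'k::field \<Rightarrow> 'h::ring_1 \<Rightarrow> 'h" +
  assumes scale_mult_left: "scale c (x * y) = scale c x * y"
    and scale_mult_right: "scale c (x * y) = x * scale c y"

text \<open>\<open>\<Delta> x\<close> is a representative of the coproduct of \<open>x\<close>. Every linear map
  \<open>H \<rightarrow> H \<otimes> H\<close> arises in this way, and the axioms and all notions below do not depend on the choice
  of the representatives.\<close>

locale hopf_algebra = algebra_over_field scale
  for scale :: "'k::field \<Rightarrow> 'h::ring_1 \<Rightarrow> 'h" +
  fixes \<Delta> :: "'h \<Rightarrow> ('h \<times> 'h \<Rightarrow>\<^sub>0 'k)"
    and \<epsilon> :: "'h \<Rightarrow> 'k"
    and S :: "'h \<Rightarrow> 'h"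
  assumes comult_add: "tensor2_eq scale (\<Delta> (x + y)) (\<Delta> x + \<Delta> y)"
    and comult_scale: "tensor2_eq scale (\<Delta> (scale c x)) (free_scale c (\<Delta> x))"
    and counit_linear: "Vector_Spaces.linear scale (*) \<epsilon>"
    and coassoc: "tensor3_eq scale
          (lin_ext free_scale
             (\<lambda>(a, b). lin_ext free_scale (\<lambda>(a1, a2). basis_vec (a1, a2, b)) (\<Delta> a)) (\<Delta> x))
          (lin_ext free_scale
             (\<lambda>(a, b). lin_ext free_scale (\<lambda>(b1, b2). basis_vec (a, b1, b2)) (\<Delta> b)) (\<Delta> x))"
    and counit_left: "lin_ext scale (\<lambda>(a, b). scale (\<epsilon> a) b) (\<Delta> x) = x"
    and counit_right: "lin_ext scale (\<lambda>(a, b). scale (\<epsilon> b) a) (\<Delta> x) = x"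
    and comult_mult: "tensor2_eq scale (\<Delta> (x * y)) (tensor_mult (\<Delta> x) (\<Delta> y))"
    and comult_one: "tensor2_eq scale (\<Delta> 1) (basis_vec (1, 1))"
    and counit_mult: "\<epsilon> (x * y) = \<epsilon> x * \<epsilon> y"
    and counit_one: "\<epsilon> 1 = 1"
    and antipode_linear: "Vector_Spaces.linear scale scale S"
    and antipode_left: "lin_ext scale (\<lambda>(a, b). S a * b) (\<Delta> x) = scale (\<epsilon> x) 1"
    and antipode_right: "lin_ext scale (\<lambda>(a, b). a * S b) (\<Delta> x) = scale (\<epsilon> x) 1"


section \<open>Gradings\<close>

definition admissible_well_order :: "'g::comm_monoid_add rel \<Rightarrow> bool"
  where "admissible_well_order r \<longleftrightarrow> well_order_on UNIV r \<and>
    (\<forall>a b c. (a, b) \<in> r - Id \<longrightarrow> (c + a, c + b) \<in> r - Id)"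

definition homogeneous_decomposition ::
    "('g \<Rightarrow> 'h::ab_group_add set) \<Rightarrow> 'h \<Rightarrow> ('g \<Rightarrow>\<^sub>0 'h) \<Rightarrow> bool"
  where "homogeneous_decomposition V x f \<longleftrightarrow>
    (\<forall>\<gamma>. Poly_Mapping.lookup f \<gamma> \<in> V \<gamma>) \<and>
    x = (\<Sum>\<gamma>\<in>Poly_Mapping.keys f. Poly_Mapping.lookup f \<gamma>)"

definition homogeneous_element :: "('g \<Rightarrow> 'h set) \<Rightarrow> 'h \<Rightarrow> bool"
  where "homogeneous_element V x \<longleftrightarrow> (\<exists>\<gamma>. x \<in> V \<gamma>)"

definition homogeneous_subset :: "('g \<Rightarrow> 'h::ab_group_add set) \<Rightarrow> 'h set \<Rightarrow> bool"
  where "homogeneous_subset V A \<longleftrightarrow>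
    (\<forall>x\<in>A. \<exists>f. homogeneous_decomposition (\<lambda>\<gamma>. A \<inter> V \<gamma>) x f)"

text \<open>\<open>A\<^sub>+\<close>, for a homogeneous subspace \<open>A\<close> with its induced grading \<open>\<gamma> \<mapsto> A \<inter> V \<gamma>\<close>.\<close>

definition plus_part ::
    "('g::comm_monoid_add \<Rightarrow> 'h::ab_group_add set) \<Rightarrow> 'h set \<Rightarrow> 'h set"
  where "plus_part V A =
    {x. \<exists>f. homogeneous_decomposition (\<lambda>\<gamma>. A \<inter> V \<gamma>) x f \<and> Poly_Mapping.lookup f 0 = 0}"

locale graded_hopf_algebra = hopf_algebra scale \<Delta> \<epsilon> S
  for scale :: "'k::field \<Rightarrow> 'h::ring_1 \<Rightarrow> 'h" and \<Delta> \<epsilon> S +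
  fixes V :: "'g::comm_monoid_add \<Rightarrow> 'h set"
  assumes subspace_component: "subspace (V \<gamma>)"
    and direct_sum: "\<exists>!f. homogeneous_decomposition V x f"
    and graded_one: "1 \<in> V 0"
    and graded_mult: "x \<in> V \<alpha> \<Longrightarrow> y \<in> V \<beta> \<Longrightarrow> x * y \<in> V (\<alpha> + \<beta>)"
    and graded_comult: "x \<in> V \<gamma> \<Longrightarrow> \<Delta> x \<in> tensor_span scale (\<Union>{V \<alpha> \<times> V \<beta> | \<alpha> \<beta>. \<alpha> + \<beta> = \<gamma>})"
    and graded_counit: "x \<in> V \<gamma> \<Longrightarrow> \<gamma> \<noteq> 0 \<Longrightarrow> \<epsilon> x = 0"

locale connected_graded_hopf_algebra = graded_hopf_algebra scale \<Delta> \<epsilon> S V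
  for scale :: "'k::field \<Rightarrow> 'h::ring_1 \<Rightarrow> 'h" and \<Delta> \<epsilon> S
    and V :: "'g::comm_monoid_add \<Rightarrow> 'h set" +
  assumes connected: "dim (V 0) = 1"


section \<open>Subalgebras and coideals\<close>

definition subalgebra :: "('k::field \<Rightarrow> 'h::ring_1 \<Rightarrow> 'h) \<Rightarrow> 'h set \<Rightarrow> bool"
  where "subalgebra scale K \<longleftrightarrow>
    module.subspace scale K \<and> 1 \<in> K \<and> (\<forall>x\<in>K. \<forall>y\<in>K. x * y \<in> K)"

definition left_coideal ::
    "('k::field \<Rightarrow> 'h::ab_group_add \<Rightarrow> 'h) \<Rightarrow> ('h \<Rightarrow> ('h \<times> 'h \<Rightarrow>\<^sub>0 'k)) \<Rightarrow> 'h set \<Rightarrow> bool"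
  where "left_coideal scale \<Delta> K \<longleftrightarrow>
    module.subspace scale K \<and> (\<forall>x\<in>K. \<Delta> x \<in> tensor_span scale (UNIV \<times> K))"

definition right_coideal ::
    "('k::field \<Rightarrow> 'h::ab_group_add \<Rightarrow> 'h) \<Rightarrow> ('h \<Rightarrow> ('h \<times> 'h \<Rightarrow>\<^sub>0 'k)) \<Rightarrow> 'h set \<Rightarrow> bool"
  where "right_coideal scale \<Delta> K \<longleftrightarrow>
    module.subspace scale K \<and> (\<forall>x\<in>K. \<Delta> x \<in> tensor_span scale (K \<times> UNIV))"

definition hopf_subalgebra ::
    "('k::field \<Rightarrow> 'h::ring_1 \<Rightarrow> 'h) \<Rightarrow> ('h \<Rightarrow> ('h \<times> 'h \<Rightarrow>\<^sub>0 'k)) \<Rightarrow> ('h \<Rightarrow> 'h) \<Rightarrow> 'h set \<Rightarrow> bool"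
  where "hopf_subalgebra scale \<Delta> S K \<longleftrightarrow> subalgebra scale K \<and>
    (\<forall>x\<in>K. \<Delta> x \<in> tensor_span scale (K \<times> K)) \<and> (\<forall>x\<in>K. S x \<in> K)"


section \<open>PBW generators\<close>

text \<open>The family \<open>(w i)\<close>, \<open>i \<in> I\<close>, is a basis of \<open>A\<close> as a left (right) \<open>B\<close>-module: it lies in
  \<open>A\<close>, generates it, and is linearly independent, all sums being finite with coefficients in
  \<open>B\<close>.\<close>

definition left_module_basis ::
    "'h::ring_1 set \<Rightarrow> 'h set \<Rightarrow> 'i set \<Rightarrow> ('i \<Rightarrow> 'h) \<Rightarrow> bool"
  where "left_module_basis B A I w \<longleftrightarrow>
    w ` I \<subseteq> A \<and>
    (\<forall>a\<in>A. \<exists>c. Poly_Mapping.keys c \<subseteq> I \<and> range (Poly_Mapping.lookup c) \<subseteq> B \<and>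
       a = (\<Sum>i\<in>Poly_Mapping.keys c. Poly_Mapping.lookup c i * w i)) \<and>
    (\<forall>c. Poly_Mapping.keys c \<subseteq> I \<and> range (Poly_Mapping.lookup c) \<subseteq> B \<and>
       (\<Sum>i\<in>Poly_Mapping.keys c. Poly_Mapping.lookup c i * w i) = 0 \<longrightarrow> c = 0)"

definition right_module_basis ::
    "'h::ring_1 set \<Rightarrow> 'h set \<Rightarrow> 'i set \<Rightarrow> ('i \<Rightarrow> 'h) \<Rightarrow> bool"
  where "right_module_basis B A I w \<longleftrightarrow>
    w ` I \<subseteq> A \<and>
    (\<forall>a\<in>A. \<exists>c. Poly_Mapping.keys c \<subseteq> I \<and> range (Poly_Mapping.lookup c) \<subseteq> B \<and>
       a = (\<Sum>i\<in>Poly_Mapping.keys c. w i * Poly_Mapping.lookup c i)) \<and>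
    (\<forall>c. Poly_Mapping.keys c \<subseteq> I \<and> range (Poly_Mapping.lookup c) \<subseteq> B \<and>
       (\<Sum>i\<in>Poly_Mapping.keys c. w i * Poly_Mapping.lookup c i) = 0 \<longrightarrow> c = 0)"

text \<open>The expressions \<open>[(\<xi>\<^sub>1, r\<^sub>1), \<dots>, (\<xi>\<^sub>m, r\<^sub>m)]\<close> with \<open>\<xi>\<^sub>1 < \<dots> < \<xi>\<^sub>m\<close> in \<open>X\<close>, with zero
  exponents removed; \<open><\<close> is the strict part of the reflexive order \<open>r\<close>. The PBW
  monomials form a family indexed by these expressions, so that distinct expressions count as
  distinct basis elements.\<close>

definition pbw_exprs :: "'i set \<Rightarrow> 'i rel \<Rightarrow> ('i \<times> nat) list set"
  where "pbw_exprs X r = {es.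
    sorted_wrt (\<lambda>\<xi> \<eta>. (\<xi>, \<eta>) \<in> r - Id) (map fst es) \<and> (\<forall>(\<xi>, n)\<in>set es. \<xi> \<in> X \<and> n > 0)}"

definition pbw_monomial :: "('i \<Rightarrow> 'h::ring_1) \<Rightarrow> ('i \<times> nat) list \<Rightarrow> 'h"
  where "pbw_monomial z es = prod_list (map (\<lambda>(\<xi>, n). z \<xi> ^ n) es)"

definition pbw_generators ::
    "'h::ring_1 set \<Rightarrow> 'h set \<Rightarrow> 'i set \<Rightarrow> ('i \<Rightarrow> 'h) \<Rightarrow> 'i rel \<Rightarrow> bool"
  where "pbw_generators B A \<Xi> z r \<longleftrightarrow>
    z ` \<Xi> \<subseteq> A \<and> linear_order_on \<Xi> r \<and>
    left_module_basis B A (pbw_exprs \<Xi> r) (pbw_monomial z) \<and>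
    right_module_basis B A (pbw_exprs \<Xi> r) (pbw_monomial z)"

text \<open>The subalgebra generated over \<open>B\<close> by the \<open>z \<eta>\<close> with \<open>\<eta> \<unlhd> \<xi>\<close>.\<close>

definition subalgebra_upto ::
    "('k::field \<Rightarrow> 'h::ring_1 \<Rightarrow> 'h) \<Rightarrow> 'h set \<Rightarrow> 'i set \<Rightarrow> ('i \<Rightarrow> 'h) \<Rightarrow> 'i rel \<Rightarrow> 'i \<Rightarrow> 'h set"
  where "subalgebra_upto scale B \<Xi> z r \<xi> =
    subalgebra scale hull (B \<union> z ` {\<eta>\<in>\<Xi>. (\<eta>, \<xi>) \<in> r})"

end

theory Submission
  imports Defs
begin

text \<open>
  For a linear form \<open>f\<close> let \<open>R\<^sub>f x = \<Sum> f(x\<^sub>1) x\<^sub>2\<close>; a subspace \<open>K\<close> is a left coideal iff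
  \<open>R\<^sub>f K \<subseteq> K\<close> for all \<open>f\<close>. Right coideals are left coideals for the opposite comultiplication.

  Let \<open>C \<subseteq> A\<close> be a homogeneous left coideal subalgebra and \<open>z \<in> A - C\<close> homogeneous, such that
  all lower degree parts of \<open>R\<^sub>f z\<close> lie in \<open>C\<close>. Then \<open>\<Delta> z \<in> 1 \<otimes> z + H \<otimes> C\<close>, hence both \<open>D = C[z]\<close>
  and the closure \<open>E\<close> of \<open>C\<close> under \<open>ad z\<close> are coideal subalgebras, \<open>E\<close> agrees with \<open>C\<close> up to
  degree \<open>deg z\<close>, and \<open>D = \<Sum> E z\<^sup>n\<close>. In characteristic \<open>0\<close> the sum is direct: if \<open>n \<ge> 1\<close> is minimal
  with \<open>e z\<^sup>n \<in> \<Sum>\<^bsub>i<n\<^esub> E z\<^sup>i\<close> for some \<open>e \<noteq> 0\<close>, a slice at the top degree of \<open>e\<close> reduces to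
  \<open>e = 1\<close>, and if \<open>z\<^sup>n = g z\<^sup>n\<^sup>-\<^sup>1 + \<dots>\<close>, comparing coefficients of \<open>z\<^sup>n\<^sup>-\<^sup>1\<close> in slices gives
  \<open>\<Delta> u = 1 \<otimes> u\<close> for \<open>u = n z - g\<close>; so \<open>u\<close> is a scalar and \<open>z \<in> E\<close>.

  Testing the homogeneous elements of \<open>A\<close> in order of degree yields a chain from \<open>B\<close> to \<open>A\<close> with
  jumps \<open>E\<^sub>\<xi> \<subset> D\<^sub>\<xi> = E\<^sub>\<xi>[z\<^sub>\<xi>]\<close> as above. An element of \<open>E\<^sub>\<xi>\<close> of degree \<open>\<gamma>\<close> outside \<open>B\<close> lies in an
  earlier jump, whose generator has a degree dividing \<open>\<gamma>\<close>. As \<open>\<gamma>\<close> has finitely many divisors and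
  the generators of a given degree are well-ordered along the chain, the monomials span by induction;
  they are independent by looking at the largest letter, whatever the order of the factors.
\<close>

section \<open>Tensors and bilinear maps\<close>

text \<open>The generators are found in order of degree, but their places in the chain do not follow
  that order: closing under \<open>ad z\<close> leaves room between \<open>C\<close> and
  \<open>E\<close>, and elements tested later may have to be inserted there. So the order of the
  chain is not a well order by construction. Least generators are available only among those whose
  degrees divide a fixed degree, and the proof that the monomials span is arranged so that these
  suffice. Testing by degree is also what produces the shape of \<open>\<Delta> z\<close>: the lower
  parts of the slices of \<open>z\<close> were tested before \<open>z\<close>, so the chain has
  already decided where they lie. The construction uses the product and the grading, never the
  comultiplication. Hence the same chain serves \<open>\<Delta>\<close> and its opposite, and for
  Hopf subalgebras its members are coideals on both sides. Tensors occur as lists of pure tensors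
  seen through bilinear maps into \<open>H\<close>. The quotient defining the tensor product is met
  only when these lists are translated back at the end.\<close>

definition linear_form :: "('k::field \<Rightarrow> 'v::ab_group_add \<Rightarrow> 'v) \<Rightarrow> ('v \<Rightarrow> 'k) \<Rightarrow> bool"
  where "linear_form scale f \<longleftrightarrow>
    (\<forall>x y. f (x + y) = f x + f y) \<and> (\<forall>c x. f (scale c x) = c * f x)"

text \<open>The values lie in \<open>H\<close> and not in the field: slices, products and antipode
  sums are all of this kind, and a bilinear form is included as a multiple of 1.\<close>

definition bilinear_map ::
    "('k::field \<Rightarrow> 'h::ab_group_add \<Rightarrow> 'h) \<Rightarrow> ('h \<Rightarrow> 'h \<Rightarrow> 'h) \<Rightarrow> bool"
  where "bilinear_map scale \<beta> \<longleftrightarrow>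
    (\<forall>x y z. \<beta> (x + y) z = \<beta> x z + \<beta> y z) \<and> (\<forall>x y z. \<beta> x (y + z) = \<beta> x y + \<beta> x z) \<and>
    (\<forall>c x y. \<beta> (scale c x) y = scale c (\<beta> x y)) \<and> (\<forall>c x y. \<beta> x (scale c y) = scale c (\<beta> x y))"

text \<open>A list of pure tensors stands for its sum; by the universal property it is determined,
  as a tensor, by its values under bilinear maps.\<close>

definition tensor_eval :: "('a \<Rightarrow> 'b \<Rightarrow> 'h::comm_monoid_add) \<Rightarrow> ('a \<times> 'b) list \<Rightarrow> 'h"
  where "tensor_eval \<beta> ts = (\<Sum>(a, b)\<leftarrow>ts. \<beta> a b)"

lemma tensor_eval_simps [simp]:
  "tensor_eval \<beta> [] = 0"
  "tensor_eval \<beta> ((a, b) # ts) = \<beta> a b + tensor_eval \<beta> ts"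
  "tensor_eval \<beta> (ts @ us) = tensor_eval \<beta> ts + tensor_eval \<beta> us"
  by (simp_all add: tensor_eval_def)

lemma tensor_eval_swap: "tensor_eval \<beta> (map prod.swap ts) = tensor_eval (\<lambda>a b. \<beta> b a) ts"
  by (induction ts) auto

lemma tensor_eval_cong:
  "(\<And>a b. (a, b) \<in> set ts \<Longrightarrow> \<beta> a b = \<beta>' a b) \<Longrightarrow> tensor_eval \<beta> ts = tensor_eval \<beta>' ts"
  by (induction ts) auto

lemma linear_formI:
  assumes "\<And>x y. f (x + y) = f x + f y" "\<And>c x. f (scale c x) = c * f x"
  shows "linear_form scale f"
  using assms by (simp add: linear_form_def)

lemma linear_formD:
  assumes "linear_form scale f"
  shows "f (x + y) = f x + f y" "f (scale c x) = c * f x"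
  using assms by (auto simp: linear_form_def)

lemma linear_form_0: "linear_form scale f \<Longrightarrow> f 0 = 0"
  by (metis add_0 add_cancel_right_left linear_formD(1))

lemma linear_form_diff: "linear_form scale f \<Longrightarrow> f (x - y) = f x - f y"
  using linear_formD(1)[of scale f "x - y" y] by simp

lemma bilinear_mapI:
  assumes "\<And>x y z. \<beta> (x + y) z = \<beta> x z + \<beta> y z" "\<And>x y z. \<beta> x (y + z) = \<beta> x y + \<beta> x z"
    "\<And>c x y. \<beta> (scale c x) y = scale c (\<beta> x y)" "\<And>c x y. \<beta> x (scale c y) = scale c (\<beta> x y)"
  shows "bilinear_map scale \<beta>"
  using assms by (simp add: bilinear_map_def)

lemma bilinear_mapD:
  assumes "bilinear_map scale \<beta>"
  shows "\<beta> (x + y) z = \<beta> x z + \<beta> y z" "\<beta> x (y + z) = \<beta> x y + \<beta> x z"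
    "\<beta> (scale c x) y = scale c (\<beta> x y)" "\<beta> x (scale c y) = scale c (\<beta> x y)"
  using assms by (auto simp: bilinear_map_def)

lemma bilinear_map_flip: "bilinear_map scale \<beta> \<Longrightarrow> bilinear_map scale (\<lambda>a b. \<beta> b a)"
  by (simp add: bilinear_map_def)

lemma bilinear_map_0:
  assumes "bilinear_map scale \<beta>"
  shows "\<beta> 0 y = 0" "\<beta> x 0 = 0"
  using bilinear_mapD(1)[OF assms, of 0 0 y] bilinear_mapD(2)[OF assms, of x 0 0] by simp_all

lemma bilinear_map_diff:
  assumes "bilinear_map scale \<beta>"
  shows "\<beta> (x - y) z = \<beta> x z - \<beta> y z" "\<beta> x (y - z) = \<beta> x y - \<beta> x z"
  using bilinear_mapD(1)[OF assms, of "x - y" y z] bilinear_mapD(2)[OF assms, of x "y - z" z]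
  by simp_all

lemma bilinear_map_sum:
  assumes "bilinear_map scale \<beta>"
  shows "\<beta> (sum f I) z = (\<Sum>i\<in>I. \<beta> (f i) z)" "\<beta> x (sum f I) = (\<Sum>i\<in>I. \<beta> x (f i))"
  by (induction I rule: infinite_finite_induct)
    (simp_all add: bilinear_mapD[OF assms] bilinear_map_0[OF assms])

section \<open>Linear forms and the reduction of tensors\<close>

context vector_space
begin

lemma vector_space_pair_self: "vector_space_pair scale ((*) :: 'a \<Rightarrow> 'a \<Rightarrow> 'a)"
  by (intro vector_space_pair.intro vector_space_axioms) (unfold_locales, auto simp: algebra_simps)

lemma linear_form_extend:
  assumes "independent X"
  obtains f where "linear_form scale f" "\<And>x. x \<in> X \<Longrightarrow> f x = g x"
proof -
  interpret vp: vector_space_pair scale "(*) :: 'a \<Rightarrow> 'a \<Rightarrow> 'a"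
    by (rule vector_space_pair_self)
  obtain f where f: "Vector_Spaces.linear scale (*) f" "\<forall>x\<in>X. f x = g x"
    using vp.linear_independent_extend[OF assms] by blast
  interpret l: Vector_Spaces.linear scale "(*)" f by (rule f(1))
  have "linear_form scale f" by (simp add: linear_form_def l.add l.scale)
  with f(2) that show thesis by blast
qed

lemma separating_form:
  assumes "subspace N" "t \<notin> N"
  obtains f where "linear_form scale f" "\<And>x. x \<in> N \<Longrightarrow> f x = 0" "f t \<noteq> 0"
proof -
  obtain X where X: "X \<subseteq> N" "independent X" "N \<subseteq> span X"
    using maximal_independent_subset[of N] by blast
  have spX: "span X = N" using X assms(1) span_minimal by blast
  have "independent (insert t X)" using X(2) assms(2) spX independent_insertI by blast
  then obtain f where f: "linear_form scale f" "\<And>x. x \<in> insert t X \<Longrightarrow> f x = (if x = t then 1 else 0)"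
    using linear_form_extend[of "insert t X" "\<lambda>x. if x = t then 1 else 0"] by blast
  have "f x = 0" if "x \<in> span X" for x
    using that
  proof (induction rule: span_induct_alt)
    case base then show ?case by (rule linear_form_0[OF f(1)])
  next
    case (step c x y)
    then have "x \<noteq> t" using X(1) assms(2) by blast
    then show ?case using step f by (simp add: linear_formD)
  qed
  then show thesis using that f spX by simp
qed

lemma linear_form_eq_zero:
  assumes "\<And>f. linear_form scale f \<Longrightarrow> f x = 0"
  shows "x = 0"
proof (rule ccontr)
  assume "x \<noteq> 0"
  then have "x \<notin> {0}" by simp
  from separating_form[OF _ this] assms show False by auto
qed

lemma tensor_eval_add_fun:
  "tensor_eval (\<lambda>a b. \<beta> a b + \<beta>' a b) ts = tensor_eval \<beta> ts + (tensor_eval \<beta>' ts :: 'b)"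
  by (induction ts) (auto simp: algebra_simps)

lemma tensor_eval_scale_fun:
  "tensor_eval (\<lambda>a b. scale c (\<beta> a b)) ts = scale c (tensor_eval \<beta> ts)"
  by (induction ts) (auto simp: scale_right_distrib)

lemma tensor_eval_sum_fun:
  "tensor_eval (\<lambda>a b. \<Sum>i\<in>I. \<beta> i a b) ts = (\<Sum>i\<in>I. tensor_eval (\<beta> i) ts :: 'b)"
  by (induction ts) (auto simp: sum.distrib)

lemma tensor_eval_mem:
  assumes "subspace K" "\<And>a b. (a, b) \<in> set ts \<Longrightarrow> \<beta> a b \<in> K"
  shows "tensor_eval \<beta> ts \<in> K"
  using assms(2) by (induction ts) (auto simp: subspace_0[OF assms(1)] intro!: subspace_add[OF assms(1)])

lemma form_pairing_bilinear:
  "linear_form scale f \<Longrightarrow> bilinear_map scale (\<lambda>a b. scale (f a) b)"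
  by (rule bilinear_mapI) (simp_all add: linear_formD scale_left_distrib scale_right_distrib mult.commute)

text \<open>The first tensor factors are rewritten in a basis; then each second factor is the value of a
  coordinate functional on the tensor.\<close>

lemma tensor_reduce:
  assumes K: "subspace K"
    and f: "\<And>f. linear_form scale f \<Longrightarrow> tensor_eval (\<lambda>a b. scale (f a) b) ts \<in> K"
  obtains us where "\<And>\<beta>. bilinear_map scale \<beta> \<Longrightarrow> tensor_eval \<beta> ts = tensor_eval \<beta> us"
    "\<And>a b. (a, b) \<in> set us \<Longrightarrow> a \<in> span (fst ` set ts) \<and> b \<in> K"
proof -
  obtain X where X: "X \<subseteq> fst ` set ts" "independent X" "fst ` set ts \<subseteq> span X"
    using maximal_independent_subset[of "fst ` set ts"] by blast
  have fin: "finite X" using X(1) finite_subset by blast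
  then obtain xs where xs: "set xs = X" "distinct xs" using finite_distinct_list by blast
  \<comment> \<open>\<open>y x\<close> collects the second factors that go with the basis vector
    \<open>x\<close>, so the tensor becomes the sum of the \<open>x \<otimes> y x\<close>.\<close>
  define y where "y x = tensor_eval (\<lambda>a b. scale (representation X a x) b) ts" for x
  have y: "y x \<in> K" if "x \<in> X" for x
  proof -
    \<comment> \<open>A form on the whole space that extends the coordinate at \<open>x\<close>; it
      makes the hypothesis on forms applicable to \<open>y x\<close>.\<close>
    obtain g where g: "linear_form scale g" "\<And>u. u \<in> X \<Longrightarrow> g u = (if u = x then 1 else 0)"
      using linear_form_extend[OF X(2), of "\<lambda>u. if u = x then 1 else 0"] by blast
    have "a \<in> span X \<and> g a = representation X a x" if "a \<in> span X" for a
      using that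
    proof (induction rule: span_induct_alt)
      case base then show ?case
        by (simp add: linear_form_0[OF g(1)] representation_zero span_zero)
    next
      case (step c u v)
      then show ?case using g X(2)
        by (auto simp: linear_formD representation_add representation_scale span_base span_scale
            representation_basis span_add)
    qed
    then have "y x = tensor_eval (\<lambda>a b. scale (g a) b) ts"
      unfolding y_def using X(3) by (intro tensor_eval_cong) force
    then show ?thesis using f[OF g(1)] by simp
  qed
  show thesis
  proof (rule that[of "map (\<lambda>x. (x, y x)) xs"])
    fix \<beta> assume \<beta>: "bilinear_map scale \<beta>"
    have "tensor_eval \<beta> (map (\<lambda>x. (x, y x)) xs) = (\<Sum>x\<in>X. \<beta> x (y x))"
      using xs by (simp add: tensor_eval_def comp_def sum_list_distinct_conv_sum_set)
    also have "\<dots> = (\<Sum>x\<in>X. tensor_eval (\<lambda>a b. \<beta> (scale (representation X a x) x) b) ts)"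
    proof (rule sum.cong[OF refl])
      fix x
      have "\<beta> x (tensor_eval (\<lambda>a b. scale (representation X a x) b) us)
        = tensor_eval (\<lambda>a b. \<beta> (scale (representation X a x) x) b) us" for us
        by (induction us) (auto simp: bilinear_map_0[OF \<beta>] bilinear_mapD[OF \<beta>])
      then show "\<beta> x (y x) = tensor_eval (\<lambda>a b. \<beta> (scale (representation X a x) x) b) ts"
        by (simp add: y_def)
    qed
    also have "\<dots> = tensor_eval (\<lambda>a b. \<Sum>x\<in>X. \<beta> (scale (representation X a x) x) b) ts"
      by (simp add: tensor_eval_sum_fun)
    also have "\<dots> = tensor_eval \<beta> ts"
    proof (rule tensor_eval_cong)
      fix a b assume "(a, b) \<in> set ts"
      then have "a \<in> span X" using X(3) by force
      then have "(\<Sum>x\<in>X. scale (representation X a x) x) = a"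
        using sum_representation_eq[OF X(2) _ fin order_refl] by blast
      then show "(\<Sum>x\<in>X. \<beta> (scale (representation X a x) x) b) = \<beta> a b"
        by (metis bilinear_map_sum(1)[OF \<beta>])
    qed
    finally show "tensor_eval \<beta> ts = tensor_eval \<beta> (map (\<lambda>x. (x, y x)) xs)" by simp
  next
    fix a b assume "(a, b) \<in> set (map (\<lambda>x. (x, y x)) xs)"
    then show "a \<in> span (fst ` set ts) \<and> b \<in> K"
      using xs y by (auto intro!: span_base subsetD[OF X(1)])
  qed
qed

end

section \<open>Graded algebras\<close>

text \<open>The order is a pair of parameters because the theorem only provides the existence of
  some admissible order on the degrees.\<close>

locale graded_algebra = algebra_over_field scale + ord: wellorder le lt
  for scale :: "'k::field \<Rightarrow> 'h::ring_1 \<Rightarrow> 'h"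
    and le lt :: "'g::comm_monoid_add \<Rightarrow> 'g \<Rightarrow> bool" +
  fixes V :: "'g \<Rightarrow> 'h set"
  assumes lt_add: "lt \<alpha> \<beta> \<Longrightarrow> lt (\<gamma> + \<alpha>) (\<gamma> + \<beta>)"
    and subspace_V: "subspace (V \<gamma>)"
    and decomposition: "\<exists>!f. homogeneous_decomposition V x f"
    and one_V: "1 \<in> V 0"
    and mult_V: "x \<in> V \<alpha> \<Longrightarrow> y \<in> V \<beta> \<Longrightarrow> x * y \<in> V (\<alpha> + \<beta>)"
    and V_0: "V 0 = span {1}"
begin

lemma add_cancel:
  fixes \<alpha> \<beta> \<gamma> :: 'g
  shows "\<gamma> + \<alpha> = \<gamma> + \<beta> \<longleftrightarrow> \<alpha> = \<beta>"
proof
  assume "\<gamma> + \<alpha> = \<gamma> + \<beta>"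
  then have "\<not> lt \<alpha> \<beta>" "\<not> lt \<beta> \<alpha>" using lt_add[of \<alpha> \<beta> \<gamma>] lt_add[of \<beta> \<alpha> \<gamma>] by auto
  then show "\<alpha> = \<beta>" using ord.neq_iff by blast
qed simp

text \<open>A least element \<open>m\<close> strictly below 0 would give
  \<open>m + m < m\<close>.\<close>

lemma zero_le: "le 0 \<gamma>"
proof (rule ccontr)
  assume *: "\<not> le 0 \<gamma>"
  define m where "m = ord.Least (\<lambda>_. True)"
  have m: "le m \<gamma>" for \<gamma> unfolding m_def by (rule ord.Least_le) simp
  have "lt m 0" using m * by (metis ord.dual_order.strict_trans2 ord.not_less)
  from lt_add[OF this, of m] m[of "m + m"] show False by (simp add: ord.not_le)
qed

lemma le_add: "le \<alpha> (\<alpha> + \<beta>)"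
  using lt_add[of 0 \<beta> \<alpha>] zero_le[of \<beta>] by (metis add.right_neutral ord.le_less)

lemma le_add': "le \<beta> (\<alpha> + \<beta>)"
  using le_add[of \<beta> \<alpha>] by (simp add: add.commute)

lemma lt_add_self: "\<beta> \<noteq> 0 \<Longrightarrow> lt \<alpha> (\<alpha> + \<beta>)"
  using lt_add[of 0 \<beta> \<alpha>] zero_le[of \<beta>] by (metis add.right_neutral ord.le_less)

lemma add_eq_0_iff:
  fixes \<alpha> \<beta> :: 'g
  shows "\<alpha> + \<beta> = 0 \<longleftrightarrow> \<alpha> = 0 \<and> \<beta> = 0"
  using le_add[of \<alpha> \<beta>] le_add'[of \<beta> \<alpha>] zero_le[of \<alpha>] zero_le[of \<beta>] by auto

section \<open>Divisibility of degrees\<close>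

definition divisor :: "'g \<Rightarrow> 'g \<Rightarrow> bool"
  where "divisor \<alpha> \<gamma> \<longleftrightarrow> (\<exists>\<beta>. \<alpha> + \<beta> = \<gamma>)"

lemma divisor_add: "divisor \<alpha> \<beta> \<Longrightarrow> divisor \<alpha> (\<beta> + \<gamma>)"
  unfolding divisor_def by (metis add.assoc)

lemma divisor_add': "divisor \<alpha> \<gamma> \<Longrightarrow> divisor \<alpha> (\<beta> + \<gamma>)"
  using divisor_add[of \<alpha> \<gamma> \<beta>] by (simp add: add.commute)

lemma divisor_le: "divisor \<alpha> \<gamma> \<Longrightarrow> le \<alpha> \<gamma>"
  unfolding divisor_def using le_add by blast

lemma divisor_refl: "divisor \<alpha> \<alpha>"
  unfolding divisor_def by (rule exI[of _ 0]) simp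

text \<open>The complement \<open>\<gamma> - \<alpha>\<close> reverses the order, so the divisors of \<open>\<gamma>\<close> are well-ordered in both
  directions.\<close>

lemma finite_divisors: "finite {\<alpha>. divisor \<alpha> \<gamma>}"
proof (rule ccontr)
  assume inf: "infinite {\<alpha>. divisor \<alpha> \<gamma>}"
  \<comment> \<open>Any complement may be chosen; by cancellation there is only one.\<close>
  define co where "co \<alpha> = (SOME \<beta>. \<alpha> + \<beta> = \<gamma>)" for \<alpha>
  have co: "\<alpha> + co \<alpha> = \<gamma>" if "divisor \<alpha> \<gamma>" for \<alpha>
    unfolding co_def using that divisor_def by (metis (mono_tags) someI_ex)
  have anti: "le \<beta> \<alpha>" if \<alpha>: "divisor \<alpha> \<gamma>" and \<beta>: "divisor \<beta> \<gamma>" and le: "le (co \<alpha>) (co \<beta>)" for \<alpha> \<beta>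
  proof (rule ccontr)
    assume "\<not> le \<beta> \<alpha>"
    then have "lt (co \<beta> + \<alpha>) (co \<beta> + \<beta>)" by (simp add: lt_add ord.not_le)
    then have "lt (\<alpha> + co \<beta>) \<gamma>" using co[OF \<beta>] by (simp add: add.commute)
    moreover have "le (\<alpha> + co \<alpha>) (\<alpha> + co \<beta>)"
    proof (cases "co \<alpha> = co \<beta>")
      case False
      then have "lt (co \<alpha>) (co \<beta>)" using le ord.le_less by blast
      then show ?thesis using lt_add ord.less_imp_le by blast
    qed simp
    ultimately show False using co[OF \<alpha>] ord.leD by simp
  qed
  let ?S = "{\<alpha>. divisor \<alpha> \<gamma>}"
  \<comment> \<open>The divisors with finitely many divisors below them. An infinite
    \<open>?S\<close> would make \<open>T\<close> closed under successors, while reversing the order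
    through \<open>co\<close> gives \<open>T\<close> a greatest element.\<close>
  define T where "T = {\<alpha>\<in>?S. finite {\<beta>\<in>?S. le \<beta> \<alpha>}}"
  have step: "n \<in> T" if n: "n \<in> ?S" and fin: "finite {\<beta>\<in>?S. lt \<beta> n}" for n
  proof -
    have "{\<beta>\<in>?S. le \<beta> n} \<subseteq> insert n {\<beta>\<in>?S. lt \<beta> n}" by (auto simp: ord.le_less)
    then show ?thesis using n fin finite_subset by (auto simp: T_def)
  qed
  have T0: "0 \<in> T"
  proof (rule step)
    show "0 \<in> ?S" by (simp add: divisor_def)
    have "{\<beta>\<in>?S. lt \<beta> 0} \<subseteq> {}" using zero_le ord.not_less by blast
    then show "finite {\<beta>\<in>?S. lt \<beta> 0}" by (rule finite_subset) simp
  qed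
  \<comment> \<open>The least complement of an element of \<open>T\<close> belongs to the greatest
    element of \<open>T\<close>.\<close>
  define m' where "m' = ord.Least (\<lambda>\<beta>. \<beta> \<in> co ` T)"
  have "m' \<in> co ` T" unfolding m'_def using T0 by (rule ord.LeastI[OF imageI])
  then obtain m where m: "m \<in> T" "m' = co m" by blast
  have max: "le \<alpha> m" if "\<alpha> \<in> T" for \<alpha>
    using that m anti[of m \<alpha>] ord.Least_le[of "\<lambda>\<beta>. \<beta> \<in> co ` T" "co \<alpha>"]
    by (auto simp: T_def m'_def)
  have "finite {\<beta>\<in>?S. le \<beta> m}" using m by (auto simp: T_def)
  then have "\<not> ?S \<subseteq> {\<beta>\<in>?S. le \<beta> m}" using inf finite_subset by blast
  then obtain n0 where n0: "n0 \<in> ?S" "lt m n0" using ord.not_le by blast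
  \<comment> \<open>The immediate successor of \<open>m\<close> among the divisors. Its predecessors
    are those of \<open>m\<close> and \<open>m\<close> itself, so it belongs to \<open>T\<close> as
    well.\<close>
  define n where "n = ord.Least (\<lambda>n. n \<in> ?S \<and> lt m n)"
  have n: "n \<in> ?S \<and> lt m n" unfolding n_def by (rule ord.LeastI[of _ n0]) (use n0 in blast)
  have "{\<beta>\<in>?S. lt \<beta> n} \<subseteq> {\<beta>\<in>?S. le \<beta> m}"
    using ord.not_less_Least[of _ "\<lambda>n. n \<in> ?S \<and> lt m n"] ord.not_le unfolding n_def by blast
  then have "finite {\<beta>\<in>?S. lt \<beta> n}" using \<open>finite {\<beta>\<in>?S. le \<beta> m}\<close> finite_subset by blast
  then have "n \<in> T" using step n by blast
  then show False using max n by (meson ord.not_le)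
qed

section \<open>Homogeneous components\<close>

definition component :: "'g \<Rightarrow> 'h \<Rightarrow> 'h"
  where "component \<gamma> x = Poly_Mapping.lookup (THE f. homogeneous_decomposition V x f) \<gamma>"

lemma component_decomposition:
  "homogeneous_decomposition V x f \<Longrightarrow> component \<gamma> x = Poly_Mapping.lookup f \<gamma>"
  unfolding component_def using decomposition by (metis the1_equality)

lemma ex_decomposition: "\<exists>f. homogeneous_decomposition V x f"
  using decomposition by blast

lemma component_in: "component \<gamma> x \<in> V \<gamma>"
  using ex_decomposition[of x] by (auto simp: component_decomposition homogeneous_decomposition_def)

lemma component_eqI:
  assumes "finite G" "\<And>\<gamma>. \<gamma> \<in> G \<Longrightarrow> g \<gamma> \<in> V \<gamma>" "x = (\<Sum>\<gamma>\<in>G. g \<gamma>)"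
  shows "component \<gamma> x = (if \<gamma> \<in> G then g \<gamma> else 0)"
proof -
  let ?h = "\<lambda>\<gamma>. if \<gamma> \<in> G then g \<gamma> else 0"
  have fin: "finite {\<gamma>. ?h \<gamma> \<noteq> 0}" by (rule finite_subset[OF _ assms(1)]) (auto split: if_splits)
  define f where "f = Abs_poly_mapping ?h"
  have f: "Poly_Mapping.lookup f = ?h"
    unfolding f_def using fin by (rule lookup_Abs_poly_mapping)
  have "(\<Sum>\<gamma>\<in>Poly_Mapping.keys f. Poly_Mapping.lookup f \<gamma>) = (\<Sum>\<gamma>\<in>G. g \<gamma>)"
    by (rule sum.mono_neutral_cong_left) (auto simp: in_keys_iff f assms(1) split: if_splits)
  then have "homogeneous_decomposition V x f"
    unfolding homogeneous_decomposition_def using assms f subspace_0[OF subspace_V] by simp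
  then show ?thesis by (simp add: component_decomposition f)
qed

lemma finite_support: "finite {\<gamma>. component \<gamma> x \<noteq> 0}"
proof -
  obtain f where "homogeneous_decomposition V x f" using ex_decomposition by blast
  then show ?thesis
    using finite_keys[of f] by (simp add: component_decomposition keys.rep_eq)
qed

lemma sum_component: "(\<Sum>\<gamma>\<in>{\<gamma>. component \<gamma> x \<noteq> 0}. component \<gamma> x) = x"
proof -
  obtain f where f: "homogeneous_decomposition V x f" using ex_decomposition by blast
  have "(\<Sum>\<gamma>\<in>{\<gamma>. component \<gamma> x \<noteq> 0}. component \<gamma> x)
      = (\<Sum>\<gamma>\<in>Poly_Mapping.keys f. Poly_Mapping.lookup f \<gamma>)"
    by (simp only: component_decomposition[OF f] keys.rep_eq)
  also have "\<dots> = x" using f unfolding homogeneous_decomposition_def by (simp only:)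
  finally show ?thesis .
qed

lemma sum_component_superset:
  "finite G \<Longrightarrow> {\<gamma>. component \<gamma> x \<noteq> 0} \<subseteq> G \<Longrightarrow> (\<Sum>\<gamma>\<in>G. component \<gamma> x) = x"
  by (subst sum_component[of x, symmetric], rule sum.mono_neutral_right) auto

lemma component_V: "x \<in> V \<alpha> \<Longrightarrow> component \<gamma> x = (if \<gamma> = \<alpha> then x else 0)"
  using component_eqI[of "{\<alpha>}" "\<lambda>_. x" x] by auto

lemma component_add: "component \<gamma> (x + y) = component \<gamma> x + component \<gamma> y"
proof -
  let ?G = "{\<gamma>. component \<gamma> x \<noteq> 0} \<union> {\<gamma>. component \<gamma> y \<noteq> 0}"
  have fin: "finite ?G" using finite_support by simp
  have "component \<gamma> (x + y) = (if \<gamma> \<in> ?G then component \<gamma> x + component \<gamma> y else 0)"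
    by (rule component_eqI[OF fin])
      (use component_in subspace_V subspace_add fin in \<open>auto simp: sum.distrib sum_component_superset\<close>)
  then show ?thesis by auto
qed

lemma component_scale: "component \<gamma> (scale c x) = scale c (component \<gamma> x)"
proof -
  let ?G = "{\<gamma>. component \<gamma> x \<noteq> 0}"
  have "component \<gamma> (scale c x) = (if \<gamma> \<in> ?G then scale c (component \<gamma> x) else 0)"
    by (rule component_eqI[OF finite_support])
      (use component_in subspace_V subspace_scale in
        \<open>auto simp: sum_component scale_sum_right[symmetric]\<close>)
  then show ?thesis by auto
qed

lemma component_0 [simp]: "component \<gamma> 0 = 0"
  using component_add[of \<gamma> 0 0] by (metis add_0 add_cancel_right_left)

lemma component_diff: "component \<gamma> (x - y) = component \<gamma> x - component \<gamma> y"
  using component_add[of \<gamma> "x - y" y] by simp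

lemma component_sum: "component \<gamma> (sum f I) = (\<Sum>i\<in>I. component \<gamma> (f i))"
  by (induction I rule: infinite_finite_induct) (simp_all add: component_add)

lemma mem_subspace_components:
  assumes "subspace K" "\<And>\<gamma>. component \<gamma> x \<in> K"
  shows "x \<in> K"
  by (subst sum_component[of x, symmetric]) (rule subspace_sum[OF assms(1)], rule assms(2))

lemma component_mult_expand:
  "component \<gamma> (x * y) = (\<Sum>\<alpha>\<in>{\<alpha>. component \<alpha> x \<noteq> 0}. \<Sum>\<beta>\<in>{\<beta>. component \<beta> y \<noteq> 0}.
    if \<alpha> + \<beta> = \<gamma> then component \<alpha> x * component \<beta> y else 0)"
proof -
  have "x * y = (\<Sum>\<alpha>\<in>{\<alpha>. component \<alpha> x \<noteq> 0}. \<Sum>\<beta>\<in>{\<beta>. component \<beta> y \<noteq> 0}.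
      component \<alpha> x * component \<beta> y)"
    by (subst (1 2) sum_component[symmetric]) (rule sum_product)
  then have "component \<gamma> (x * y) = (\<Sum>\<alpha>\<in>{\<alpha>. component \<alpha> x \<noteq> 0}. \<Sum>\<beta>\<in>{\<beta>. component \<beta> y \<noteq> 0}.
      component \<gamma> (component \<alpha> x * component \<beta> y))"
    by (simp add: component_sum)
  also have "\<dots> = (\<Sum>\<alpha>\<in>{\<alpha>. component \<alpha> x \<noteq> 0}. \<Sum>\<beta>\<in>{\<beta>. component \<beta> y \<noteq> 0}.
      if \<alpha> + \<beta> = \<gamma> then component \<alpha> x * component \<beta> y else 0)"
    by (intro sum.cong refl, subst component_V[OF mult_V[OF component_in component_in]]) auto
  finally show ?thesis .
qed

lemma component_mult_mem:
  assumes Q: "subspace Q"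
    and "\<And>\<alpha> \<beta>. \<alpha> + \<beta> = \<gamma> \<Longrightarrow> component \<alpha> x * component \<beta> y \<in> Q"
  shows "component \<gamma> (x * y) \<in> Q"
  unfolding component_mult_expand
  by (intro subspace_sum[OF Q]) (auto intro: assms subspace_0[OF Q])

text \<open>By cancellation in the monoid, \<open>\<alpha>\<close> is the only degree of
  \<open>x\<close> that multiplication by \<open>y\<close> carries to
  \<open>\<alpha> + \<beta>\<close>.\<close>

lemma component_mult_right:
  assumes "y \<in> V \<beta>"
  shows "component (\<alpha> + \<beta>) (x * y) = component \<alpha> x * y"
proof -
  have "component (\<alpha> + \<beta>) (x * y) - component \<alpha> x * y
      = component (\<alpha> + \<beta>) ((x - component \<alpha> x) * y)"
    by (simp add: left_diff_distrib component_diff component_V[OF mult_V[OF component_in assms]])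
  also have "\<dots> \<in> {0}"
  proof (rule component_mult_mem)
    show "subspace {0}" by simp
    fix \<alpha>' \<beta>' assume eq: "\<alpha>' + \<beta>' = \<alpha> + \<beta>"
    show "component \<alpha>' (x - component \<alpha> x) * component \<beta>' y \<in> {0}"
      using eq by (auto simp: component_V[OF assms] component_diff component_V[OF component_in]
          add.commute[of _ \<beta>] add_cancel)
  qed
  finally show ?thesis by simp
qed

lemma component_mult_right_0:
  assumes "y \<in> V \<beta>" "\<not> divisor \<beta> \<gamma>"
  shows "component \<gamma> (x * y) = 0"
proof -
  have "component \<gamma> (x * y) \<in> {0}"
    by (rule component_mult_mem)
      (use assms in \<open>auto simp: component_V[OF assms(1)] divisor_def add.commute[of _ \<beta>]\<close>)
  then show ?thesis by simp
qed

lemma component_mult_left: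
  assumes "y \<in> V \<beta>"
  shows "component (\<beta> + \<alpha>) (y * x) = y * component \<alpha> x"
proof -
  have "component (\<beta> + \<alpha>) (y * x) - y * component \<alpha> x
      = component (\<beta> + \<alpha>) (y * (x - component \<alpha> x))"
    by (simp add: right_diff_distrib component_diff component_V[OF mult_V[OF assms component_in]])
  also have "\<dots> \<in> {0}"
  proof (rule component_mult_mem)
    show "subspace {0}" by simp
    fix \<alpha>' \<beta>' assume eq: "\<alpha>' + \<beta>' = \<beta> + \<alpha>"
    show "component \<alpha>' y * component \<beta>' (x - component \<alpha> x) \<in> {0}"
      using eq by (auto simp: component_V[OF assms] component_diff component_V[OF component_in]
          add_cancel)
  qed
  finally show ?thesis by simp
qed

lemma component_mult_left_0:
  assumes "y \<in> V \<beta>" "\<not> divisor \<beta> \<gamma>"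
  shows "component \<gamma> (y * x) = 0"
proof -
  have "component \<gamma> (y * x) \<in> {0}"
    by (rule component_mult_mem)
      (use assms in \<open>auto simp: component_V[OF assms(1)] divisor_def\<close>)
  then show ?thesis by simp
qed

lemma V_0_scalar: "x \<in> V 0 \<Longrightarrow> \<exists>c. x = scale c 1"
  unfolding V_0 by (auto simp: span_singleton)

lemma V_unique: "x \<in> V \<alpha> \<Longrightarrow> x \<in> V \<beta> \<Longrightarrow> x \<noteq> 0 \<Longrightarrow> \<alpha> = \<beta>"
  using component_V by metis

lemma power_V: "z \<in> V \<delta> \<Longrightarrow> \<exists>\<beta>. z ^ n \<in> V \<beta> \<and> (\<delta> \<noteq> 0 \<and> n > 0 \<longrightarrow> \<beta> \<noteq> 0)"
proof (induction n)
  case 0 then show ?case using one_V by auto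
next
  case (Suc n)
  then obtain \<beta> where "z ^ n \<in> V \<beta>" by blast
  then show ?case using Suc.prems mult_V[of z \<delta> "z ^ n" \<beta>] by (auto simp: add_eq_0_iff intro!: exI[of _ "\<delta> + \<beta>"])
qed

lemma subalgebra_subspace: "subalgebra scale K \<Longrightarrow> subspace K"
  by (simp add: subalgebra_def)

lemma subalgebra_mult: "subalgebra scale K \<Longrightarrow> x \<in> K \<Longrightarrow> y \<in> K \<Longrightarrow> x * y \<in> K"
  by (simp add: subalgebra_def)

lemma subalgebra_one: "subalgebra scale K \<Longrightarrow> 1 \<in> K"
  by (simp add: subalgebra_def)

lemma subalgebra_add: "subalgebra scale K \<Longrightarrow> x \<in> K \<Longrightarrow> y \<in> K \<Longrightarrow> x + y \<in> K"
  by (simp add: subalgebra_def subspace_add)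

lemma subalgebra_diff: "subalgebra scale K \<Longrightarrow> x \<in> K \<Longrightarrow> y \<in> K \<Longrightarrow> x - y \<in> K"
  by (simp add: subalgebra_def subspace_diff)

lemma subalgebra_zero: "subalgebra scale K \<Longrightarrow> 0 \<in> K"
  by (simp add: subalgebra_def subspace_0)

lemma subalgebra_scale: "subalgebra scale K \<Longrightarrow> x \<in> K \<Longrightarrow> scale c x \<in> K"
  by (simp add: subalgebra_def subspace_scale)

lemma subalgebra_power: "subalgebra scale K \<Longrightarrow> x \<in> K \<Longrightarrow> x ^ n \<in> K"
  by (induction n) (auto simp: subalgebra_one subalgebra_mult)

lemma V_0_subalgebra: "subalgebra scale K \<Longrightarrow> V 0 \<subseteq> K"
  unfolding V_0 by (intro span_minimal) (auto simp: subalgebra_one subalgebra_subspace)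

lemma subalgebraI:
  assumes "subspace K" "1 \<in> K" "\<And>x y. x \<in> K \<Longrightarrow> y \<in> K \<Longrightarrow> x * y \<in> K"
  shows "subalgebra scale K"
  using assms by (simp add: subalgebra_def)

lemma subalgebra_Inter: "(\<And>K. K \<in> \<K> \<Longrightarrow> subalgebra scale K) \<Longrightarrow> subalgebra scale (\<Inter>\<K>)"
  by (auto simp: subalgebra_def subspace_Inter)

lemma subalgebra_hull: "subalgebra scale (subalgebra scale hull X)"
  by (rule hull_in) (auto intro: subalgebra_Inter)

definition homogeneous_subalgebra :: "'h set \<Rightarrow> bool"
  where "homogeneous_subalgebra K \<longleftrightarrow> subalgebra scale K \<and> (\<forall>x\<in>K. \<forall>\<gamma>. component \<gamma> x \<in> K)"

end

section \<open>Adjoining an element\<close>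

context graded_algebra
begin

text \<open>Since \<open>z c = c z + [z, c]\<close>, sums of powers of \<open>z\<close> with left
  coefficients are closed under multiplication only if the coefficients are closed under
  \<open>ad z\<close>.\<close>

definition ad_closure :: "'h set \<Rightarrow> 'h \<Rightarrow> 'h set"
  where "ad_closure C z = \<Inter>{K. subalgebra scale K \<and> C \<subseteq> K \<and> (\<forall>x\<in>K. z * x - x * z \<in> K)}"

definition adjoin :: "'h set \<Rightarrow> 'h \<Rightarrow> 'h set"
  where "adjoin C z = subalgebra scale hull (insert z C)"

lemma ad_closure_subalgebra: "subalgebra scale (ad_closure C z)"
  unfolding ad_closure_def by (rule subalgebra_Inter) auto

lemma ad_closure_superset: "C \<subseteq> ad_closure C z"
  unfolding ad_closure_def by auto

lemma ad_closure_ad: "x \<in> ad_closure C z \<Longrightarrow> z * x - x * z \<in> ad_closure C z"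
  unfolding ad_closure_def by auto

lemma ad_closure_minimal:
  assumes "subalgebra scale K" "C \<subseteq> K" "\<And>x. x \<in> K \<Longrightarrow> z * x - x * z \<in> K"
  shows "ad_closure C z \<subseteq> K"
  unfolding ad_closure_def using assms by (intro Inter_lower) auto

lemma adjoin_subalgebra: "subalgebra scale (adjoin C z)"
  unfolding adjoin_def by (rule subalgebra_hull)

lemma adjoin_superset: "C \<subseteq> adjoin C z" "z \<in> adjoin C z"
  unfolding adjoin_def using hull_subset[of "insert z C" "subalgebra scale"] by auto

lemma adjoin_minimal: "subalgebra scale K \<Longrightarrow> C \<subseteq> K \<Longrightarrow> z \<in> K \<Longrightarrow> adjoin C z \<subseteq> K"
  unfolding adjoin_def by (rule hull_minimal) auto

lemma ad_closure_subset_adjoin: "ad_closure C z \<subseteq> adjoin C z"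
  by (rule ad_closure_minimal)
    (use adjoin_superset in \<open>auto intro!: adjoin_subalgebra subalgebra_diff subalgebra_mult\<close>)

text \<open>For use with minimality: a subalgebra generated by homogeneous data is contained in this
  part of itself, and is therefore homogeneous.\<close>

lemma component_closed_subalgebra:
  assumes K: "subalgebra scale K"
  shows "subalgebra scale {x\<in>K. \<forall>\<gamma>. component \<gamma> x \<in> K}"
proof (rule subalgebraI)
  show "subspace {x\<in>K. \<forall>\<gamma>. component \<gamma> x \<in> K}"
    by (rule subspaceI)
      (auto simp: component_add component_scale subalgebra_zero[OF K]
        intro: subalgebra_add[OF K] subalgebra_scale[OF K])
  show "1 \<in> {x\<in>K. \<forall>\<gamma>. component \<gamma> x \<in> K}"
    by (simp add: component_V[OF one_V] subalgebra_zero[OF K] subalgebra_one[OF K])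
  show "x * y \<in> {x\<in>K. \<forall>\<gamma>. component \<gamma> x \<in> K}"
    if "x \<in> {x\<in>K. \<forall>\<gamma>. component \<gamma> x \<in> K}" "y \<in> {x\<in>K. \<forall>\<gamma>. component \<gamma> x \<in> K}" for x y
    using that by (blast intro!: component_mult_mem[OF subalgebra_subspace[OF K]] subalgebra_mult[OF K])
qed

lemma component_ad_mem:
  assumes z: "z \<in> V \<delta>" and K: "subspace K"
    and ad: "\<And>\<beta>. \<delta> + \<beta> = \<gamma> \<Longrightarrow> z * component \<beta> x - component \<beta> x * z \<in> K"
  shows "component \<gamma> (z * x - x * z) \<in> K"
proof (cases "divisor \<delta> \<gamma>")
  case True
  then obtain \<beta> where \<beta>: "\<gamma> = \<delta> + \<beta>" unfolding divisor_def by blast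
  have "component \<gamma> (z * x - x * z) = z * component \<beta> x - component \<beta> x * z"
    using component_mult_left[OF z, of \<beta> x] component_mult_right[OF z, of \<beta> x]
    by (simp add: \<beta> component_diff add.commute)
  then show ?thesis using ad \<beta> by simp
next
  case False
  then show ?thesis
    by (simp add: component_diff component_mult_left_0[OF z] component_mult_right_0[OF z] subspace_0[OF K])
qed

lemma ad_closure_homogeneous:
  assumes C: "homogeneous_subalgebra C" and z: "z \<in> V \<delta>"
  shows "homogeneous_subalgebra (ad_closure C z)"
proof -
  let ?E = "ad_closure C z"
  have "?E \<subseteq> {x\<in>?E. \<forall>\<gamma>. component \<gamma> x \<in> ?E}"
  proof (rule ad_closure_minimal)
    show "C \<subseteq> {x\<in>?E. \<forall>\<gamma>. component \<gamma> x \<in> ?E}"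
      using C ad_closure_superset unfolding homogeneous_subalgebra_def by blast
    fix x assume "x \<in> {x\<in>?E. \<forall>\<gamma>. component \<gamma> x \<in> ?E}"
    then show "z * x - x * z \<in> {x\<in>?E. \<forall>\<gamma>. component \<gamma> x \<in> ?E}"
      using component_ad_mem[OF z subalgebra_subspace[OF ad_closure_subalgebra]] ad_closure_ad by simp
  qed (rule component_closed_subalgebra[OF ad_closure_subalgebra])
  then show ?thesis using ad_closure_subalgebra unfolding homogeneous_subalgebra_def by blast
qed

lemma adjoin_homogeneous:
  assumes C: "homogeneous_subalgebra C" and z: "z \<in> V \<delta>"
  shows "homogeneous_subalgebra (adjoin C z)"
proof -
  let ?E = "adjoin C z"
  have "?E \<subseteq> {x\<in>?E. \<forall>\<gamma>. component \<gamma> x \<in> ?E}"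
  proof (rule adjoin_minimal)
    show "C \<subseteq> {x\<in>?E. \<forall>\<gamma>. component \<gamma> x \<in> ?E}"
      using C adjoin_superset unfolding homogeneous_subalgebra_def by blast
    show "z \<in> {x\<in>?E. \<forall>\<gamma>. component \<gamma> x \<in> ?E}"
      by (auto simp: adjoin_superset component_V[OF z] subalgebra_zero[OF adjoin_subalgebra])
  qed (rule component_closed_subalgebra[OF adjoin_subalgebra])
  then show ?thesis using adjoin_subalgebra unfolding homogeneous_subalgebra_def by blast
qed

text \<open>If \<open>\<delta>\<close> does not divide \<open>\<gamma>\<close>, it divides no
  divisor of \<open>\<gamma>\<close>. So the elements whose components in degrees not divisible by
  \<open>\<delta>\<close> lie in \<open>C\<close> form a subalgebra; it contains \<open>C\<close>,
  and also \<open>z\<close>, whose only component has degree \<open>\<delta>\<close>.\<close>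

lemma adjoin_component_not_divisor:
  assumes C: "homogeneous_subalgebra C" and z: "z \<in> V \<delta>"
    and x: "x \<in> adjoin C z" and \<gamma>: "\<not> divisor \<delta> \<gamma>"
  shows "component \<gamma> x \<in> C"
proof -
  have sC: "subalgebra scale C" using C by (simp add: homogeneous_subalgebra_def)
  have "adjoin C z \<subseteq> {x. \<forall>\<gamma>. \<not> divisor \<delta> \<gamma> \<longrightarrow> component \<gamma> x \<in> C}"
  proof (rule adjoin_minimal[OF subalgebraI])
    show "subspace {x. \<forall>\<gamma>. \<not> divisor \<delta> \<gamma> \<longrightarrow> component \<gamma> x \<in> C}"
      by (rule subspaceI)
        (auto simp: component_add component_scale subalgebra_zero[OF sC]
          intro: subalgebra_add[OF sC] subalgebra_scale[OF sC])
    show "1 \<in> {x. \<forall>\<gamma>. \<not> divisor \<delta> \<gamma> \<longrightarrow> component \<gamma> x \<in> C}"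
      by (simp add: component_V[OF one_V] subalgebra_zero[OF sC] subalgebra_one[OF sC])
    show "x * y \<in> {x. \<forall>\<gamma>. \<not> divisor \<delta> \<gamma> \<longrightarrow> component \<gamma> x \<in> C}"
      if "x \<in> {x. \<forall>\<gamma>. \<not> divisor \<delta> \<gamma> \<longrightarrow> component \<gamma> x \<in> C}"
        "y \<in> {x. \<forall>\<gamma>. \<not> divisor \<delta> \<gamma> \<longrightarrow> component \<gamma> x \<in> C}" for x y
      using that divisor_add divisor_add'
      by (blast intro!: component_mult_mem[OF subalgebra_subspace[OF sC]] subalgebra_mult[OF sC])
    show "C \<subseteq> {x. \<forall>\<gamma>. \<not> divisor \<delta> \<gamma> \<longrightarrow> component \<gamma> x \<in> C}"
      using C by (auto simp: homogeneous_subalgebra_def)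
    show "z \<in> {x. \<forall>\<gamma>. \<not> divisor \<delta> \<gamma> \<longrightarrow> component \<gamma> x \<in> C}"
      by (auto simp: component_V[OF z] subalgebra_zero[OF sC] divisor_refl)
  qed
  then show ?thesis using x \<gamma> by blast
qed

text \<open>\<open>ad z\<close> raises degrees by \<open>\<delta>\<close>. Up to degree
  \<open>\<delta>\<close> it can therefore act only on components of degree 0, and these are
  scalars, which commute with \<open>z\<close>.\<close>

lemma ad_closure_component_le:
  assumes C: "homogeneous_subalgebra C" and z: "z \<in> V \<delta>"
    and x: "x \<in> ad_closure C z" and \<gamma>: "le \<gamma> \<delta>"
  shows "component \<gamma> x \<in> C"
proof -
  have sC: "subalgebra scale C" using C by (simp add: homogeneous_subalgebra_def)
  let ?K = "{x. \<forall>\<gamma>. le \<gamma> \<delta> \<longrightarrow> component \<gamma> x \<in> C}"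
  have "ad_closure C z \<subseteq> ?K"
  proof (rule ad_closure_minimal[OF subalgebraI])
    show "subspace ?K"
      by (rule subspaceI)
        (auto simp: component_add component_scale subalgebra_zero[OF sC]
          intro: subalgebra_add[OF sC] subalgebra_scale[OF sC])
    show "1 \<in> ?K"
      by (simp add: component_V[OF one_V] subalgebra_zero[OF sC] subalgebra_one[OF sC])
    show "x * y \<in> ?K" if "x \<in> ?K" "y \<in> ?K" for x y
      using that le_add le_add' ord.order_trans
      by (blast intro!: component_mult_mem[OF subalgebra_subspace[OF sC]] subalgebra_mult[OF sC])
    show "C \<subseteq> ?K"
      using C by (auto simp: homogeneous_subalgebra_def)
    fix x assume x: "x \<in> ?K"
    show "z * x - x * z \<in> ?K"
    proof (intro CollectI allI impI)
      fix \<gamma> assume \<gamma>: "le \<gamma> \<delta>"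
      show "component \<gamma> (z * x - x * z) \<in> C"
      proof (rule component_ad_mem[OF z subalgebra_subspace[OF sC]])
        fix \<beta> assume "\<delta> + \<beta> = \<gamma>"
        then have "\<beta> = 0" using \<gamma> lt_add_self[of \<beta> \<delta>] ord.leD by blast
        then obtain c where "component \<beta> x = scale c 1" using V_0_scalar component_in by blast
        then show "z * component \<beta> x - component \<beta> x * z \<in> C"
          using scale_mult_left[of c 1 z] scale_mult_right[of c z 1] by (simp add: subalgebra_zero[OF sC])
      qed
    qed
  qed
  then show ?thesis using x \<gamma> by blast
qed

text \<open>Polynomials in \<open>z\<close> with left coefficients; the index is a strict bound on
  the exponent, so that index 0 is the zero space and \<open>z ^ n\<close> first occurs at
  \<open>Suc n\<close>.\<close>

primrec filtration :: "'h set \<Rightarrow> 'h \<Rightarrow> nat \<Rightarrow> 'h set" where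
  "filtration E z 0 = {0}"
| "filtration E z (Suc n) = {y + e * z ^ n | y e. y \<in> filtration E z n \<and> e \<in> E}"

lemma filtration_SucI: "y \<in> filtration E z n \<Longrightarrow> e \<in> E \<Longrightarrow> y + e * z ^ n \<in> filtration E z (Suc n)"
  by auto

context
  fixes E :: "'h set" and z :: 'h
  assumes E: "subalgebra scale E"
begin

lemma filtration_subspace: "subspace (filtration E z n)"
proof (induction n)
  case (Suc n)
  show ?case
  proof (rule subspaceI)
    show "0 \<in> filtration E z (Suc n)"
      using filtration_SucI[OF subspace_0[OF Suc] subalgebra_zero[OF E]] by simp
    fix x assume x: "x \<in> filtration E z (Suc n)"
    then obtain y e where x': "x = y + e * z ^ n" "y \<in> filtration E z n" "e \<in> E" by auto
    show "scale c x \<in> filtration E z (Suc n)" for c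
      using filtration_SucI[OF subspace_scale[OF Suc x'(2)] subalgebra_scale[OF E x'(3)], of c c]
      by (simp add: x' scale_right_distrib scale_mult_left)
    fix x2 assume "x2 \<in> filtration E z (Suc n)"
    then obtain y2 e2 where x2: "x2 = y2 + e2 * z ^ n" "y2 \<in> filtration E z n" "e2 \<in> E" by auto
    show "x + x2 \<in> filtration E z (Suc n)"
      using filtration_SucI[OF subspace_add[OF Suc x'(2) x2(2)] subalgebra_add[OF E x'(3) x2(3)]]
      by (simp add: x' x2 algebra_simps)
  qed
qed simp

lemmas filtration_add = subspace_add[OF filtration_subspace]
  and filtration_diff = subspace_diff[OF filtration_subspace]
  and filtration_zero = subspace_0[OF filtration_subspace]

lemma filtration_mono: "m \<le> n \<Longrightarrow> x \<in> filtration E z m \<Longrightarrow> x \<in> filtration E z n"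
proof (induction n rule: dec_induct)
  case (step n)
  then show ?case using filtration_SucI[OF _ subalgebra_zero[OF E], of x z n] by simp
qed

lemma filtration_top: "e \<in> E \<Longrightarrow> e * z ^ n \<in> filtration E z (Suc n)"
  using filtration_SucI[OF filtration_zero] by simp

lemma filtration_base: "e \<in> E \<Longrightarrow> e \<in> filtration E z (Suc n)"
  using filtration_mono[OF _ filtration_top[of e 0]] by (simp del: filtration.simps)

lemma filtration_mult_left: "e \<in> E \<Longrightarrow> x \<in> filtration E z n \<Longrightarrow> e * x \<in> filtration E z n"
proof (induction n arbitrary: x)
  case (Suc n)
  then obtain y f where x: "x = y + f * z ^ n" "y \<in> filtration E z n" "f \<in> E" by auto
  show ?case
    using filtration_SucI[OF Suc.IH[OF Suc.prems(1) x(2)] subalgebra_mult[OF E Suc.prems(1) x(3)]]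
    by (simp add: x(1) algebra_simps)
qed simp

lemma filtration_shift: "x \<in> filtration E z n \<Longrightarrow> x * z \<in> filtration E z (Suc n)"
proof (induction n arbitrary: x)
  case (Suc n)
  then obtain y f where x: "x = y + f * z ^ n" "y \<in> filtration E z n" "f \<in> E" by auto
  show ?case
    using filtration_SucI[OF Suc.IH[OF x(2)] x(3)] by (simp add: x(1) algebra_simps power_commutes)
qed (simp add: subalgebra_zero[OF E])

lemma filtration_shift_power: "x \<in> filtration E z n \<Longrightarrow> x * z ^ m \<in> filtration E z (n + m)"
proof (induction m)
  case (Suc m)
  then show ?case using filtration_shift[of "x * z ^ m" "n + m"] by (simp add: mult.assoc power_commutes)
qed simp

lemma filtration_component:
  assumes hom: "\<And>x \<gamma>. x \<in> E \<Longrightarrow> component \<gamma> x \<in> E" and z: "z \<in> V \<delta>"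
  shows "x \<in> filtration E z n \<Longrightarrow> component \<gamma> x \<in> filtration E z n"
proof (induction n arbitrary: x)
  case (Suc n)
  then obtain y e where x: "x = y + e * z ^ n" "y \<in> filtration E z n" "e \<in> E" by auto
  obtain \<beta> where \<beta>: "z ^ n \<in> V \<beta>" using power_V[OF z] by blast
  have "\<exists>e'\<in>E. component \<gamma> (e * z ^ n) = e' * z ^ n"
  proof (cases "divisor \<beta> \<gamma>")
    case True
    then obtain \<alpha> where "\<gamma> = \<alpha> + \<beta>" unfolding divisor_def by (metis add.commute)
    then show ?thesis using component_mult_right[OF \<beta>] hom[OF x(3)] by blast
  next
    case False
    then show ?thesis using component_mult_right_0[OF \<beta>] subalgebra_zero[OF E] by force
  qed
  then show ?case using filtration_SucI[OF Suc.IH[OF x(2)]] by (force simp: x(1) component_add)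
qed simp

context
  assumes ad: "\<And>x. x \<in> E \<Longrightarrow> z * x - x * z \<in> E"
begin

text \<open>Each passage of one factor \<open>z\<close> across \<open>e\<close> leaves the
  commutator of \<open>z\<close> and \<open>e\<close>, which is again in \<open>E\<close> and comes
  with one power of \<open>z\<close> fewer.\<close>

lemma power_commutator: "e \<in> E \<Longrightarrow> z ^ n * e - e * z ^ n \<in> filtration E z n"
proof (induction n arbitrary: e)
  case (Suc n)
  define e' where "e' = z * e - e * z"
  have e': "e' \<in> E" unfolding e'_def by (rule ad[OF Suc.prems])
  have "z * (z ^ n * w) = z ^ n * (z * w)" for w by (metis mult.assoc power_commutes)
  then have "z ^ Suc n * e - e * z ^ Suc n
      = (z ^ n * e' - e' * z ^ n) + e' * z ^ n + (z ^ n * e - e * z ^ n) * z"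
    by (simp add: e'_def algebra_simps power_commutes power_Suc2[of z n] del: power_Suc)
  also have "\<dots> \<in> filtration E z (Suc n)"
    by (intro filtration_add filtration_shift Suc.IH Suc.prems filtration_top e'
        filtration_mono[OF _ Suc.IH[OF e']]) simp
  finally show ?case .
qed simp

lemma filtration_mult_right: "x \<in> filtration E z n \<Longrightarrow> e \<in> E \<Longrightarrow> x * e \<in> filtration E z n"
proof (induction n arbitrary: x)
  case (Suc n)
  then obtain y f where x: "x = y + f * z ^ n" "y \<in> filtration E z n" "f \<in> E" by auto
  have "x * e = y * e + f * (z ^ n * e - e * z ^ n) + (f * e) * z ^ n"
    by (simp add: x(1) algebra_simps)
  then show ?case
    using filtration_SucI[OF filtration_add[OF Suc.IH[OF x(2) Suc.prems(2)]
          filtration_mult_left[OF x(3) power_commutator[OF Suc.prems(2)]]]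
        subalgebra_mult[OF E x(3) Suc.prems(2)]] by simp
qed simp

lemma filtration_mult:
  "x \<in> filtration E z m \<Longrightarrow> y \<in> filtration E z n \<Longrightarrow> x * y \<in> filtration E z (m + n)"
proof (induction n arbitrary: y)
  case (Suc n)
  then obtain y' e where y: "y = y' + e * z ^ n" "y' \<in> filtration E z n" "e \<in> E" by auto
  have "x * y' + (x * e) * z ^ n \<in> filtration E z (m + n)"
    by (intro filtration_add Suc.IH Suc.prems y filtration_shift_power filtration_mult_right)
  then show ?case using filtration_mono[of "m + n" "m + Suc n"] by (simp add: y algebra_simps)
qed (simp add: filtration_zero)

lemma filtration_Union_subalgebra: "subalgebra scale (\<Union>n. filtration E z n)"
proof (rule subalgebraI)
  show "subspace (\<Union>n. filtration E z n)"
  proof (rule subspaceI)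
    show "0 \<in> (\<Union>n. filtration E z n)" using filtration_zero by blast
    show "x + y \<in> (\<Union>n. filtration E z n)"
      if "x \<in> (\<Union>n. filtration E z n)" "y \<in> (\<Union>n. filtration E z n)" for x y
    proof -
      from that obtain m n where "x \<in> filtration E z m" "y \<in> filtration E z n" by blast
      then have "x + y \<in> filtration E z (max m n)"
        using filtration_mono[of m "max m n" x] filtration_mono[of n "max m n" y] filtration_add by simp
      then show ?thesis by blast
    qed
    show "scale c x \<in> (\<Union>n. filtration E z n)" if "x \<in> (\<Union>n. filtration E z n)" for c x
      using that subspace_scale[OF filtration_subspace] by blast
  qed
  show "1 \<in> (\<Union>n. filtration E z n)" using filtration_base[OF subalgebra_one[OF E]] by blast
  show "x * y \<in> (\<Union>n. filtration E z n)"
    if "x \<in> (\<Union>n. filtration E z n)" "y \<in> (\<Union>n. filtration E z n)" for x y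
    using that filtration_mult by blast
qed

end

end

text \<open>The union is a subalgebra because its coefficients are closed under \<open>ad z\<close>;
  conversely, commutators with \<open>z\<close> never lead out of \<open>adjoin C z\<close>.\<close>

lemma adjoin_eq_filtration: "adjoin C z = (\<Union>n. filtration (ad_closure C z) z n)"
proof
  let ?E = "ad_closure C z"
  show "adjoin C z \<subseteq> (\<Union>n. filtration ?E z n)"
  proof (rule adjoin_minimal)
    show "subalgebra scale (\<Union>n. filtration ?E z n)"
      by (rule filtration_Union_subalgebra[OF ad_closure_subalgebra ad_closure_ad])
    show "C \<subseteq> (\<Union>n. filtration ?E z n)"
    proof
      fix x assume "x \<in> C"
      then have "x \<in> filtration ?E z (Suc 0)"
        using filtration_base[OF ad_closure_subalgebra[of C z]] ad_closure_superset by blast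
      then show "x \<in> (\<Union>n. filtration ?E z n)" by (rule UN_I[OF UNIV_I])
    qed
    show "z \<in> (\<Union>n. filtration ?E z n)"
    proof
      show "z \<in> filtration ?E z (Suc 1)"
        using filtration_top[OF ad_closure_subalgebra[of C z]
            subalgebra_one[OF ad_closure_subalgebra[of C z]], of z 1]
        by (simp only: mult_1_left power_one_right)
    qed (rule UNIV_I)
  qed
  have "filtration ?E z n \<subseteq> adjoin C z" for n
  proof (induction n)
    case (Suc n)
    then show ?case
      using ad_closure_subset_adjoin adjoin_superset(2)
      by (auto intro!: subalgebra_add[OF adjoin_subalgebra] subalgebra_mult[OF adjoin_subalgebra]
          subalgebra_power[OF adjoin_subalgebra])
  qed (simp add: subalgebra_zero[OF adjoin_subalgebra])
  then show "(\<Union>n. filtration ?E z n) \<subseteq> adjoin C z" by blast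
qed

end

section \<open>Slices of the comultiplication\<close>

definition tensor_equiv ::
    "('k::field \<Rightarrow> 'h::ab_group_add \<Rightarrow> 'h) \<Rightarrow> ('h \<times> 'h) list \<Rightarrow> ('h \<times> 'h) list \<Rightarrow> bool"
  where "tensor_equiv scale ts us \<longleftrightarrow>
    (\<forall>\<beta>. bilinear_map scale \<beta> \<longrightarrow> tensor_eval \<beta> ts = tensor_eval \<beta> us)"

lemma tensor_equivD:
  "tensor_equiv scale ts us \<Longrightarrow> bilinear_map scale \<beta> \<Longrightarrow> tensor_eval \<beta> ts = tensor_eval \<beta> us"
  by (simp add: tensor_equiv_def)

lemma tensor_eval_commute:
  "tensor_eval (\<lambda>a b. tensor_eval (\<lambda>c d. G a b c d) us) ts
    = tensor_eval (\<lambda>c d. tensor_eval (\<lambda>a b. G a b c d) ts) us"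
proof (induction ts)
  case Nil
  have "tensor_eval (\<lambda>c d. 0) us = 0" by (induction us) auto
  then show ?case by simp
next
  case (Cons p ts)
  obtain a b where p: "p = (a, b)" by fastforce
  have "tensor_eval (\<lambda>c d. G a b c d + F c d) us = tensor_eval (G a b) us + tensor_eval F us" for F
    by (induction us) (auto simp: algebra_simps)
  then show ?case using Cons by (simp add: p)
qed

lemma tensor_eval_mult_right:
  fixes \<beta> :: "'a \<Rightarrow> 'b \<Rightarrow> 'h::ring"
  shows "tensor_eval \<beta> ts * d = tensor_eval (\<lambda>a b. \<beta> a b * d) ts"
  by (induction ts) (auto simp: algebra_simps)

lemma tensor_eval_mult_left:
  fixes \<beta> :: "'a \<Rightarrow> 'b \<Rightarrow> 'h::ring"
  shows "d * tensor_eval \<beta> ts = tensor_eval (\<lambda>a b. d * \<beta> a b) ts"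
  by (induction ts) (auto simp: algebra_simps)

text \<open>The comultiplication is given by lists of pure tensors, so the axioms only involve the values
  of bilinear maps on these lists.\<close>

locale graded_bialgebra = graded_algebra scale le lt V
  for scale :: "'k::field_char_0 \<Rightarrow> 'h::ring_1 \<Rightarrow> 'h"
    and le lt :: "'g::comm_monoid_add \<Rightarrow> 'g \<Rightarrow> bool"
    and V :: "'g \<Rightarrow> 'h set" +
  fixes cop :: "'h \<Rightarrow> ('h \<times> 'h) list" and \<epsilon> :: "'h \<Rightarrow> 'k"
  assumes cop_add: "bilinear_map scale \<beta> \<Longrightarrow>
      tensor_eval \<beta> (cop (x + y)) = tensor_eval \<beta> (cop x) + tensor_eval \<beta> (cop y)"
    and cop_scale: "bilinear_map scale \<beta> \<Longrightarrow>
      tensor_eval \<beta> (cop (scale c x)) = scale c (tensor_eval \<beta> (cop x))"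
    and cop_one: "bilinear_map scale \<beta> \<Longrightarrow> tensor_eval \<beta> (cop 1) = \<beta> 1 1"
    and cop_mult: "bilinear_map scale \<beta> \<Longrightarrow> tensor_eval \<beta> (cop (x * y)) =
      tensor_eval (\<lambda>a b. tensor_eval (\<lambda>c d. \<beta> (a * c) (b * d)) (cop y)) (cop x)"
    and counit_form: "linear_form scale \<epsilon>"
    and counit_one: "\<epsilon> 1 = 1"
    and counit_left: "tensor_eval (\<lambda>a b. scale (\<epsilon> a) b) (cop x) = x"
    and counit_right: "tensor_eval (\<lambda>a b. scale (\<epsilon> b) a) (cop x) = x"
    and counit_graded: "x \<in> V \<gamma> \<Longrightarrow> \<gamma> \<noteq> 0 \<Longrightarrow> \<epsilon> x = 0"
    and cop_graded: "x \<in> V \<gamma> \<Longrightarrow> \<exists>us. tensor_equiv scale (cop x) us \<and>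
      (\<forall>(a, b)\<in>set us. \<exists>\<alpha> \<beta>. a \<in> V \<alpha> \<and> b \<in> V \<beta> \<and> \<alpha> + \<beta> = \<gamma>)"
begin

text \<open>The operator \<open>R\<^sub>f\<close> of the overview.\<close>

definition slice :: "('h \<Rightarrow> 'k) \<Rightarrow> 'h \<Rightarrow> 'h"
  where "slice f x = tensor_eval (\<lambda>a b. scale (f a) b) (cop x)"

definition stable :: "'h set \<Rightarrow> bool"
  where "stable K \<longleftrightarrow> (\<forall>x\<in>K. \<forall>f. linear_form scale f \<longrightarrow> slice f x \<in> K)"

lemma stableD: "stable K \<Longrightarrow> x \<in> K \<Longrightarrow> linear_form scale f \<Longrightarrow> slice f x \<in> K"
  by (simp add: stable_def)

lemma slice_add: "linear_form scale f \<Longrightarrow> slice f (x + y) = slice f x + slice f y"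
  unfolding slice_def by (rule cop_add[OF form_pairing_bilinear])

lemma slice_scale: "linear_form scale f \<Longrightarrow> slice f (scale c x) = scale c (slice f x)"
  unfolding slice_def by (rule cop_scale[OF form_pairing_bilinear])

lemma slice_zero: "linear_form scale f \<Longrightarrow> slice f 0 = 0"
  using slice_scale[of f 0 0] by simp

lemma slice_diff: "linear_form scale f \<Longrightarrow> slice f (x - y) = slice f x - slice f y"
  using slice_add[of f "x - y" y] by simp

lemma slice_one: "linear_form scale f \<Longrightarrow> slice f 1 = scale (f 1) 1"
  unfolding slice_def by (rule cop_one[OF form_pairing_bilinear])

lemma slice_sum: "linear_form scale f \<Longrightarrow> slice f (sum g I) = (\<Sum>i\<in>I. slice f (g i))"
  by (induction I rule: infinite_finite_induct) (simp_all add: slice_add slice_zero)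

text \<open>Apply \<open>f\<close> to the right counit axiom. Thus the slices of an element
  determine all values of forms on it.\<close>

lemma counit_slice:
  assumes "linear_form scale f"
  shows "\<epsilon> (slice f x) = f x"
proof -
  have "\<epsilon> (tensor_eval (\<lambda>a b. scale (f a) b) ts) = f (tensor_eval (\<lambda>a b. scale (\<epsilon> b) a) ts)" for ts
    by (induction ts)
      (auto simp: linear_form_0[OF assms] linear_form_0[OF counit_form] linear_formD[OF assms]
        linear_formD[OF counit_form] mult.commute)
  then show ?thesis by (simp add: slice_def counit_right)
qed

lemma linear_form_mult_right: "linear_form scale f \<Longrightarrow> linear_form scale (\<lambda>a. f (a * h))"
  by (rule linear_formI) (simp_all add: distrib_right linear_formD flip: scale_mult_left)

lemma linear_form_mult_left: "linear_form scale f \<Longrightarrow> linear_form scale (\<lambda>a. f (h * a))"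
  by (rule linear_formI) (simp_all add: distrib_left linear_formD flip: scale_mult_right)

text \<open>The list \<open>us\<close> may be any representation of \<open>\<Delta> x\<close>, in
  particular one whose second factors lie in a prescribed subspace. This is how membership of slices
  of products is proved.\<close>

lemma slice_mult_right:
  assumes f: "linear_form scale f" and us: "tensor_equiv scale (cop x) us"
  shows "slice f (y * x) = tensor_eval (\<lambda>h d. slice (\<lambda>a. f (a * h)) y * d) us"
proof -
  have "slice f (y * x) =
      tensor_eval (\<lambda>a b. tensor_eval (\<lambda>h d. scale (f (a * h)) (b * d)) (cop x)) (cop y)"
    unfolding slice_def by (rule cop_mult[OF form_pairing_bilinear[OF f]])
  also have "\<dots> = tensor_eval (\<lambda>a b. tensor_eval (\<lambda>h d. scale (f (a * h)) (b * d)) us) (cop y)"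
    by (intro tensor_eval_cong tensor_equivD[OF us] bilinear_mapI)
      (simp_all add: distrib_left linear_formD[OF f] scale_left_distrib scale_right_distrib
        mult.commute flip: scale_mult_right)
  also have "\<dots> = tensor_eval (\<lambda>h d. slice (\<lambda>a. f (a * h)) y * d) us"
    unfolding slice_def tensor_eval_mult_right
    by (subst tensor_eval_commute, intro tensor_eval_cong) (simp add: scale_mult_left)
  finally show ?thesis .
qed

lemma slice_mult_left:
  assumes f: "linear_form scale f" and us: "tensor_equiv scale (cop x) us"
  shows "slice f (x * y) = tensor_eval (\<lambda>h d. d * slice (\<lambda>a. f (h * a)) y) us"
proof -
  have "slice f (x * y) =
      tensor_eval (\<lambda>h d. tensor_eval (\<lambda>a b. scale (f (h * a)) (d * b)) (cop y)) (cop x)"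
    unfolding slice_def by (rule cop_mult[OF form_pairing_bilinear[OF f]])
  also have "\<dots> = tensor_eval (\<lambda>h d. d * slice (\<lambda>a. f (h * a)) y) (cop x)"
    by (simp add: slice_def tensor_eval_mult_left scale_mult_right)
  also have "\<dots> = tensor_eval (\<lambda>h d. d * slice (\<lambda>a. f (h * a)) y) us"
  proof (rule tensor_equivD[OF us bilinear_mapI])
    fix h h' d
    have "slice (\<lambda>a. f ((h + h') * a)) y = slice (\<lambda>a. f (h * a)) y + slice (\<lambda>a. f (h' * a)) y"
      unfolding slice_def tensor_eval_add_fun[symmetric]
      by (intro tensor_eval_cong) (simp add: linear_formD[OF f] distrib_right scale_left_distrib)
    then show "d * slice (\<lambda>a. f ((h + h') * a)) y
        = d * slice (\<lambda>a. f (h * a)) y + d * slice (\<lambda>a. f (h' * a)) y"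
      by (simp add: distrib_left)
  next
    fix c h d
    have "slice (\<lambda>a. f (scale c h * a)) y = scale c (slice (\<lambda>a. f (h * a)) y)"
      unfolding slice_def tensor_eval_scale_fun[symmetric]
      by (intro tensor_eval_cong) (simp add: linear_formD[OF f] flip: scale_mult_left)
    then show "d * slice (\<lambda>a. f (scale c h * a)) y = scale c (d * slice (\<lambda>a. f (h * a)) y)"
      by (simp add: scale_mult_right)
  qed (simp_all add: distrib_right scale_mult_left)
  finally show ?thesis .
qed

lemma ex_rep_stable:
  assumes "subspace K" "\<And>f. linear_form scale f \<Longrightarrow> slice f x \<in> K"
  obtains us where "tensor_equiv scale (cop x) us" "\<And>a b. (a, b) \<in> set us \<Longrightarrow> b \<in> K"
  using tensor_reduce[of K "cop x"] assms unfolding slice_def tensor_equiv_def by metis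

text \<open>\<open>tensor_reduce\<close> is applied to \<open>\<Delta> z - 1 \<otimes> z\<close>,
  whose slices are exactly the elements assumed to lie in \<open>K\<close>.\<close>

lemma ex_rep_primitive:
  assumes K: "subspace K"
    and z: "\<And>f. linear_form scale f \<Longrightarrow> slice f z - scale (f 1) z \<in> K"
  obtains us where "tensor_equiv scale (cop z) ((1, z) # us)" "\<And>a b. (a, b) \<in> set us \<Longrightarrow> b \<in> K"
proof -
  have "tensor_eval (\<lambda>a b. scale (f a) b) ((- 1, z) # cop z) \<in> K" if f: "linear_form scale f" for f
  proof -
    have "f (- 1) = - f 1" using linear_form_diff[OF f, of 0 1] by (simp add: linear_form_0[OF f])
    then show ?thesis using z[OF f] by (simp add: slice_def)
  qed
  from tensor_reduce[OF K this] obtain us where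
    us: "\<And>\<beta>. bilinear_map scale \<beta> \<Longrightarrow> tensor_eval \<beta> ((- 1, z) # cop z) = tensor_eval \<beta> us"
      "\<And>a b. (a, b) \<in> set us \<Longrightarrow> b \<in> K" by metis
  have "tensor_equiv scale (cop z) ((1, z) # us)"
    unfolding tensor_equiv_def
  proof (intro allI impI)
    fix \<beta> assume \<beta>: "bilinear_map scale \<beta>"
    have "\<beta> (- 1) z = - \<beta> 1 z"
      using bilinear_map_diff(1)[OF \<beta>, of 0 1 z] by (simp add: bilinear_map_0[OF \<beta>])
    then show "tensor_eval \<beta> (cop z) = tensor_eval \<beta> ((1, z) # us)"
      using us(1)[OF \<beta>] by (simp add: algebra_simps)
  qed
  then show thesis using that us(2) by blast
qed

text \<open>A slice of \<open>x * y\<close> is a sum of slices of \<open>x\<close> times second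
  factors of \<open>\<Delta> y\<close>, and the latter can be chosen in \<open>K\<close>.\<close>

lemma stable_part_subalgebra:
  assumes K: "subalgebra scale K"
  shows "subalgebra scale {x\<in>K. \<forall>f. linear_form scale f \<longrightarrow> slice f x \<in> K}"
proof (rule subalgebraI)
  let ?L = "{x\<in>K. \<forall>f. linear_form scale f \<longrightarrow> slice f x \<in> K}"
  show "subspace ?L"
    by (rule subspaceI)
      (auto simp: slice_add slice_scale slice_zero subalgebra_zero[OF K]
        intro: subalgebra_add[OF K] subalgebra_scale[OF K])
  show "1 \<in> ?L" by (simp add: slice_one subalgebra_one[OF K] subalgebra_scale[OF K])
  fix x y assume x: "x \<in> ?L" and y: "y \<in> ?L"
  obtain us where us: "tensor_equiv scale (cop y) us" "\<And>a b. (a, b) \<in> set us \<Longrightarrow> b \<in> K"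
    using ex_rep_stable[OF subalgebra_subspace[OF K]] y by blast
  have "slice f (x * y) \<in> K" if "linear_form scale f" for f
    unfolding slice_mult_right[OF that us(1)]
    using x us(2) linear_form_mult_right[OF that]
    by (intro tensor_eval_mem[OF subalgebra_subspace[OF K]] subalgebra_mult[OF K]) auto
  then show "x * y \<in> ?L" using x y subalgebra_mult[OF K] by simp
qed

lemma adjoin_stable:
  assumes C: "subalgebra scale C" "stable C"
    and z: "\<And>f. linear_form scale f \<Longrightarrow> slice f z - scale (f 1) z \<in> C"
  shows "stable (adjoin C z)"
proof -
  let ?D = "adjoin C z"
  note D = adjoin_subalgebra[of C z]
  have "?D \<subseteq> {x\<in>?D. \<forall>f. linear_form scale f \<longrightarrow> slice f x \<in> ?D}"
  proof (rule adjoin_minimal[OF stable_part_subalgebra[OF D]])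
    show "C \<subseteq> {x\<in>?D. \<forall>f. linear_form scale f \<longrightarrow> slice f x \<in> ?D}"
      using C(2) adjoin_superset unfolding stable_def by blast
    have "slice f z \<in> ?D" if f: "linear_form scale f" for f
      using subalgebra_add[OF D, of "slice f z - scale (f 1) z" "scale (f 1) z"]
        z[OF f] adjoin_superset[where C = C and z = z] subalgebra_scale[OF D] by auto
    then show "z \<in> {x\<in>?D. \<forall>f. linear_form scale f \<longrightarrow> slice f x \<in> ?D}"
      using adjoin_superset by simp
  qed
  then show ?thesis unfolding stable_def by blast
qed

text \<open>With \<open>\<Delta> z = 1 \<otimes> z + \<Sum> h \<otimes> d\<close>, slicing commutes with \<open>ad z\<close> up to terms built from the
  \<open>d\<close>.\<close>

lemma slice_mult_primitive:
  assumes f: "linear_form scale f" and us: "tensor_equiv scale (cop z) ((1, z) # us)"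
  shows "slice f (x * z) = slice f x * z + tensor_eval (\<lambda>h d. slice (\<lambda>a. f (a * h)) x * d) us"
    and "slice f (z * x) = z * slice f x + tensor_eval (\<lambda>h d. d * slice (\<lambda>a. f (h * a)) x) us"
  using slice_mult_right[OF f us] slice_mult_left[OF f us] by simp_all

lemma ad_closure_stable:
  assumes C: "subalgebra scale C" "stable C"
    and z: "\<And>f. linear_form scale f \<Longrightarrow> slice f z - scale (f 1) z \<in> C"
  shows "stable (ad_closure C z)"
proof -
  let ?E = "ad_closure C z"
  note E = ad_closure_subalgebra[of C z]
  obtain us where us: "tensor_equiv scale (cop z) ((1, z) # us)" "\<And>a b. (a, b) \<in> set us \<Longrightarrow> b \<in> C"
    using ex_rep_primitive[OF subalgebra_subspace[OF C(1)] z] by blast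
  let ?L = "{x\<in>?E. \<forall>f. linear_form scale f \<longrightarrow> slice f x \<in> ?E}"
  have "?E \<subseteq> ?L"
  proof (rule ad_closure_minimal[OF stable_part_subalgebra[OF E]])
    show "C \<subseteq> ?L" using C(2) ad_closure_superset unfolding stable_def by blast
    fix x assume x: "x \<in> ?L"
    have "slice f (z * x - x * z) \<in> ?E" if f: "linear_form scale f" for f
    proof -
      have "slice f (z * x - x * z) = (z * slice f x - slice f x * z)
          + (tensor_eval (\<lambda>h d. d * slice (\<lambda>a. f (h * a)) x) us
            - tensor_eval (\<lambda>h d. slice (\<lambda>a. f (a * h)) x * d) us)"
        by (simp add: slice_diff[OF f] slice_mult_primitive[OF f us(1)])
      also have "\<dots> \<in> ?E"
        using x f us(2) linear_form_mult_right[OF f] linear_form_mult_left[OF f]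
          ad_closure_superset[of C z]
        by (intro subalgebra_add[OF E] subalgebra_diff[OF E] ad_closure_ad
            tensor_eval_mem[OF subalgebra_subspace[OF E]] subalgebra_mult[OF E]) auto
      finally show ?thesis .
    qed
    then show "z * x - x * z \<in> ?L" using x ad_closure_ad by simp
  qed
  then show ?thesis unfolding stable_def by blast
qed

text \<open>A first tensor factor of degree \<open>\<gamma> \<ge> \<delta>\<close> forces
  \<open>\<gamma> = \<delta>\<close> and a second factor of degree 0, that is, a scalar. The right
  counit axiom then reassembles \<open>x\<close> from these terms.\<close>

lemma slice_component_below:
  assumes x: "x \<in> V \<delta>" and f: "linear_form scale f"
    and \<gamma>: "le \<delta> \<gamma>"
  shows "slice (\<lambda>a. f (component \<gamma> a)) x = (if \<delta> = \<gamma> then scale (f x) 1 else 0)"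
proof -
  let ?f = "\<lambda>a. f (component \<gamma> a)"
  have lf: "linear_form scale ?f"
    by (rule linear_formI) (simp_all add: component_add component_scale linear_formD[OF f])
  obtain us where us: "tensor_equiv scale (cop x) us"
    "\<And>a b. (a, b) \<in> set us \<Longrightarrow> \<exists>\<alpha> \<beta>. a \<in> V \<alpha> \<and> b \<in> V \<beta> \<and> \<alpha> + \<beta> = \<delta>"
    using cop_graded[OF x] by blast
  have "slice ?f x = tensor_eval (\<lambda>a b. scale (?f a) b) us"
    unfolding slice_def by (rule tensor_equivD[OF us(1) form_pairing_bilinear[OF lf]])
  also have "\<dots> = tensor_eval (\<lambda>a b. scale (if \<delta> = \<gamma> then ?f (scale (\<epsilon> b) a) else 0) 1) us"
  proof (rule tensor_eval_cong)
    fix a b assume "(a, b) \<in> set us"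
    then obtain \<alpha> \<beta> where ab: "a \<in> V \<alpha>" "b \<in> V \<beta>" "\<alpha> + \<beta> = \<delta>" using us(2) by blast
    show "scale (?f a) b = scale (if \<delta> = \<gamma> then ?f (scale (\<epsilon> b) a) else 0) 1"
    proof (cases "\<alpha> = \<gamma>")
      case True
      have "\<not> lt \<alpha> (\<alpha> + \<beta>)" using \<gamma> True ab(3) ord.leD by blast
      then have \<beta>: "\<beta> = 0" using lt_add_self by blast
      then obtain c where c: "b = scale c 1" using ab V_0_scalar by blast
      then have "\<epsilon> b = c" by (simp add: linear_formD(2)[OF counit_form] counit_one)
      then show ?thesis using True ab \<beta> c
        by (simp add: linear_formD(2)[OF f] component_scale)
    next
      case False
      then show ?thesis
        using component_V[OF ab(1), of \<gamma>] component_scale[of \<gamma> "\<epsilon> b" a] linear_form_0[OF f] by auto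
    qed
  qed
  also have "\<dots> = scale (if \<delta> = \<gamma> then ?f (tensor_eval (\<lambda>a b. scale (\<epsilon> b) a) us) else 0) 1"
    by (induction us)
      (auto simp: linear_form_0[OF f] linear_form_0[OF lf] linear_formD(1)[OF lf] scale_left_distrib)
  also have "tensor_eval (\<lambda>a b. scale (\<epsilon> b) a) us = x"
    using tensor_equivD[OF us(1) bilinear_map_flip[OF form_pairing_bilinear[OF counit_form]]]
    by (simp add: counit_right)
  finally show ?thesis using component_V[OF x] by simp
qed

text \<open>By the left counit axiom, subtracting \<open>scale (f 1) x\<close> means slicing by
  \<open>f - f(1) \<epsilon>\<close>. This form kills first factors of degree 0, and all other terms
  have second factors of degree below \<open>\<gamma>\<close>.\<close>

lemma slice_primitive_degree:
  assumes x: "x \<in> V \<gamma>" and f: "linear_form scale f" and \<beta>: "le \<gamma> \<beta>"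
  shows "component \<beta> (slice f x - scale (f 1) x) = 0"
proof -
  obtain us where us: "tensor_equiv scale (cop x) us"
    "\<And>a b. (a, b) \<in> set us \<Longrightarrow> \<exists>\<alpha> \<beta>. a \<in> V \<alpha> \<and> b \<in> V \<beta> \<and> \<alpha> + \<beta> = \<gamma>"
    using cop_graded[OF x] by blast
  let ?g = "\<lambda>a. f a - f 1 * \<epsilon> a"
  have g: "linear_form scale ?g"
    by (rule linear_formI) (simp_all add: linear_formD[OF f] linear_formD[OF counit_form] algebra_simps)
  have "tensor_eval (\<lambda>a b. scale (?g a) b) ts = tensor_eval (\<lambda>a b. scale (f a) b) ts
      - scale (f 1) (tensor_eval (\<lambda>a b. scale (\<epsilon> a) b) ts)" for ts
    by (induction ts) (auto simp: scale_left_diff_distrib scale_right_distrib)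
  then have "slice f x - scale (f 1) x = slice ?g x"
    unfolding slice_def by (simp only: counit_left)
  also have "\<dots> = tensor_eval (\<lambda>a b. scale (?g a) b) us"
    unfolding slice_def by (rule tensor_equivD[OF us(1) form_pairing_bilinear[OF g]])
  finally have eq: "slice f x - scale (f 1) x = tensor_eval (\<lambda>a b. scale (?g a) b) us" .
  have sub: "subspace {y. component \<beta> y = 0}"
    by (rule subspaceI) (simp_all add: component_add component_scale)
  have "tensor_eval (\<lambda>a b. scale (?g a) b) us \<in> {y. component \<beta> y = 0}"
  proof (rule tensor_eval_mem[OF sub])
    fix a b assume "(a, b) \<in> set us"
    then obtain \<alpha> \<alpha>' where ab: "a \<in> V \<alpha>" "b \<in> V \<alpha>'" "\<alpha> + \<alpha>' = \<gamma>" using us(2) by blast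
    show "scale (?g a) b \<in> {y. component \<beta> y = 0}"
    proof (cases "\<alpha> = 0")
      case True
      then obtain c where "a = scale c 1" using ab V_0_scalar by blast
      then have "?g a = 0"
        by (simp add: linear_formD(2)[OF f] linear_formD(2)[OF counit_form] counit_one mult.commute)
      then show ?thesis by simp
    next
      case False
      then have "lt \<alpha>' \<gamma>" using lt_add_self[OF False, of \<alpha>'] ab by (simp add: add.commute)
      then have "\<beta> \<noteq> \<alpha>'" using \<beta> ord.leD by blast
      then show ?thesis using component_V[OF ab(2)] by (simp add: component_scale)
    qed
  qed
  then show ?thesis using eq by simp
qed

end

section \<open>Powers of an adjoined element\<close>

context graded_algebra
begin

lemma finite_has_greatest:
  assumes "finite G" "G \<noteq> {}"
  shows "\<exists>m\<in>G. \<forall>\<gamma>\<in>G. le \<gamma> m"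
  using assms
proof (induction G rule: finite_ne_induct)
  case (insert x F)
  then obtain m where "m \<in> F" "\<forall>\<gamma>\<in>F. le \<gamma> m" by blast
  then show ?case using ord.linear[of x m] ord.order_trans by (metis insert_iff ord.order_refl)
qed simp

end

context graded_bialgebra
begin

text \<open>With \<open>\<gamma>\<close> the top degree of \<open>e\<close>, a form composed with
  \<open>component \<gamma>\<close> ignores the lower components and turns the top one into a scalar
  by \<open>slice_component_below\<close>.\<close>

lemma ex_slice_scalar:
  assumes "e \<noteq> 0"
  obtains f c where "linear_form scale f" "c \<noteq> 0" "slice f e = scale c 1"
proof -
  let ?G = "{\<gamma>. component \<gamma> e \<noteq> 0}"
  have "?G \<noteq> {}" using assms sum_component[of e] by force
  then obtain \<gamma> where \<gamma>: "component \<gamma> e \<noteq> 0" "\<And>\<beta>. component \<beta> e \<noteq> 0 \<Longrightarrow> le \<beta> \<gamma>"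
    using finite_has_greatest[OF finite_support, of e] by auto
  from \<gamma>(1) obtain f where f: "linear_form scale f" "f (component \<gamma> e) \<noteq> 0"
    using linear_form_eq_zero by blast
  let ?f = "\<lambda>a. f (component \<gamma> a)"
  have lf: "linear_form scale ?f"
    by (rule linear_formI) (simp_all add: component_add component_scale linear_formD[OF f(1)])
  have "slice ?f e = slice ?f (\<Sum>\<beta>\<in>?G. component \<beta> e)" by (simp only: sum_component)
  also have "\<dots> = (\<Sum>\<beta>\<in>?G. slice ?f (component \<beta> e))" by (rule slice_sum[OF lf])
  also have "\<dots> = (\<Sum>\<beta>\<in>?G. if \<beta> = \<gamma> then scale (f (component \<gamma> e)) 1 else 0)"
    by (rule sum.cong[OF refl]) (use slice_component_below[OF component_in f(1)] \<gamma>(2) in auto)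
  also have "\<dots> = scale (f (component \<gamma> e)) 1" using finite_support[of e] \<gamma>(1) by (simp add: sum.delta)
  finally show thesis using that[OF lf f(2)] by simp
qed

text \<open>Applying \<open>\<epsilon>\<close> gives \<open>f u = f 1 * \<epsilon> u\<close> for
  every form \<open>f\<close>, and forms separate points.\<close>

lemma scalar_of_slices:
  assumes "\<And>f. linear_form scale f \<Longrightarrow> slice f u = scale (f 1) u"
  shows "u = scale (\<epsilon> u) 1"
proof -
  have "f (u - scale (\<epsilon> u) 1) = 0" if f: "linear_form scale f" for f
  proof -
    have "f u = \<epsilon> (scale (f 1) u)" using counit_slice[OF f, of u] assms[OF f] by simp
    then show ?thesis by (simp add: linear_form_diff[OF f] linear_formD[OF f] linear_formD[OF counit_form])
  qed
  then show ?thesis using linear_form_eq_zero by force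
qed

context
  fixes E :: "'h set" and z :: 'h and us :: "('h \<times> 'h) list"
  assumes E: "subalgebra scale E" and stE: "stable E"
    and ad: "\<And>x. x \<in> E \<Longrightarrow> z * x - x * z \<in> E"
    and cz: "tensor_equiv scale (cop z) ((1, z) # us)"
    and us: "\<And>a b. (a, b) \<in> set us \<Longrightarrow> b \<in> E"
begin

text \<open>What slicing of \<open>x * z\<close> produces besides \<open>slice f x * z\<close>. At
  \<open>x = 1\<close> it is \<open>slice f z - scale (f 1) z\<close>.\<close>

definition correction :: "('h \<Rightarrow> 'k) \<Rightarrow> 'h \<Rightarrow> 'h"
  where "correction f x = tensor_eval (\<lambda>h d. slice (\<lambda>a. f (a * h)) x * d) us"

lemma slice_times: "linear_form scale f \<Longrightarrow> slice f (x * z) = slice f x * z + correction f x"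
  unfolding correction_def by (rule slice_mult_primitive(1)[OF _ cz])

lemma slice_times_power:
  "x \<in> E \<Longrightarrow> linear_form scale f \<Longrightarrow> slice f (x * z ^ n) - slice f x * z ^ n \<in> filtration E z n"
proof (induction n arbitrary: f)
  case (Suc n)
  note f = Suc.prems(2)
  have "correction f (x * z ^ n) \<in> filtration E z (Suc n)"
    unfolding correction_def
  proof (rule tensor_eval_mem[OF filtration_subspace[OF E]])
    fix h d assume "(h, d) \<in> set us"
    then have d: "d \<in> E" by (rule us)
    let ?f = "\<lambda>a. f (a * h)"
    have lf: "linear_form scale ?f" by (rule linear_form_mult_right[OF f])
    have "(slice ?f (x * z ^ n) - slice ?f x * z ^ n) + slice ?f x * z ^ n \<in> filtration E z (Suc n)"
      by (intro filtration_add[OF E] filtration_top[OF E] stableD[OF stE] lf Suc.prems(1)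
          filtration_mono[OF E _ Suc.IH]) simp
    then have "slice ?f (x * z ^ n) \<in> filtration E z (Suc n)" by (simp only: diff_add_cancel)
    then show "slice ?f (x * z ^ n) * d \<in> filtration E z (Suc n)"
      using d by - (intro filtration_mult_right[OF E ad])
  qed
  moreover have "(slice f (x * z ^ n) - slice f x * z ^ n) * z \<in> filtration E z (Suc n)"
    by (rule filtration_shift[OF E Suc.IH[OF Suc.prems]])
  moreover have "slice f (x * z ^ Suc n) - slice f x * z ^ Suc n
      = (slice f (x * z ^ n) - slice f x * z ^ n) * z + correction f (x * z ^ n)"
    using slice_times[OF f, of "x * z ^ n"] by (simp add: algebra_simps power_commutes)
  ultimately show ?case using filtration_add[OF E] by (simp only:)
qed simp

text \<open>The factor \<open>Suc n\<close> arises as in the derivative of a power: each factor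
  \<open>z\<close> contributes one \<open>correction\<close>, and moving it to the left of the
  remaining factors changes only lower powers.\<close>

lemma slice_times_power_Suc:
  "x \<in> E \<Longrightarrow> linear_form scale f \<Longrightarrow>
    slice f (x * z ^ Suc n) - slice f x * z ^ Suc n - scale (of_nat (Suc n)) (correction f x * z ^ n)
      \<in> filtration E z n"
proof (induction n)
  case 0
  then show ?case using slice_times by simp
next
  case (Suc n)
  note f = Suc.prems(2)
  \<comment> \<open>The fixed list \<open>us\<close> is replaced by a variable \<open>ts\<close> to
    allow induction on the list.\<close>
  have "correction f (x * z ^ Suc n) - correction f x * z ^ Suc n
      = tensor_eval (\<lambda>h d. (slice (\<lambda>a. f (a * h)) (x * z ^ Suc n)
          - slice (\<lambda>a. f (a * h)) x * z ^ Suc n) * d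
        + slice (\<lambda>a. f (a * h)) x * (z ^ Suc n * d - d * z ^ Suc n)) ts"
    if "correction f = (\<lambda>x. tensor_eval (\<lambda>h d. slice (\<lambda>a. f (a * h)) x * d) ts)" for ts
    unfolding that by (induction ts) (auto simp: algebra_simps simp del: power_Suc)
  from this[of us] have "correction f (x * z ^ Suc n) - correction f x * z ^ Suc n
      = tensor_eval (\<lambda>h d. (slice (\<lambda>a. f (a * h)) (x * z ^ Suc n)
          - slice (\<lambda>a. f (a * h)) x * z ^ Suc n) * d
        + slice (\<lambda>a. f (a * h)) x * (z ^ Suc n * d - d * z ^ Suc n)) us"
    by (simp add: correction_def fun_eq_iff)
  also have "\<dots> \<in> filtration E z (Suc n)"
  proof (rule tensor_eval_mem[OF filtration_subspace[OF E]])
    fix h d assume "(h, d) \<in> set us"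
    then have d: "d \<in> E" by (rule us)
    let ?f = "\<lambda>a. f (a * h)"
    have lf: "linear_form scale ?f" by (rule linear_form_mult_right[OF f])
    show "(slice ?f (x * z ^ Suc n) - slice ?f x * z ^ Suc n) * d
        + slice ?f x * (z ^ Suc n * d - d * z ^ Suc n) \<in> filtration E z (Suc n)"
      by (intro filtration_add[OF E] filtration_mult_right[OF E ad] filtration_mult_left[OF E]
          slice_times_power power_commutator[OF E ad] stableD[OF stE] lf Suc.prems(1) d)
  qed
  finally have "correction f (x * z ^ Suc n) - correction f x * z ^ Suc n \<in> filtration E z (Suc n)" .
  moreover have "(slice f (x * z ^ Suc n) - slice f x * z ^ Suc n
      - scale (of_nat (Suc n)) (correction f x * z ^ n)) * z \<in> filtration E z (Suc n)"
    by (rule filtration_shift[OF E Suc.IH[OF Suc.prems]])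
  moreover have "slice f (x * z ^ Suc (Suc n)) - slice f x * z ^ Suc (Suc n)
      - scale (of_nat (Suc (Suc n))) (correction f x * z ^ Suc n)
    = (slice f (x * z ^ Suc n) - slice f x * z ^ Suc n
      - scale (of_nat (Suc n)) (correction f x * z ^ n)) * z
      + (correction f (x * z ^ Suc n) - correction f x * z ^ Suc n)"
    (is "?l = ?r")
  proof -
    have 1: "slice f (x * z ^ Suc (Suc n)) = slice f (x * z ^ Suc n) * z + correction f (x * z ^ Suc n)"
      using slice_times[OF f, of "x * z ^ Suc n"] by (simp only: mult.assoc power_Suc2[of z "Suc n"])
    have 2: "scale (of_nat (Suc (Suc n))) (correction f x * z ^ Suc n)
        = scale (of_nat (Suc n)) (correction f x * z ^ n) * z + correction f x * z ^ Suc n"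
      by (simp only: of_nat_Suc[of "Suc n"] scale_left_distrib scale_one scale_mult_left[symmetric]
          mult.assoc power_Suc2) (simp only: add.commute)
    show ?thesis unfolding 1 2 by (simp only: power_Suc2[of z "Suc n"] left_diff_distrib mult.assoc)
        (simp only: algebra_simps)
  qed
  ultimately show ?case using filtration_add[OF E] by (simp only:)
qed

lemma filtration_slice:
  "x \<in> filtration E z n \<Longrightarrow> linear_form scale f \<Longrightarrow> slice f x \<in> filtration E z n"
proof (induction n arbitrary: x)
  case 0 then show ?case by (simp add: slice_zero)
next
  case (Suc n)
  note f = Suc.prems(2)
  from Suc.prems obtain y e where x: "x = y + e * z ^ n" "y \<in> filtration E z n" "e \<in> E" by auto
  have "slice f x = slice f y + (slice f (e * z ^ n) - slice f e * z ^ n) + slice f e * z ^ n"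
    by (simp add: x slice_add[OF f])
  then show ?case
    using filtration_SucI[OF filtration_add[OF E Suc.IH[OF x(2) f] slice_times_power[OF x(3) f]]
        stableD[OF stE x(3) f]] by (simp only:)
qed

lemma power_independent_aux:
  assumes z: "z \<notin> E"
  shows "e \<in> E \<Longrightarrow> e * z ^ n \<in> filtration E z n \<Longrightarrow> e = 0"
proof (induction n arbitrary: e)
  case (Suc n)
  show ?case
  proof (rule ccontr)
    assume "e \<noteq> 0"
    then obtain f0 c where f0: "linear_form scale f0" "c \<noteq> 0" "slice f0 e = scale c 1"
      by (rule ex_slice_scalar)
    \<comment> \<open>The filtration is stable under slices, so slicing the relation by
      \<open>f0\<close> keeps it a relation, now with the scalar leading coefficient
      \<open>c\<close>.\<close>
    have "slice f0 (e * z ^ Suc n) - (slice f0 (e * z ^ Suc n) - slice f0 e * z ^ Suc n)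
        \<in> filtration E z (Suc n)"
      by (intro filtration_diff[OF E] filtration_slice slice_times_power Suc.prems f0)
    then have "scale c (z ^ Suc n) \<in> filtration E z (Suc n)"
      by (simp add: f0 flip: scale_mult_left del: filtration.simps power_Suc)
    then have "scale (inverse c) (scale c (z ^ Suc n)) \<in> filtration E z (Suc n)"
      by (rule subspace_scale[OF filtration_subspace[OF E]])
    then have "z ^ Suc n \<in> filtration E z (Suc n)" using f0(2) by (simp del: filtration.simps power_Suc)
    then obtain y g where g: "z ^ Suc n = y + g * z ^ n" "y \<in> filtration E z n" "g \<in> E"
      by (auto simp del: power_Suc)
    \<comment> \<open>Characteristic 0 makes \<open>N\<close> invertible, so that \<open>z\<close>
      can be recovered from \<open>u\<close> and \<open>g\<close>.\<close>
    define N where "N = (of_nat (Suc n) :: 'k)"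
    have N: "N \<noteq> 0" unfolding N_def by (simp only: of_nat_eq_0_iff)
    define u where "u = scale N z - g"
    have "slice f u = scale (f 1) u" if f: "linear_form scale f" for f
    proof -
      have T: "correction f 1 = slice f z - scale (f 1) z"
        using slice_times[OF f, of 1] by (simp add: slice_one[OF f] flip: scale_mult_left)
      have T_E: "correction f 1 \<in> E"
        unfolding correction_def
        by (intro tensor_eval_mem[OF subalgebra_subspace[OF E]] subalgebra_mult[OF E] us
            stableD[OF stE] subalgebra_one[OF E] linear_form_mult_right f)
      \<comment> \<open>The slice of \<open>z ^ Suc n\<close> is computed directly and through
        \<open>y + g * z ^ n\<close>. Modulo lower powers the two results differ by a multiple of
        \<open>z ^ n\<close>, whose coefficient must vanish by \<open>Suc.IH\<close>.\<close>
      have "slice f (1 * z ^ Suc n) - slice f 1 * z ^ Suc n - scale N (correction f 1 * z ^ n)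
          \<in> filtration E z n"
        unfolding N_def by (rule slice_times_power_Suc[OF subalgebra_one[OF E] f])
      moreover have "slice f (1 * z ^ Suc n) = slice f y + slice f (g * z ^ n)"
        by (simp only: mult_1_left g(1) slice_add[OF f])
      moreover have "slice f 1 * z ^ Suc n = scale (f 1) y + scale (f 1) g * z ^ n"
        by (simp only: slice_one[OF f] g(1) scale_mult_left[symmetric] mult_1_left scale_right_distrib)
      ultimately have "slice f y + slice f (g * z ^ n) - (scale (f 1) y + scale (f 1) g * z ^ n)
          - scale N (correction f 1 * z ^ n) \<in> filtration E z n" by (simp only:)
      from filtration_diff[OF E filtration_diff[OF E this filtration_slice[OF g(2) f]]
          slice_times_power[OF g(3) f]]
      have "slice f g * z ^ n - (scale (f 1) y + scale (f 1) g * z ^ n)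
          - scale N (correction f 1 * z ^ n) \<in> filtration E z n" by (simp add: algebra_simps)
      from filtration_add[OF E this subspace_scale[OF filtration_subspace[OF E] g(2), of "f 1"]]
      have "(slice f g - scale (f 1) g - scale N (correction f 1)) * z ^ n \<in> filtration E z n"
        by (simp add: algebra_simps scale_mult_left)
      moreover have "slice f g - scale (f 1) g - scale N (correction f 1) \<in> E"
        by (intro subalgebra_diff[OF E] stableD[OF stE] subalgebra_scale[OF E] g f T_E)
      ultimately have "slice f g - scale (f 1) g - scale N (correction f 1) = 0"
        using Suc.IH by blast
      then have "slice f g = scale (f 1) g + scale N (slice f z - scale (f 1) z)"
        unfolding T by (simp add: algebra_simps)
      then show ?thesis
        by (simp add: u_def slice_diff[OF f] slice_scale[OF f] scale_right_diff_distrib mult.commute)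
    qed
    then have "u = scale (\<epsilon> u) 1" by (rule scalar_of_slices)
    then have "u \<in> E" using subalgebra_scale[OF E subalgebra_one[OF E]] by metis
    then have "scale (inverse N) (u + g) \<in> E"
      by (intro subalgebra_scale[OF E] subalgebra_add[OF E] g)
    then show False using z N by (simp add: u_def)
  qed
qed simp

end

lemma power_independent:
  assumes E: "subalgebra scale E" "stable E" "\<And>x. x \<in> E \<Longrightarrow> z * x - x * z \<in> E"
    and z: "\<And>f. linear_form scale f \<Longrightarrow> slice f z - scale (f 1) z \<in> E" "z \<notin> E"
    and e: "e \<in> E" "e * z ^ n \<in> filtration E z n"
  shows "e = 0"
proof -
  obtain us where us: "tensor_equiv scale (cop z) ((1, z) # us)" "\<And>a b. (a, b) \<in> set us \<Longrightarrow> b \<in> E"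
    using ex_rep_primitive[OF subalgebra_subspace[OF E(1)] z(1)] by blast
  show ?thesis by (rule power_independent_aux[OF E us z(2) e])
qed

end

section \<open>The chain of coideal subalgebras\<close>

context graded_algebra
begin

definition deg :: "'h \<Rightarrow> 'g"
  where "deg x = (SOME \<gamma>. x \<in> V \<gamma>)"

lemma deg_eq: "x \<in> V \<gamma> \<Longrightarrow> x \<noteq> 0 \<Longrightarrow> deg x = \<gamma>"
  unfolding deg_def by (rule some_equality) (auto dest: V_unique)

lemma deg_V: "homogeneous_element V x \<Longrightarrow> x \<in> V (deg x)"
  unfolding homogeneous_element_def deg_def by (rule someI_ex)

text \<open>The order in which elements are tested; an arbitrary well order breaks ties within a
  degree. It lives on all of \<open>'h\<close>, with \<open>deg\<close> an arbitrary value on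
  elements that are not homogeneous.\<close>

definition stage :: "'h rel"
  where "stage = {(x, y). lt (deg x) (deg y) \<or>
    deg x = deg y \<and> (x, y) \<in> (SOME r. well_order_on UNIV r) - Id}"

lemma well_order_some: "well_order_on UNIV (SOME r. well_order_on (UNIV :: 'h set) r)"
  using someI_ex[OF well_order_on[of "UNIV :: 'h set"]] .

lemma wf_stage: "wf stage"
proof -
  let ?W = "(SOME r. well_order_on (UNIV :: 'h set) r)"
  have "wf {(\<alpha>, \<beta>). lt \<alpha> \<beta>}"
  proof (rule wfUNIVI)
    fix P x assume "\<forall>x. (\<forall>y. (y, x) \<in> {(\<alpha>, \<beta>). lt \<alpha> \<beta>} \<longrightarrow> P y) \<longrightarrow> P x"
    then show "P x" by (induction x rule: ord.less_induct) blast
  qed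
  moreover have "wf (?W - Id)" using well_order_some by (simp add: well_order_on_def)
  ultimately have "wf (inv_image ({(\<alpha>, \<beta>). lt \<alpha> \<beta>} <*lex*> (?W - Id)) (\<lambda>x. (deg x, x)))"
    by (intro wf_inv_image wf_lex_prod)
  then show ?thesis by (rule wf_subset) (auto simp: stage_def inv_image_def)
qed

lemma stage_total: "x \<noteq> y \<Longrightarrow> (x, y) \<in> stage \<or> (y, x) \<in> stage"
proof -
  assume "x \<noteq> y"
  moreover have "total (SOME r. well_order_on (UNIV :: 'h set) r)"
    using well_order_some by (simp add: well_order_on_def linear_order_on_def)
  ultimately show ?thesis
    using ord.neq_iff[of "deg x" "deg y"] by (auto simp: stage_def total_on_def)
qed

lemma stage_trans: "(x, y) \<in> stage \<Longrightarrow> (y, z) \<in> stage \<Longrightarrow> (x, z) \<in> stage"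
proof -
  have tr: "trans ((SOME r. well_order_on (UNIV :: 'h set) r) - Id)"
    using well_order_some
    by (intro trans_diff_Id)
      (simp_all add: well_order_on_def linear_order_on_def partial_order_on_def preorder_on_def)
  assume "(x, y) \<in> stage" "(y, z) \<in> stage"
  then show ?thesis
    unfolding stage_def mem_Collect_eq case_prod_conv
    using ord.less_trans[of "deg x" "deg y" "deg z"] transD[OF tr, of x y z] by metis
qed

lemma stage_degree: "lt (deg x) (deg y) \<Longrightarrow> (x, y) \<in> stage"
  by (simp add: stage_def)

lemma subalgebra_chain_Union:
  assumes "\<U> \<noteq> {}" "\<And>K. K \<in> \<U> \<Longrightarrow> subalgebra scale K"
    and chain: "\<And>K L. K \<in> \<U> \<Longrightarrow> L \<in> \<U> \<Longrightarrow> K \<subseteq> L \<or> L \<subseteq> K"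
  shows "subalgebra scale (\<Union>\<U>)"
proof -
  have common: "\<exists>K\<in>\<U>. x \<in> K \<and> y \<in> K" if "x \<in> \<Union>\<U>" "y \<in> \<Union>\<U>" for x y
    using that chain by blast
  show ?thesis
  proof (intro subalgebraI subspaceI)
    show "0 \<in> \<Union>\<U>" "1 \<in> \<Union>\<U>" using assms(1,2) subalgebra_zero subalgebra_one by blast+
    show "x + y \<in> \<Union>\<U>" "x * y \<in> \<Union>\<U>" if "x \<in> \<Union>\<U>" "y \<in> \<Union>\<U>" for x y
      using common[OF that] assms(2) subalgebra_add subalgebra_mult by blast+
    show "scale c x \<in> \<Union>\<U>" if "x \<in> \<Union>\<U>" for c x
      using that assms(2) subalgebra_scale by blast
  qed
qed

end

text \<open>Every homogeneous element \<open>i\<close> of \<open>A\<close>, taken in order of degree, is tested once. It becomes a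
  generator unless it lies in some gap \<open>upper j - mid j\<close> of an earlier generator \<open>j\<close>. Then
  \<open>lower i \<subseteq> mid i \<subset> upper i\<close>: \<open>upper i\<close> arises from \<open>lower i\<close> by adjoining \<open>i\<close>, and \<open>mid i\<close> by
  closing under \<open>ad i\<close>. Later generators refine the intervals \<open>[lower i, mid i]\<close>
  and those above \<open>upper i\<close>, never the gap \<open>[mid i, upper i]\<close>.\<close>

locale subalgebra_pair = graded_algebra scale le lt V
  for scale :: "'k::field \<Rightarrow> 'h::ring_1 \<Rightarrow> 'h"
    and le lt :: "'g::comm_monoid_add \<Rightarrow> 'g \<Rightarrow> bool"
    and V :: "'g \<Rightarrow> 'h set" +
  fixes A B :: "'h set"
  assumes hom_A: "homogeneous_subalgebra A" and hom_B: "homogeneous_subalgebra B"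
    and B_A: "B \<subseteq> A"
begin

text \<open>Being a generator and the set \<open>lower\<close> are computed together: the test of
  \<open>i\<close> needs the gaps of earlier generators, and these are determined by their lower
  sets. The second component is defined for every \<open>i\<close>, generator or not.\<close>

definition chain_step :: "('h \<Rightarrow> bool \<times> 'h set) \<Rightarrow> 'h \<Rightarrow> bool \<times> 'h set"
  where "chain_step f i =
    (i \<in> A \<and> i \<notin> B \<and> homogeneous_element V i \<and>
      (\<forall>j. (j, i) \<in> stage \<and> fst (f j) \<longrightarrow>
        i \<in> ad_closure (snd (f j)) j \<or> i \<notin> adjoin (snd (f j)) j),
     B \<union> {x. \<exists>j. (j, i) \<in> stage \<and> fst (f j) \<and> i \<notin> adjoin (snd (f j)) j \<and> x \<in> adjoin (snd (f j)) j})"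

definition chain :: "'h \<Rightarrow> bool \<times> 'h set"
  where "chain = wfrec stage chain_step"

definition gens :: "'h set" where "gens = {i. fst (chain i)}"
definition lower :: "'h \<Rightarrow> 'h set" where "lower i = snd (chain i)"
definition mid :: "'h \<Rightarrow> 'h set" where "mid i = ad_closure (lower i) i"
definition upper :: "'h \<Rightarrow> 'h set" where "upper i = adjoin (lower i) i"

lemma chain_unfold: "chain i = chain_step chain i"
proof -
  have "chain_step (cut f stage i) i = chain_step f i" for f
    unfolding chain_step_def
    by (simp add: cut_apply cong: conj_cong)
  then show ?thesis unfolding chain_def using wfrec[OF wf_stage, of chain_step i] by simp
qed

lemma gens_iff: "i \<in> gens \<longleftrightarrow> i \<in> A \<and> i \<notin> B \<and> homogeneous_element V i \<and>
    (\<forall>j. (j, i) \<in> stage \<and> j \<in> gens \<longrightarrow> i \<in> mid j \<or> i \<notin> upper j)"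
  unfolding gens_def mid_def upper_def lower_def mem_Collect_eq
  by (subst chain_unfold) (simp add: chain_step_def)

lemma lower_eq: "lower i = B \<union> \<Union>{upper j | j. (j, i) \<in> stage \<and> j \<in> gens \<and> i \<notin> upper j}"
  unfolding gens_def upper_def mem_Collect_eq
  by (subst lower_def, subst chain_unfold) (auto simp: chain_step_def lower_def)

lemma subalgebra_A: "subalgebra scale A" and subalgebra_B: "subalgebra scale B"
  using hom_A hom_B by (auto simp: homogeneous_subalgebra_def)

lemma gens_V: "i \<in> gens \<Longrightarrow> i \<in> V (deg i)"
  using gens_iff deg_V by blast

lemma gens_nonzero: "i \<in> gens \<Longrightarrow> i \<noteq> 0"
  using gens_iff subalgebra_zero[OF subalgebra_B] by blast

lemma gens_deg: "i \<in> gens \<Longrightarrow> deg i \<noteq> 0"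
  using gens_V[of i] V_0_subalgebra[OF subalgebra_B] gens_iff[of i] by (metis subsetD)

lemma B_lower: "B \<subseteq> lower i"
  by (subst lower_eq) blast

lemma lower_mid: "lower i \<subseteq> mid i"
  unfolding mid_def by (rule ad_closure_superset)

lemma mid_upper: "mid i \<subseteq> upper i"
  unfolding mid_def upper_def by (rule ad_closure_subset_adjoin)

lemma self_upper: "i \<in> upper i"
  unfolding upper_def by (rule adjoin_superset)

lemma subalgebra_mid: "subalgebra scale (mid i)"
  unfolding mid_def by (rule ad_closure_subalgebra)

lemma subalgebra_upper: "subalgebra scale (upper i)"
  unfolding upper_def by (rule adjoin_subalgebra)

lemma mid_ad: "x \<in> mid i \<Longrightarrow> i * x - x * i \<in> mid i"
  unfolding mid_def by (rule ad_closure_ad)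

lemma upper_filtration: "upper i = (\<Union>n. filtration (mid i) i n)"
  unfolding upper_def mid_def by (rule adjoin_eq_filtration)

text \<open>Position in the chain, as opposed to the order of testing \<open>stage\<close>: a
  generator tested later may stand below an earlier one.\<close>

definition gens_order :: "'h rel"
  where "gens_order = {(j, k). j \<in> gens \<and> k \<in> gens \<and> upper j \<subseteq> upper k}"

end

locale coideal_pair =
  graded_bialgebra scale le lt V cop \<epsilon> + subalgebra_pair scale le lt V A B
  for scale :: "'k::field_char_0 \<Rightarrow> 'h::ring_1 \<Rightarrow> 'h"
    and le lt :: "'g::comm_monoid_add \<Rightarrow> 'g \<Rightarrow> bool"
    and V :: "'g \<Rightarrow> 'h set" and cop \<epsilon> and A B +
  assumes stable_A: "stable A" and stable_B: "stable B"
begin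

text \<open>The invariant of the induction along \<open>stage\<close>. Its last clause says that the
  gap of an earlier generator \<open>j\<close> lies entirely above or entirely below the interval
  from \<open>lower i\<close> to \<open>upper i\<close>.\<close>

definition good :: "'h \<Rightarrow> bool"
  where "good i \<longleftrightarrow> homogeneous_subalgebra (lower i) \<and> stable (lower i) \<and> lower i \<subseteq> A \<and> i \<notin> mid i \<and>
    (\<forall>f. linear_form scale f \<longrightarrow> slice f i - scale (f 1) i \<in> lower i) \<and>
    (\<forall>j\<in>gens. (j, i) \<in> stage \<longrightarrow>
      (i \<in> mid j \<longrightarrow> upper i \<subseteq> mid j) \<and> (i \<notin> upper j \<longrightarrow> upper j \<subseteq> lower i))"

context
  fixes i
  assumes i: "i \<in> gens" and good: "good i"
begin

lemma good_mid: "homogeneous_subalgebra (mid i)" "stable (mid i)"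
  and good_upper: "homogeneous_subalgebra (upper i)" "stable (upper i)" "upper i \<subseteq> A"
proof -
  have lower: "homogeneous_subalgebra (lower i)" "stable (lower i)" "lower i \<subseteq> A"
    and prim: "\<And>f. linear_form scale f \<Longrightarrow> slice f i - scale (f 1) i \<in> lower i"
    using good unfolding good_def by blast+
  have sub: "subalgebra scale (lower i)" using lower(1) by (simp add: homogeneous_subalgebra_def)
  show "homogeneous_subalgebra (mid i)" "homogeneous_subalgebra (upper i)"
    unfolding mid_def upper_def
    by (rule ad_closure_homogeneous[OF lower(1) gens_V[OF i]]
        adjoin_homogeneous[OF lower(1) gens_V[OF i]])+
  show "stable (mid i)" unfolding mid_def by (rule ad_closure_stable[OF sub lower(2) prim])
  show "stable (upper i)" unfolding upper_def by (rule adjoin_stable[OF sub lower(2) prim])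
  show "upper i \<subseteq> A"
    unfolding upper_def using lower(3) i gens_iff by (intro adjoin_minimal subalgebra_A) blast+
qed

end

text \<open>An element of \<open>A - B\<close> that fails the test lies in the gap of an earlier
  generator. Goodness is assumed for \<open>y\<close> alone, since inside the main induction it is
  known only for elements tested before.\<close>

lemma cover_aux:
  assumes y: "y \<in> A" "y \<notin> B" "homogeneous_element V y" and good: "y \<in> gens \<Longrightarrow> good y"
  obtains k where "k \<in> gens" "k = y \<or> (k, y) \<in> stage" "y \<in> upper k" "y \<notin> mid k"
proof (cases "y \<in> gens")
  case True
  then show thesis using that[of y] good self_upper good_def by blast
next
  case False
  then show thesis using that y gens_iff by blast
qed

lemma all_good: "i \<in> gens \<Longrightarrow> good i"
proof (induction i rule: wf_induct_rule[OF wf_stage])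
  case (1 i)
  note i = \<open>i \<in> gens\<close>
  have IH: "good j" if "(j, i) \<in> stage" "j \<in> gens" for j using 1 that by blast
  \<comment> \<open>The gaps of earlier generators do not overlap: goodness of the one tested later
    places it relative to the other.\<close>
  have compare: "upper j \<subseteq> mid k \<or> upper k \<subseteq> mid j"
    if j: "(j, i) \<in> stage" "j \<in> gens" and k: "(k, i) \<in> stage" "k \<in> gens" and "j \<noteq> k" for j k
  proof -
    have *: "upper j \<subseteq> mid k \<or> upper k \<subseteq> mid j"
      if "(j, k) \<in> stage" "j \<in> gens" "k \<in> gens" "good k" for j k
    proof -
      have "k \<in> mid j \<or> k \<notin> upper j" using that gens_iff by blast
      then show ?thesis using that lower_mid unfolding good_def by blast
    qed
    show ?thesis using stage_total[OF \<open>j \<noteq> k\<close>] *[of j k] *[of k j] IH j k by blast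
  qed
  define \<U> where "\<U> = insert B {upper j | j. (j, i) \<in> stage \<and> j \<in> gens \<and> i \<notin> upper j}"
  have lower: "lower i = \<Union>\<U>" unfolding \<U>_def by (subst lower_eq) blast
  have \<U>: "homogeneous_subalgebra K" "stable K" "K \<subseteq> A" "B \<subseteq> K" "i \<notin> K" if KU: "K \<in> \<U>" for K
  proof -
    consider "K = B" | j where "K = upper j" "(j, i) \<in> stage" "j \<in> gens" "i \<notin> upper j"
      using KU unfolding \<U>_def by blast
    then have "homogeneous_subalgebra K \<and> stable K \<and> K \<subseteq> A \<and> B \<subseteq> K \<and> i \<notin> K"
    proof cases
      case 1
      then show ?thesis using hom_B stable_B B_A i gens_iff[of i] by simp
    next
      case (2 j)
      then have "B \<subseteq> K" using B_lower lower_mid mid_upper by blast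
      then show ?thesis using 2 good_upper[OF 2(3) IH[OF 2(2,3)]] by simp
    qed
    then show "homogeneous_subalgebra K" "stable K" "K \<subseteq> A" "B \<subseteq> K" "i \<notin> K" by blast+
  qed
  have "subalgebra scale (lower i)"
    unfolding lower
  proof (rule subalgebra_chain_Union)
    show "\<U> \<noteq> {}" by (simp add: \<U>_def)
    show "subalgebra scale K" if "K \<in> \<U>" for K
      using \<U>(1)[OF that] by (simp add: homogeneous_subalgebra_def)
    fix K L assume KL: "K \<in> \<U>" "L \<in> \<U>"
    show "K \<subseteq> L \<or> L \<subseteq> K"
    proof (cases "K = B \<or> L = B")
      case True then show ?thesis using \<U>(4) KL by blast
    next
      case False
      then obtain j k where "K = upper j" "L = upper k" "(j, i) \<in> stage" "j \<in> gens"
        "(k, i) \<in> stage" "k \<in> gens" using KL unfolding \<U>_def by blast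
      then show ?thesis using compare[of j k] mid_upper by blast
    qed
  qed
  moreover have "component \<gamma> x \<in> lower i" if "x \<in> lower i" for x \<gamma>
    using that \<U>(1) unfolding lower homogeneous_subalgebra_def by blast
  ultimately have hom: "homogeneous_subalgebra (lower i)" by (simp add: homogeneous_subalgebra_def)
  have sub: "subalgebra scale (lower i)" by fact
  have st: "stable (lower i)" using \<U>(2) unfolding stable_def lower by blast
  have lower_A: "lower i \<subseteq> A" using \<U>(3) unfolding lower by blast
  have "i \<notin> lower i" using \<U>(5) unfolding lower by blast
  \<comment> \<open>Up to degree \<open>deg i\<close>, closing under \<open>ad i\<close> adds
    nothing to \<open>lower i\<close>.\<close>
  then have i_mid: "i \<notin> mid i"
    using ad_closure_component_le[OF hom gens_V[OF i], of i "deg i"] component_V[OF gens_V[OF i]]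
    unfolding mid_def by auto
  have upper_lower: "upper j \<subseteq> lower i" if "(j, i) \<in> stage" "j \<in> gens" "i \<notin> upper j" for j
    using that unfolding lower \<U>_def by blast
  \<comment> \<open>A nonzero component \<open>?c\<close> has degree below \<open>deg i\<close>, so
    outside \<open>B\<close> it lies in the gap of some \<open>k\<close> tested before
    \<open>i\<close>. If \<open>i\<close> were in \<open>mid k\<close>, so would be
    \<open>?c\<close>; since \<open>i\<close> avoids the gap of \<open>k\<close>, it is outside
    \<open>upper k\<close>, and then \<open>upper k\<close> is one of the sets that make up
    \<open>lower i\<close>.\<close>
  have prim: "slice f i - scale (f 1) i \<in> lower i" if f: "linear_form scale f" for f
  proof (rule mem_subspace_components[OF subalgebra_subspace[OF sub]])
    fix \<beta>
    let ?c = "component \<beta> (slice f i - scale (f 1) i)"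
    have closed: "?c \<in> K" if "homogeneous_subalgebra K" "stable K" "i \<in> K" for K
      using that f subalgebra_diff subalgebra_scale stableD unfolding homogeneous_subalgebra_def
      by metis
    show "?c \<in> lower i"
    proof (cases "?c = 0 \<or> ?c \<in> B")
      case True then show ?thesis using B_lower subalgebra_zero[OF sub] by auto
    next
      case False
      then have "\<not> le (deg i) \<beta>" using slice_primitive_degree[OF gens_V[OF i] f] by blast
      moreover have "deg ?c = \<beta>" using False component_in by (intro deg_eq) auto
      ultimately have stage: "(?c, i) \<in> stage" by (intro stage_degree) (simp add: ord.not_le)
      have "?c \<in> A" using closed hom_A stable_A i gens_iff by blast
      moreover have "homogeneous_element V ?c" using component_in unfolding homogeneous_element_def by blast
      ultimately obtain k where k: "k \<in> gens" "k = ?c \<or> (k, ?c) \<in> stage" "?c \<in> upper k" "?c \<notin> mid k"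
        using cover_aux[of ?c] False IH[OF stage] by blast
      have ki: "(k, i) \<in> stage" using k(2) stage stage_trans by blast
      have "i \<notin> mid k" using k(4) closed good_mid[OF k(1) IH[OF ki k(1)]] by blast
      then have "i \<notin> upper k" using i gens_iff ki k(1) by blast
      then show ?thesis using upper_lower[OF ki k(1)] k(3) by blast
    qed
  qed
  have "upper i \<subseteq> mid j" if j: "j \<in> gens" "(j, i) \<in> stage" "i \<in> mid j" for j
  proof -
    have "K \<subseteq> mid j" if KU: "K \<in> \<U>" for K
    proof (cases "K = B")
      case True then show ?thesis using B_lower lower_mid by blast
    next
      case False
      then obtain k where k: "K = upper k" "(k, i) \<in> stage" "k \<in> gens" "i \<notin> upper k"
        using KU unfolding \<U>_def by blast
      then have "j \<noteq> k" using j mid_upper by blast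
      then show ?thesis using compare[OF j(2,1) k(2,3)] k j mid_upper by blast
    qed
    then have "lower i \<subseteq> mid j" unfolding lower by blast
    then show ?thesis unfolding upper_def[of i] by (rule adjoin_minimal[OF subalgebra_mid _ j(3)])
  qed
  then show ?case
    unfolding good_def using hom st lower_A i_mid prim upper_lower by blast
qed

lemma gens_lower: "i \<in> gens \<Longrightarrow> homogeneous_subalgebra (lower i)"
  using all_good unfolding good_def by blast

lemma gens_mid: "i \<in> gens \<Longrightarrow> homogeneous_subalgebra (mid i)" "i \<in> gens \<Longrightarrow> stable (mid i)"
    "i \<in> gens \<Longrightarrow> i \<notin> mid i"
  using good_mid all_good unfolding good_def by blast+

lemma gens_upper: "i \<in> gens \<Longrightarrow> homogeneous_subalgebra (upper i)" "i \<in> gens \<Longrightarrow> stable (upper i)"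
    "i \<in> gens \<Longrightarrow> upper i \<subseteq> A"
  using good_upper all_good by blast+

lemma gens_primitive: "i \<in> gens \<Longrightarrow> linear_form scale f \<Longrightarrow> slice f i - scale (f 1) i \<in> mid i"
  using all_good lower_mid unfolding good_def by blast

section \<open>The linear order of the generators\<close>

lemma gens_compare:
  assumes "j \<in> gens" "k \<in> gens" "j \<noteq> k"
  shows "upper j \<subseteq> mid k \<or> upper k \<subseteq> mid j"
proof -
  have *: "upper j \<subseteq> mid k \<or> upper k \<subseteq> mid j" if "(j, k) \<in> stage" "j \<in> gens" "k \<in> gens" for j k
  proof -
    have "k \<in> mid j \<or> k \<notin> upper j" using that gens_iff by blast
    then show ?thesis using that lower_mid all_good[OF that(3)] unfolding good_def by blast
  qed
  show ?thesis using stage_total[OF assms(3)] * assms by blast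
qed

lemma gens_cover:
  assumes "y \<in> A" "y \<notin> B" "homogeneous_element V y"
  obtains k where "k \<in> gens" "y \<in> upper k" "y \<notin> mid k"
  using cover_aux[OF assms all_good] by blast

lemma gens_order_strict:
  "(j, k) \<in> gens_order - Id \<longleftrightarrow> j \<in> gens \<and> k \<in> gens \<and> upper j \<subseteq> mid k"
proof
  assume *: "(j, k) \<in> gens_order - Id"
  then have "\<not> upper k \<subseteq> mid j" using self_upper[of j] gens_mid(3)[of j] unfolding gens_order_def by blast
  then show "j \<in> gens \<and> k \<in> gens \<and> upper j \<subseteq> mid k"
    using * gens_compare[of j k] unfolding gens_order_def by blast
next
  assume "j \<in> gens \<and> k \<in> gens \<and> upper j \<subseteq> mid k"
  then show "(j, k) \<in> gens_order - Id"
    using mid_upper[of k] self_upper[of k] gens_mid(3)[of k] unfolding gens_order_def by blast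
qed

lemma gens_order_le: "(j, k) \<in> gens_order \<longleftrightarrow> j \<in> gens \<and> k \<in> gens \<and> (j = k \<or> upper j \<subseteq> mid k)"
  using gens_order_strict[of j k] unfolding gens_order_def by blast

lemma linear_order_gens: "linear_order_on gens gens_order"
proof -
  have "refl_on gens gens_order" by (auto simp: refl_on_def gens_order_def)
  moreover have "trans gens_order" by (rule transI) (auto simp: gens_order_def)
  moreover have "antisym gens_order"
  proof (rule antisymI, rule ccontr)
    fix j k assume "(j, k) \<in> gens_order" "(k, j) \<in> gens_order" "j \<noteq> k"
    then show False
      using gens_order_strict[of j k] self_upper[of k] gens_mid(3)[of k]
      unfolding gens_order_def by blast
  qed
  moreover have "total_on gens gens_order"
    using gens_compare gens_order_le by (auto simp: total_on_def)
  ultimately show ?thesis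
    by (simp add: linear_order_on_def partial_order_on_def preorder_on_def gens_order_def) blast
qed

lemma mid_cover:
  assumes k: "k \<in> gens" and y: "y \<in> mid k" "homogeneous_element V y" "y \<notin> B"
  obtains j where "j \<in> gens" "upper j \<subseteq> mid k" "y \<in> upper j" "y \<notin> mid j"
proof -
  have "y \<in> A" using gens_upper(3)[OF k] mid_upper y by blast
  then obtain j where j: "j \<in> gens" "y \<in> upper j" "y \<notin> mid j" using gens_cover y by blast
  then have "\<not> upper k \<subseteq> mid j" "j \<noteq> k" using y mid_upper by blast+
  then show thesis using that j gens_compare[OF j(1) k] by blast
qed

section \<open>Least generators among those of bounded degree type\<close>

lemma gap_divisor:
  assumes k: "k \<in> gens" and y: "y \<in> upper k" "y \<notin> lower k" "y \<in> V \<gamma>"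
  shows "divisor (deg k) \<gamma>"
  using adjoin_component_not_divisor[OF gens_lower[OF k] gens_V[OF k], of y \<gamma>] y component_V[OF y(3)]
  unfolding upper_def by auto

text \<open>\<open>\<zeta>\<close> is tested after \<open>\<xi>\<close> but stands below it. In
  their common degree \<open>mid \<xi>\<close> and \<open>lower \<xi>\<close> agree, so some earlier
  \<open>upper j\<close> contains \<open>\<zeta>\<close> and not \<open>\<xi>\<close>. For the first
  such \<open>j\<close> in the order of testing, \<open>\<zeta>\<close> lies in \<open>mid j\<close>
  but not in \<open>lower j\<close>, which forces \<open>deg j\<close> to be a proper divisor of the
  common degree.\<close>

lemma separating_generator:
  assumes \<xi>: "\<xi> \<in> gens" and \<zeta>: "\<zeta> \<in> gens" and stage: "(\<xi>, \<zeta>) \<in> stage"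
    and deg: "deg \<zeta> = deg \<xi>" and below: "upper \<zeta> \<subseteq> mid \<xi>"
  obtains j where "j \<in> gens" "divisor (deg j) (deg \<xi>)" "deg j \<noteq> deg \<xi>" "\<zeta> \<in> mid j" "\<xi> \<notin> upper j"
proof -
  have \<zeta>V: "\<zeta> \<in> V (deg \<xi>)" using gens_V[OF \<zeta>] deg by simp
  have \<zeta>B: "\<zeta> \<notin> B" using \<zeta> gens_iff by blast
  define P where "P j \<longleftrightarrow> j \<in> gens \<and> \<xi> \<notin> upper j \<and> \<zeta> \<in> upper j" for j
  have "\<zeta> \<in> mid \<xi>" using below self_upper by blast
  then have "\<zeta> \<in> lower \<xi>"
    using ad_closure_component_le[OF gens_lower[OF \<xi>] gens_V[OF \<xi>], of \<zeta> "deg \<xi>"] component_V[OF \<zeta>V]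
    unfolding mid_def by auto
  then obtain j1 where j1: "P j1" "(j1, \<xi>) \<in> stage"
    using \<zeta>B unfolding P_def by (subst (asm) lower_eq) blast
  obtain j where j: "P j" "\<And>j'. (j', j) \<in> stage \<Longrightarrow> \<not> P j'"
    using wfE_min[OF wf_stage, of j1 "Collect P"] j1(1) by auto
  have "(j, \<xi>) \<in> stage"
    using j1 j(2)[of j1] stage_total[of j j1] stage_trans by blast
  then have "(j, \<zeta>) \<in> stage" using stage stage_trans by blast
  \<comment> \<open>As a generator tested after \<open>j\<close>, \<open>\<zeta>\<close> avoids the
    gap of \<open>j\<close>.\<close>
  then have \<zeta>j: "\<zeta> \<in> mid j" using \<zeta> gens_iff j(1) unfolding P_def by blast
  have "\<zeta> \<notin> lower j"
  proof
    assume "\<zeta> \<in> lower j"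
    then obtain j' where j': "(j', j) \<in> stage" "j' \<in> gens" "j \<notin> upper j'" "\<zeta> \<in> upper j'"
      using \<zeta>B by (subst (asm) lower_eq) blast
    then have "upper j' \<subseteq> lower j" by (subst lower_eq) blast
    then have "P j'" using j' j(1) lower_mid mid_upper unfolding P_def by blast
    then show False using j(2) j' by blast
  qed
  moreover have jg: "j \<in> gens" using j(1) unfolding P_def by blast
  ultimately have "divisor (deg j) (deg \<xi>)" "deg j \<noteq> deg \<xi>"
    using gap_divisor[of j \<zeta>] ad_closure_component_le[OF gens_lower[OF jg] gens_V[OF jg], of \<zeta> "deg \<xi>"]
      j(1) \<zeta>V \<zeta>j component_V[OF \<zeta>V] unfolding P_def mid_def by auto
  then show thesis using that \<zeta>j j(1) unfolding P_def by blast
qed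

definition least_of :: "'h set \<Rightarrow> 'h \<Rightarrow> bool"
  where "least_of Q m \<longleftrightarrow> m \<in> Q \<and> (\<forall>q\<in>Q. (m, q) \<in> gens_order)"

text \<open>Of the two least elements of the parts, the smaller one is least in the union. This
  passes from a single degree to the finitely many divisors of a degree.\<close>

lemma least_finite_union:
  assumes "finite G" and least: "\<And>\<beta> Q. \<beta> \<in> G \<Longrightarrow> Q \<subseteq> {k\<in>gens. deg k = \<beta>} \<Longrightarrow> Q \<noteq> {} \<Longrightarrow> \<exists>m. least_of Q m"
  shows "Q \<subseteq> {k\<in>gens. deg k \<in> G} \<Longrightarrow> Q \<noteq> {} \<Longrightarrow> \<exists>m. least_of Q m"
  using assms
proof (induction G arbitrary: Q rule: finite_induct)
  case (insert \<beta> G)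
  let ?Q1 = "{k\<in>Q. deg k = \<beta>}" and ?Q2 = "{k\<in>Q. deg k \<in> G}"
  have Q: "Q = ?Q1 \<union> ?Q2" using insert.prems(1) by auto
  have 1: "?Q1 \<noteq> {} \<Longrightarrow> \<exists>m. least_of ?Q1 m" using insert.prems(1) by (intro insert.prems(3)[of \<beta>]) auto
  have 2: "\<exists>m. least_of ?Q2 m" if "?Q2 \<noteq> {}"
  proof (rule insert.IH[OF _ that])
    show "?Q2 \<subseteq> {k\<in>gens. deg k \<in> G}" using insert.prems(1) by blast
    show "\<exists>m. least_of Q' m" if "\<beta>' \<in> G" "Q' \<subseteq> {k\<in>gens. deg k = \<beta>'}" "Q' \<noteq> {}" for \<beta>' Q'
      by (rule insert.prems(3)[OF _ that(2,3)]) (simp add: that(1))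
  qed
  show ?case
  proof (cases "?Q1 = {} \<or> ?Q2 = {}")
    case True
    then have "Q = ?Q1 \<or> Q = ?Q2" using Q by blast
    then show ?thesis using 1 2 insert.prems(2) by (elim disjE) simp_all
  next
    case False
    then obtain m1 m2 where m: "least_of ?Q1 m1" "least_of ?Q2 m2" using 1 2 by blast
    have tr: "trans gens_order" and tot: "total_on gens gens_order" and re: "refl_on gens gens_order"
      using linear_order_gens
      by (auto simp: linear_order_on_def partial_order_on_def preorder_on_def)
    have mg: "m1 \<in> gens" "m2 \<in> gens" using m insert.prems(1) unfolding least_of_def by blast+
    then have "(m1, m2) \<in> gens_order \<or> (m2, m1) \<in> gens_order"
      using tot re unfolding total_on_def refl_on_def by metis
    then have "least_of Q m1 \<or> least_of Q m2"
    proof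
      assume "(m1, m2) \<in> gens_order"
      then have "least_of (?Q1 \<union> ?Q2) m1" using m transD[OF tr] unfolding least_of_def by blast
      then show ?thesis using Q by simp
    next
      assume "(m2, m1) \<in> gens_order"
      then have "least_of (?Q1 \<union> ?Q2) m2" using m transD[OF tr] unfolding least_of_def by blast
      then show ?thesis using Q by simp
    qed
    then show ?thesis by blast
  qed
qed auto

text \<open>A set of generators of degree \<open>\<alpha>\<close> without least element would be separated by a set of
  generators of degrees properly dividing \<open>\<alpha>\<close>, again without least element.\<close>

lemma least_degree: "Q \<subseteq> {k\<in>gens. deg k = \<alpha>} \<Longrightarrow> Q \<noteq> {} \<Longrightarrow> \<exists>m. least_of Q m"
proof (induction \<alpha> arbitrary: Q rule: ord.less_induct)
  case (less \<alpha>)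
  show ?case
  proof (rule ccontr)
    assume no: "\<nexists>m. least_of Q m"
    \<comment> \<open>The separators between members of \<open>Q\<close>. Their degrees properly
      divide \<open>\<alpha>\<close>, so the induction hypothesis provides a least one.\<close>
    define J where "J = {j\<in>gens. divisor (deg j) \<alpha> \<and> deg j \<noteq> \<alpha> \<and> (\<exists>\<xi>\<in>Q. \<exists>\<zeta>\<in>Q. \<zeta> \<in> mid j \<and> \<xi> \<notin> upper j)}"
    \<comment> \<open>The first tested element \<open>\<xi>\<close> of \<open>Q'\<close> is not
      least in \<open>Q\<close>, so some \<open>\<zeta>\<close> stands below it; \<open>Q'\<close>
      being closed downwards, \<open>\<zeta>\<close> is in \<open>Q'\<close> and thus tested after
      \<open>\<xi>\<close>. This is the situation of \<open>separating_generator\<close>.\<close>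
    have sep: "\<exists>j\<in>J. \<exists>\<xi>\<in>Q'. \<xi> \<notin> upper j"
      if Q': "Q' \<subseteq> Q" "Q' \<noteq> {}" "\<And>q q'. q \<in> Q' \<Longrightarrow> q' \<in> Q \<Longrightarrow> upper q' \<subseteq> mid q \<Longrightarrow> q' \<in> Q'" for Q'
    proof -
      obtain \<xi> where \<xi>: "\<xi> \<in> Q'" "\<And>y. (y, \<xi>) \<in> stage \<Longrightarrow> y \<notin> Q'"
        using wfE_min[OF wf_stage] Q'(2) by (metis all_not_in_conv)
      obtain \<zeta> where \<zeta>: "\<zeta> \<in> Q" "(\<xi>, \<zeta>) \<notin> gens_order"
        using no \<xi>(1) Q'(1) unfolding least_of_def by blast
      have g: "\<xi> \<in> gens" "\<zeta> \<in> gens" "deg \<xi> = \<alpha>" "deg \<zeta> = \<alpha>" using \<xi> \<zeta> Q'(1) less.prems by blast+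
      then have *: "upper \<zeta> \<subseteq> mid \<xi>" "\<zeta> \<noteq> \<xi>"
        using \<zeta>(2) gens_compare[of \<xi> \<zeta>] gens_order_le by blast+
      then have "\<zeta> \<in> Q'" using Q'(3) \<xi> \<zeta> by blast
      then have "(\<xi>, \<zeta>) \<in> stage" using \<xi>(2) stage_total[OF *(2)] by blast
      from separating_generator[OF g(1,2) this _ *(1)] g(3,4) obtain j where
        "j \<in> gens" "divisor (deg j) \<alpha>" "deg j \<noteq> \<alpha>" "\<zeta> \<in> mid j" "\<xi> \<notin> upper j" by metis
      then show ?thesis using \<xi> \<zeta> Q'(1) unfolding J_def by blast
    qed
    have "J \<noteq> {}" using sep[of Q] less.prems(2) by blast
    moreover have "J \<subseteq> {k\<in>gens. deg k \<in> {\<beta>. divisor \<beta> \<alpha> \<and> \<beta> \<noteq> \<alpha>}}" unfolding J_def by blast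
    moreover have "finite {\<beta>. divisor \<beta> \<alpha> \<and> \<beta> \<noteq> \<alpha>}"
      by (rule finite_subset[OF _ finite_divisors[of \<alpha>]]) blast
    moreover have "\<exists>m. least_of Q m"
      if "\<beta> \<in> {\<beta>. divisor \<beta> \<alpha> \<and> \<beta> \<noteq> \<alpha>}" "Q \<subseteq> {k\<in>gens. deg k = \<beta>}" "Q \<noteq> {}" for \<beta> Q
      using less.IH[of \<beta> Q] that divisor_le[of \<beta> \<alpha>] ord.le_less by blast
    ultimately obtain j0 where j0: "least_of J j0"
      using least_finite_union[of "{\<beta>. divisor \<beta> \<alpha> \<and> \<beta> \<noteq> \<alpha>}" J] by blast
    then have j0g: "j0 \<in> gens" and "\<exists>\<zeta>\<in>Q. \<zeta> \<in> mid j0" unfolding least_of_def J_def by blast+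
    have below: "upper q \<subseteq> mid j0" if "q \<in> Q" "q \<in> mid j0" for q
    proof -
      have q: "q \<in> gens" using that less.prems by blast
      have "q \<noteq> j0" "\<not> upper j0 \<subseteq> mid q"
        using that gens_mid(3)[OF j0g] gens_mid(3)[OF q] mid_upper by blast+
      then show ?thesis using gens_compare[OF q j0g] by blast
    qed
    \<comment> \<open>Applied to the part of \<open>Q\<close> below the least separator
      \<open>j0\<close>, \<open>sep\<close> gives a separator below some \<open>\<xi>\<close> of
      that part, hence strictly below \<open>j0\<close>.\<close>
    have "\<exists>j\<in>J. \<exists>\<xi>\<in>{q\<in>Q. q \<in> mid j0}. \<xi> \<notin> upper j"
    proof (rule sep)
      show "{q\<in>Q. q \<in> mid j0} \<noteq> {}" using \<open>\<exists>\<zeta>\<in>Q. \<zeta> \<in> mid j0\<close> by blast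
      show "q' \<in> {q\<in>Q. q \<in> mid j0}"
        if "q \<in> {q\<in>Q. q \<in> mid j0}" "q' \<in> Q" "upper q' \<subseteq> mid q" for q q'
        using that below self_upper[of q'] mid_upper[of q] by blast
    qed blast
    then obtain j \<xi> where j: "j \<in> J" "\<xi> \<in> Q" "\<xi> \<in> mid j0" "\<xi> \<notin> upper j" by blast
    have g: "j \<in> gens" "\<xi> \<in> gens" using j less.prems unfolding J_def by blast+
    have "upper j \<subseteq> mid \<xi>" using gens_compare[OF g] j(4) self_upper mid_upper by blast
    then have "upper j \<subseteq> mid j0" using below j mid_upper by blast
    moreover have "upper j0 \<subseteq> upper j" using j0 j(1) unfolding least_of_def gens_order_def by blast
    ultimately show False using self_upper gens_mid(3)[OF j0g] by blast
  qed
qed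

lemma least_divisor_degrees:
  assumes "Q \<subseteq> {k\<in>gens. divisor (deg k) \<gamma>}" "Q \<noteq> {}"
  shows "\<exists>m. least_of Q m"
proof (rule least_finite_union[OF finite_divisors[of \<gamma>]])
  show "\<exists>m. least_of Q' m" if "Q' \<subseteq> {k\<in>gens. deg k = \<beta>}" "Q' \<noteq> {}" for \<beta> Q'
    using least_degree that .
qed (use assms in auto)

end

section \<open>PBW monomials\<close>

lemma sorted_wrt_same_set:
  assumes "\<And>x y. P x y \<Longrightarrow> \<not> P y x"
  shows "sorted_wrt P xs \<Longrightarrow> sorted_wrt P ys \<Longrightarrow> set xs = set ys \<Longrightarrow> xs = ys"
proof (induction xs arbitrary: ys)
  case (Cons x xs)
  then obtain y ys' where ys: "ys = y # ys'" by (cases ys) auto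
  have irrefl: "\<not> P u u" for u using assms by blast
  have "x = y"
    using Cons.prems assms unfolding ys by (metis list.set_intros(1) set_ConsD sorted_wrt.simps(2))
  moreover have "x \<notin> set xs" "y \<notin> set ys'"
    using Cons.prems(1,2) irrefl unfolding ys by (metis sorted_wrt.simps(2))+
  ultimately have "set xs = set ys'" using Cons.prems(3) unfolding ys by (simp add: insert_ident)
  then show ?case using Cons \<open>x = y\<close> unfolding ys by simp
qed simp

lemma pbw_monomial_simps [simp]:
  "pbw_monomial z [] = 1"
  "pbw_monomial z ((\<xi>, n) # es) = z \<xi> ^ n * pbw_monomial z es"
  "pbw_monomial z (es @ fs) = pbw_monomial z es * pbw_monomial z fs"
  by (simp_all add: pbw_monomial_def)

lemma pbw_exprs_iff:
  "es \<in> pbw_exprs X r \<longleftrightarrow> sorted_wrt (\<lambda>p q. (fst p, fst q) \<in> r - Id) es \<and>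
    (\<forall>p\<in>set es. fst p \<in> X \<and> snd p > 0)"
  unfolding pbw_exprs_def by (auto simp: sorted_wrt_map)

lemma pbw_exprs_mono: "X \<subseteq> Y \<Longrightarrow> pbw_exprs X r \<subseteq> pbw_exprs Y r"
  unfolding subset_iff pbw_exprs_iff by blast

lemma pbw_exprs_Nil: "[] \<in> pbw_exprs X r"
  by (simp add: pbw_exprs_iff)

lemma linear_order_onD:
  assumes "linear_order_on Z r"
  shows "trans r" "antisym r" "trans (r - Id)"
    "x \<in> Z \<Longrightarrow> y \<in> Z \<Longrightarrow> x \<noteq> y \<Longrightarrow> (x, y) \<in> r - Id \<or> (y, x) \<in> r - Id"
  using assms
  by (auto simp: linear_order_on_def partial_order_on_def preorder_on_def total_on_def
      intro!: trans_diff_Id)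

text \<open>Here \<open>r\<close> may be any linear order: a letter that is largest in the chain can
  have its place anywhere inside the expression.\<close>

lemma pbw_exprs_insert:
  assumes r: "linear_order_on Z r" and es: "es \<in> pbw_exprs X r" and X: "X \<subseteq> Z"
    and \<xi>: "\<xi> \<in> Z" "\<xi> \<notin> X" and n: "n > 0"
  obtains es1 es2 where "es = es1 @ es2" "es1 @ (\<xi>, n) # es2 \<in> pbw_exprs (insert \<xi> X) r"
proof -
  have "\<exists>es1 es2. es = es1 @ es2 \<and> (\<forall>p\<in>set es1. (fst p, \<xi>) \<in> r - Id) \<and> (\<forall>p\<in>set es2. (\<xi>, fst p) \<in> r - Id)"
    using es
  proof (induction es)
    case Nil then show ?case by simp
  next
    case (Cons p es)
    have es: "es \<in> pbw_exprs X r" and p: "fst p \<in> X" and pq: "\<And>q. q \<in> set es \<Longrightarrow> (fst p, fst q) \<in> r - Id"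
      using Cons.prems by (auto simp: pbw_exprs_iff)
    from Cons.IH[OF es] obtain es1 es2 where IH: "es = es1 @ es2"
      "\<forall>p\<in>set es1. (fst p, \<xi>) \<in> r - Id" "\<forall>p\<in>set es2. (\<xi>, fst p) \<in> r - Id" by blast
    have "(fst p, \<xi>) \<in> r - Id \<or> (\<xi>, fst p) \<in> r - Id"
      using linear_order_onD(4)[OF r] p X \<xi> by blast
    then show ?case
    proof
      assume "(fst p, \<xi>) \<in> r - Id"
      then show ?thesis using IH by (intro exI[of _ "p # es1"] exI[of _ es2]) auto
    next
      assume *: "(\<xi>, fst p) \<in> r - Id"
      then have "(\<xi>, fst q) \<in> r - Id" if "q \<in> set (p # es)" for q
        using that pq[of q] transD[OF linear_order_onD(3)[OF r] *, of "fst q"] by (cases "q = p") simp_all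
      then show ?thesis by (intro exI[of _ "[]"] exI[of _ "p # es"]) simp
    qed
  qed
  then obtain es1 es2 where s: "es = es1 @ es2" "\<forall>p\<in>set es1. (fst p, \<xi>) \<in> r - Id"
    "\<forall>p\<in>set es2. (\<xi>, fst p) \<in> r - Id" by blast
  then have "es1 @ (\<xi>, n) # es2 \<in> pbw_exprs (insert \<xi> X) r"
    using es n by (auto simp: pbw_exprs_iff sorted_wrt_append)
  then show thesis using that s(1) by blast
qed

section \<open>Removing a letter from an expression\<close>

definition exponent :: "'i \<Rightarrow> ('i \<times> nat) list \<Rightarrow> nat"
  where "exponent \<xi> es = (\<Sum>(\<eta>, n)\<leftarrow>es. if \<eta> = \<xi> then n else 0)"

definition remove_letter :: "'i \<Rightarrow> ('i \<times> nat) list \<Rightarrow> ('i \<times> nat) list"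
  where "remove_letter \<xi> es = filter (\<lambda>p. fst p \<noteq> \<xi>) es"

lemma exponent_simps [simp]:
  "exponent \<xi> [] = 0"
  "exponent \<xi> (p # es) = (if fst p = \<xi> then snd p else 0) + exponent \<xi> es"
  by (auto simp: exponent_def split: prod.splits)

lemma exponent_append: "exponent \<xi> (es @ fs) = exponent \<xi> es + exponent \<xi> fs"
  by (induction es) auto

lemma exponent_0: "(\<forall>p\<in>set es. fst p \<noteq> \<xi>) \<Longrightarrow> exponent \<xi> es = 0"
  by (induction es) auto

lemma remove_letter_id: "(\<forall>p\<in>set es. fst p \<noteq> \<xi>) \<Longrightarrow> remove_letter \<xi> es = es"
  unfolding remove_letter_def by (simp add: filter_id_conv)

lemma remove_letter_pbw_exprs:
  "es \<in> pbw_exprs X r \<Longrightarrow> remove_letter \<xi> es \<in> pbw_exprs (X - {\<xi>}) r"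
  unfolding remove_letter_def by (auto simp: pbw_exprs_iff sorted_wrt_filter)

lemma pbw_exprs_split:
  assumes es: "es \<in> pbw_exprs X r"
  shows "(\<exists>es1 es2. es = es1 @ (\<xi>, exponent \<xi> es) # es2 \<and> remove_letter \<xi> es = es1 @ es2) \<or>
    exponent \<xi> es = 0 \<and> remove_letter \<xi> es = es"
proof (cases "\<exists>p\<in>set es. fst p = \<xi>")
  case False
  then have *: "\<forall>p\<in>set es. fst p \<noteq> \<xi>" by blast
  show ?thesis using exponent_0[OF *] remove_letter_id[OF *] by simp
next
  case True
  then obtain p es1 es2 where s: "es = es1 @ p # es2" "fst p = \<xi>" by (meson split_list)
  have "\<forall>p\<in>set es1. fst p \<noteq> \<xi>" "\<forall>p\<in>set es2. fst p \<noteq> \<xi>"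
    using es s by (auto simp: pbw_exprs_iff sorted_wrt_append)
  then have "exponent \<xi> es2 = 0" "remove_letter \<xi> es1 = es1" "remove_letter \<xi> es2 = es2"
    "exponent \<xi> es = snd p"
    using exponent_0[of es2 \<xi>] remove_letter_id[of es1 \<xi>] remove_letter_id[of es2 \<xi>] s
      exponent_0[of es1 \<xi>] by (auto simp: exponent_append)
  then show ?thesis
    using s by (intro disjI1 exI[of _ es1] exI[of _ es2]) (auto simp: remove_letter_def)
qed

lemma pbw_exprs_eqI:
  assumes "antisym r" and es: "es \<in> pbw_exprs X r" and fs: "fs \<in> pbw_exprs X r"
    and eq: "exponent \<xi> es = exponent \<xi> fs" "remove_letter \<xi> es = remove_letter \<xi> fs"
  shows "es = fs"
proof (rule sorted_wrt_same_set[where P = "\<lambda>p q. (fst p, fst q) \<in> r - Id"])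
  have *: "set gs = set (remove_letter \<xi> gs) \<union> (if exponent \<xi> gs = 0 then {} else {(\<xi>, exponent \<xi> gs)})"
    if gs: "gs \<in> pbw_exprs X r" for gs
  proof -
    have pos: "\<forall>p\<in>set gs. snd p > 0" using gs by (simp add: pbw_exprs_iff)
    show ?thesis
      using pbw_exprs_split[OF gs, of \<xi>]
    proof
      assume "\<exists>es1 es2. gs = es1 @ (\<xi>, exponent \<xi> gs) # es2 \<and> remove_letter \<xi> gs = es1 @ es2"
      then obtain es1 es2 where split: "gs = es1 @ (\<xi>, exponent \<xi> gs) # es2"
        "remove_letter \<xi> gs = es1 @ es2" by blast
      have "set gs = set (es1 @ es2) \<union> {(\<xi>, exponent \<xi> gs)}" by (subst split(1)) auto
      moreover from this have "exponent \<xi> gs > 0" using pos by auto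
      ultimately show ?thesis by (simp add: split(2))
    qed simp
  qed
  show "set es = set fs" using *[OF es] *[OF fs] eq by simp
qed (use assms in \<open>auto simp: pbw_exprs_iff antisym_def\<close>)

text \<open>The flag selects the left or the right module structure, so that both basis statements
  have one proof.\<close>

definition side_mult :: "bool \<Rightarrow> 'h::ring_1 \<Rightarrow> 'h \<Rightarrow> 'h"
  where "side_mult s b w = (if s then b * w else w * b)"

lemma side_mult_0 [simp]: "side_mult s 0 w = 0" "side_mult s b 0 = 0"
  by (simp_all add: side_mult_def)

lemma side_mult_add: "side_mult s (b + b') w = side_mult s b w + side_mult s b' w"
  by (simp add: side_mult_def algebra_simps)

definition side_basis :: "bool \<Rightarrow> 'h::ring_1 set \<Rightarrow> 'h set \<Rightarrow> 'i set \<Rightarrow> ('i \<Rightarrow> 'h) \<Rightarrow> bool"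
  where "side_basis s B A I w \<longleftrightarrow> w ` I \<subseteq> A \<and>
    (\<forall>a\<in>A. \<exists>F c. finite F \<and> F \<subseteq> I \<and> c ` F \<subseteq> B \<and> a = (\<Sum>i\<in>F. side_mult s (c i) (w i))) \<and>
    (\<forall>F c. finite F \<longrightarrow> F \<subseteq> I \<longrightarrow> c ` F \<subseteq> B \<longrightarrow> (\<Sum>i\<in>F. side_mult s (c i) (w i)) = 0 \<longrightarrow>
      (\<forall>i\<in>F. c i = 0))"

lemma side_basis_expansion:
  assumes "side_basis s B A I w" "a \<in> A"
  obtains F c where "finite F" "F \<subseteq> I" "c ` F \<subseteq> B" "a = (\<Sum>i\<in>F. side_mult s (c i) (w i))"
proof -
  have "\<forall>a\<in>A. \<exists>F c. finite F \<and> F \<subseteq> I \<and> c ` F \<subseteq> B \<and> a = (\<Sum>i\<in>F. side_mult s (c i) (w i))"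
    using assms(1) unfolding side_basis_def by (elim conjE)
  from bspec[OF this assms(2)] show thesis by (elim exE conjE) (rule that)
qed

lemma side_basis_poly_mapping:
  assumes sb: "side_basis s B A I w" and B: "0 \<in> B"
  shows "w ` I \<subseteq> A"
    and "a \<in> A \<Longrightarrow> \<exists>c. Poly_Mapping.keys c \<subseteq> I \<and> range (Poly_Mapping.lookup c) \<subseteq> B \<and>
       a = (\<Sum>i\<in>Poly_Mapping.keys c. side_mult s (Poly_Mapping.lookup c i) (w i))"
    and "Poly_Mapping.keys c \<subseteq> I \<Longrightarrow> range (Poly_Mapping.lookup c) \<subseteq> B \<Longrightarrow>
       (\<Sum>i\<in>Poly_Mapping.keys c. side_mult s (Poly_Mapping.lookup c i) (w i)) = 0 \<Longrightarrow> c = 0"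
proof -
  show "w ` I \<subseteq> A" using sb by (simp add: side_basis_def)
  show "\<exists>c. Poly_Mapping.keys c \<subseteq> I \<and> range (Poly_Mapping.lookup c) \<subseteq> B \<and>
       a = (\<Sum>i\<in>Poly_Mapping.keys c. side_mult s (Poly_Mapping.lookup c i) (w i))" if aA: "a \<in> A"
  proof -
    obtain F c where F: "finite F" "F \<subseteq> I" "c ` F \<subseteq> B" "a = (\<Sum>i\<in>F. side_mult s (c i) (w i))"
      by (rule side_basis_expansion[OF sb aA])
    let ?h = "\<lambda>i. if i \<in> F then c i else 0"
    define f where "f = Abs_poly_mapping ?h"
    have "finite {i. ?h i \<noteq> 0}" by (rule finite_subset[OF _ F(1)]) (auto split: if_splits)
    then have f: "Poly_Mapping.lookup f = ?h" unfolding f_def by (rule lookup_Abs_poly_mapping)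
    have "(\<Sum>i\<in>Poly_Mapping.keys f. side_mult s (Poly_Mapping.lookup f i) (w i)) = a"
      unfolding F(4)
      by (rule sum.mono_neutral_cong_left[OF F(1)]) (auto simp: in_keys_iff f split: if_splits)
    moreover have "Poly_Mapping.keys f \<subseteq> I"
      using F(2) by (auto simp: in_keys_iff f split: if_splits)
    moreover have "range (Poly_Mapping.lookup f) \<subseteq> B" using F(3) B by (auto simp: f)
    ultimately show ?thesis by metis
  qed
  show "c = 0" if "Poly_Mapping.keys c \<subseteq> I" "range (Poly_Mapping.lookup c) \<subseteq> B"
    "(\<Sum>i\<in>Poly_Mapping.keys c. side_mult s (Poly_Mapping.lookup c i) (w i)) = 0"
  proof -
    have "\<forall>i\<in>Poly_Mapping.keys c. Poly_Mapping.lookup c i = 0"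
    proof -
      have "\<forall>F c. finite F \<longrightarrow> F \<subseteq> I \<longrightarrow> c ` F \<subseteq> B \<longrightarrow>
          (\<Sum>i\<in>F. side_mult s (c i) (w i)) = 0 \<longrightarrow> (\<forall>i\<in>F. c i = 0)"
        using sb unfolding side_basis_def by (elim conjE)
      moreover have "Poly_Mapping.lookup c ` Poly_Mapping.keys c \<subseteq> B" using that(2) by blast
      ultimately show ?thesis using that(1,3) finite_keys[of c] by metis
    qed
    then show ?thesis by (intro poly_mapping_eqI) (auto simp: in_keys_iff)
  qed
qed

lemma left_module_basis_side:
  assumes "side_basis True B A I w" "0 \<in> B"
  shows "left_module_basis B A I w"
  unfolding left_module_basis_def
  using side_basis_poly_mapping[OF assms] by (simp add: side_mult_def)

lemma right_module_basis_side:
  assumes "side_basis False B A I w" "0 \<in> B"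
  shows "right_module_basis B A I w"
  unfolding right_module_basis_def
  using side_basis_poly_mapping[OF assms] by (simp add: side_mult_def)

context coideal_pair
begin

section \<open>Spanning by PBW monomials\<close>

abbreviation monomial :: "('h \<times> nat) list \<Rightarrow> 'h"
  where "monomial \<equiv> pbw_monomial (\<lambda>x. x)"

lemma monomial_mem:
  "subalgebra scale K \<Longrightarrow> es \<in> pbw_exprs X r \<Longrightarrow> X \<subseteq> K \<Longrightarrow> monomial es \<in> K"
proof (induction es)
  case (Cons p es)
  then show ?case
    by (cases p) (auto simp: pbw_exprs_iff intro!: subalgebra_mult subalgebra_power)
qed (simp add: subalgebra_one)

lemma monomial_V: "es \<in> pbw_exprs X r \<Longrightarrow> X \<subseteq> gens \<Longrightarrow> \<exists>\<beta>. monomial es \<in> V \<beta>"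
proof (induction es)
  case (Cons p es)
  then obtain \<beta> where \<beta>: "monomial es \<in> V \<beta>" by (auto simp: pbw_exprs_iff)
  have "fst p \<in> gens" using Cons.prems by (auto simp: pbw_exprs_iff)
  then obtain \<alpha> where "fst p ^ snd p \<in> V \<alpha>" using power_V[OF gens_V] by blast
  then show ?case using mult_V[OF _ \<beta>] by (cases p) auto
qed (use one_V in auto)

lemma side_mult_mem: "subalgebra scale K \<Longrightarrow> b \<in> K \<Longrightarrow> w \<in> K \<Longrightarrow> side_mult s b w \<in> K"
  by (simp add: side_mult_def subalgebra_mult)

lemma side_mult_scale: "side_mult s (scale a b) w = scale a (side_mult s b w)"
  by (simp add: side_mult_def flip: scale_mult_left scale_mult_right)

text \<open>A linear span over the field is enough, because the coefficients \<open>b\<close>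
  already range over all of \<open>B\<close>; \<open>pbw_span_combination\<close> collects it into
  combinations over \<open>B\<close>.\<close>

definition pbw_span :: "bool \<Rightarrow> 'h rel \<Rightarrow> 'h set \<Rightarrow> 'h set"
  where "pbw_span s r Y = span {side_mult s b (monomial es) | b es. b \<in> B \<and> es \<in> pbw_exprs Y r}"

lemma pbw_span_mono: "X \<subseteq> Y \<Longrightarrow> pbw_span s r X \<subseteq> pbw_span s r Y"
  unfolding pbw_span_def by (rule span_mono) (use pbw_exprs_mono in blast)

lemma pbw_span_subspace: "subspace (pbw_span s r X)"
  unfolding pbw_span_def by (rule subspace_span)

lemma pbw_span_gen: "b \<in> B \<Longrightarrow> es \<in> pbw_exprs X r \<Longrightarrow> side_mult s b (monomial es) \<in> pbw_span s r X"
  unfolding pbw_span_def by (rule span_base) blast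

lemma pbw_span_B: "b \<in> B \<Longrightarrow> b \<in> pbw_span s r X"
  using pbw_span_gen[of b "[]" X r s] pbw_exprs_Nil[of X r] by (cases s) (simp_all add: side_mult_def)

lemma pbw_span_induct:
  assumes "x \<in> pbw_span s r X" "subspace {x. P x}"
    and "\<And>b es. b \<in> B \<Longrightarrow> es \<in> pbw_exprs X r \<Longrightarrow> P (side_mult s b (monomial es))"
  shows "P x"
  using assms(1,2) unfolding pbw_span_def
  by (rule span_induct) (use assms(3) in auto)

lemma pbw_span_component:
  assumes "x \<in> pbw_span s r X" "X \<subseteq> gens"
  shows "component \<gamma> x \<in> pbw_span s r X"
proof (rule pbw_span_induct[OF assms(1)])
  show "subspace {x. component \<gamma> x \<in> pbw_span s r X}"
    by (rule subspaceI)
      (auto simp: component_add component_scale subspace_0[OF pbw_span_subspace]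
        intro: subspace_add[OF pbw_span_subspace] subspace_scale[OF pbw_span_subspace])
  fix b es assume b: "b \<in> B" and es: "es \<in> pbw_exprs X r"
  obtain \<beta> where \<beta>: "monomial es \<in> V \<beta>" using monomial_V[OF es assms(2)] by blast
  show "component \<gamma> (side_mult s b (monomial es)) \<in> pbw_span s r X"
  proof (cases "divisor \<beta> \<gamma>")
    case False
    then show ?thesis
      by (simp add: side_mult_def component_mult_right_0[OF \<beta>] component_mult_left_0[OF \<beta>]
          subspace_0[OF pbw_span_subspace])
  next
    case True
    then obtain \<alpha> where \<gamma>: "\<gamma> = \<beta> + \<alpha>" unfolding divisor_def by blast
    have "component \<gamma> (side_mult s b (monomial es)) = side_mult s (component \<alpha> b) (monomial es)"
      unfolding side_mult_def \<gamma>
      using component_mult_right[OF \<beta>, of \<alpha> b] component_mult_left[OF \<beta>, of \<alpha> b]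
      by (simp add: add.commute)
    moreover have "component \<alpha> b \<in> B" using hom_B b unfolding homogeneous_subalgebra_def by blast
    ultimately show ?thesis using pbw_span_gen[OF _ es] by simp
  qed
qed

text \<open>The power \<open>\<xi> ^ n\<close> can be moved to its place among smaller letters modulo lower powers of
  \<open>\<xi>\<close>.\<close>

lemma side_mult_move:
  assumes E: "subalgebra scale E" and ad: "\<And>x. x \<in> E \<Longrightarrow> z * x - x * z \<in> E"
    and w: "u \<in> E" "w \<in> E" "b \<in> E"
  shows "side_mult s b (u * (z ^ n * w)) - side_mult s b (u * w) * z ^ n \<in> filtration E z n"
proof (cases s)
  case True
  have "side_mult s b (u * (z ^ n * w)) - side_mult s b (u * w) * z ^ n
      = (b * u) * (z ^ n * w - w * z ^ n)"
    using True by (simp add: side_mult_def algebra_simps)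
  also have "\<dots> \<in> filtration E z n"
    by (intro filtration_mult_left[OF E] subalgebra_mult[OF E] w power_commutator[OF E ad])
  finally show ?thesis .
next
  case False
  have "side_mult s b (u * (z ^ n * w)) - side_mult s b (u * w) * z ^ n
      = u * (z ^ n * (w * b) - (w * b) * z ^ n)"
    using False by (simp add: side_mult_def algebra_simps)
  also have "\<dots> \<in> filtration E z n"
    by (intro filtration_mult_left[OF E] subalgebra_mult[OF E] w power_commutator[OF E ad])
  finally show ?thesis .
qed

text \<open>The power of \<open>\<xi>\<close> stands on the right of \<open>x\<close>, whereas
  \<open>r\<close> wants it inside the monomials. The error of moving it is a polynomial in
  \<open>\<xi>\<close> of lower degree, which the spanning argument treats by induction on the
  exponent.\<close>

lemma pbw_span_insert:
  assumes r: "linear_order_on Z r" and Y: "Y \<subseteq> Z" "Y \<subseteq> gens" and \<xi>: "\<xi> \<in> Y" and n: "n > 0"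
    and x: "x \<in> pbw_span s r {\<eta>\<in>Y. upper \<eta> \<subseteq> mid \<xi>}"
  shows "\<exists>y\<in>pbw_span s r {\<eta>\<in>Y. upper \<eta> \<subseteq> upper \<xi>}. x * \<xi> ^ n - y \<in> filtration (mid \<xi>) \<xi> n"
proof (rule pbw_span_induct[OF x])
  let ?X = "{\<eta>\<in>Y. upper \<eta> \<subseteq> mid \<xi>}"
  let ?S = "pbw_span s r {\<eta>\<in>Y. upper \<eta> \<subseteq> upper \<xi>}" and ?F = "filtration (mid \<xi>) \<xi> n"
  note F = filtration_subspace[OF subalgebra_mid] and S = pbw_span_subspace
  show "subspace {x. \<exists>y\<in>?S. x * \<xi> ^ n - y \<in> ?F}"
  proof (rule subspaceI)
    show "0 \<in> {x. \<exists>y\<in>?S. x * \<xi> ^ n - y \<in> ?F}"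
      using subspace_0[OF F] subspace_0[OF S] by force
    fix a assume "a \<in> {x. \<exists>y\<in>?S. x * \<xi> ^ n - y \<in> ?F}"
    then obtain y where y: "y \<in> ?S" "a * \<xi> ^ n - y \<in> ?F" by blast
    have "scale c a * \<xi> ^ n - scale c y \<in> ?F" for c
      using subspace_scale[OF F y(2), of c] by (simp add: scale_right_diff_distrib scale_mult_left)
    then show "scale c a \<in> {x. \<exists>y\<in>?S. x * \<xi> ^ n - y \<in> ?F}" for c
      using subspace_scale[OF S y(1)] by blast
    fix a' assume "a' \<in> {x. \<exists>y\<in>?S. x * \<xi> ^ n - y \<in> ?F}"
    then obtain y' where y': "y' \<in> ?S" "a' * \<xi> ^ n - y' \<in> ?F" by blast
    have "(a + a') * \<xi> ^ n - (y + y') \<in> ?F"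
      using subspace_add[OF F y(2) y'(2)] by (simp add: algebra_simps)
    then show "a + a' \<in> {x. \<exists>y\<in>?S. x * \<xi> ^ n - y \<in> ?F}"
      using subspace_add[OF S y(1) y'(1)] by blast
  qed
  fix b es assume b: "b \<in> B" and es: "es \<in> pbw_exprs ?X r"
  have "\<xi> \<in> gens" using \<xi> Y by blast
  have X: "?X \<subseteq> Z" "\<xi> \<in> Z" using Y \<xi> by blast+
  have "\<xi> \<notin> ?X" using self_upper[of \<xi>] gens_mid(3)[OF \<open>\<xi> \<in> gens\<close>] by blast
  note X = X this
  obtain es1 es2 where s: "es = es1 @ es2" "es1 @ (\<xi>, n) # es2 \<in> pbw_exprs (insert \<xi> ?X) r"
    by (rule pbw_exprs_insert[OF r es X n])
  have "insert \<xi> ?X \<subseteq> {\<eta>\<in>Y. upper \<eta> \<subseteq> upper \<xi>}" using \<xi> mid_upper by blast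
  then have "side_mult s b (monomial (es1 @ (\<xi>, n) # es2)) \<in> ?S"
    by (intro pbw_span_gen[OF b] subsetD[OF pbw_exprs_mono s(2)])
  moreover have "side_mult s b (monomial es) * \<xi> ^ n - side_mult s b (monomial (es1 @ (\<xi>, n) # es2)) \<in> ?F"
  proof -
    have "es1 \<in> pbw_exprs ?X r" "es2 \<in> pbw_exprs ?X r"
      using es s(1) by (auto simp: pbw_exprs_iff sorted_wrt_append)
    moreover have "?X \<subseteq> mid \<xi>" using self_upper by blast
    ultimately have "monomial es1 \<in> mid \<xi>" "monomial es2 \<in> mid \<xi>"
      using monomial_mem[OF subalgebra_mid] by blast+
    moreover have "b \<in> mid \<xi>" using b B_lower lower_mid by blast
    ultimately have "side_mult s b (monomial es1 * (\<xi> ^ n * monomial es2))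
        - side_mult s b (monomial es1 * monomial es2) * \<xi> ^ n \<in> ?F"
      by (intro side_mult_move subalgebra_mid mid_ad)
    from subspace_neg[OF F this] show ?thesis by (simp add: s(1))
  qed
  ultimately show "\<exists>y\<in>?S. side_mult s b (monomial es) * \<xi> ^ n - y \<in> ?F" by blast
qed

text \<open>Three nested arguments: induction on the degree \<open>\<gamma>\<close>, then the least
  generator \<open>m\<close> that fails in degree \<open>\<gamma>\<close>, then induction on the
  exponent of \<open>m\<close>. The set \<open>Y\<close> is an initial segment of the chain, so that
  the generators needed below \<open>k\<close> are at hand.\<close>

lemma pbw_span_upper_homogeneous:
  assumes r: "linear_order_on Z r" and Y: "Y \<subseteq> Z" "Y \<subseteq> gens"
    and down: "\<And>j k. j \<in> gens \<Longrightarrow> k \<in> Y \<Longrightarrow> upper j \<subseteq> upper k \<Longrightarrow> j \<in> Y"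
  shows "k \<in> Y \<Longrightarrow> x \<in> upper k \<Longrightarrow> x \<in> V \<gamma> \<Longrightarrow> x \<in> pbw_span s r {\<eta>\<in>Y. upper \<eta> \<subseteq> upper k}"
proof (induction \<gamma> arbitrary: k x rule: ord.less_induct)
  case (less \<gamma>)
  define S where "S X = pbw_span s r X" for X
  note S = pbw_span_subspace[of s r, folded S_def]
  have S_mono: "S X \<subseteq> S X'" if "X \<subseteq> X'" for X X' unfolding S_def by (rule pbw_span_mono[OF that])
  let ?le = "\<lambda>k. {\<eta>\<in>Y. upper \<eta> \<subseteq> upper k}" and ?lt = "\<lambda>k. {\<eta>\<in>Y. upper \<eta> \<subseteq> mid k}"
  have homog: "homogeneous_element V x" if "x \<in> V \<alpha>" for x \<alpha>
    using that unfolding homogeneous_element_def by blast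
  have IH: "x \<in> S (?lt k)" if x: "x \<in> mid k" "x \<in> V \<alpha>" and k: "k \<in> Y" and "lt \<alpha> \<gamma>" for x k \<alpha>
  proof (cases "x \<in> B")
    case True then show ?thesis unfolding S_def by (rule pbw_span_B)
  next
    case False
    then obtain j where j: "j \<in> gens" "upper j \<subseteq> mid k" "x \<in> upper j" "x \<notin> mid j"
      using mid_cover[OF _ x(1) homog[OF x(2)]] k Y(2) by blast
    then have "j \<in> Y" using down k mid_upper by blast
    then have "x \<in> S (?le j)" using less.IH[OF \<open>lt \<alpha> \<gamma>\<close>] j x unfolding S_def by blast
    moreover have "?le j \<subseteq> ?lt k" using j(2) by blast
    ultimately show ?thesis using S_mono by blast
  qed
  \<comment> \<open>Requiring \<open>deg k\<close> to divide \<open>\<gamma>\<close> makes least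
    elements available. Nothing is lost, as an element of degree \<open>\<gamma>\<close> outside
    \<open>B\<close> lies in a gap whose generator has such a degree.\<close>
  define bad where "bad = {k\<in>Y. divisor (deg k) \<gamma> \<and> (\<exists>x. x \<in> upper k \<and> x \<in> V \<gamma> \<and> x \<notin> S (?le k))}"
  have "bad = {}"
  proof (rule ccontr)
    assume "bad \<noteq> {}"
    moreover have "bad \<subseteq> {k\<in>gens. divisor (deg k) \<gamma>}" using Y(2) unfolding bad_def by blast
    ultimately obtain m where m: "least_of bad m" using least_divisor_degrees by blast
    then have mY: "m \<in> Y" and mg: "m \<in> gens" using Y(2) unfolding least_of_def bad_def by blast+
    \<comment> \<open>Outside \<open>B\<close>, such an \<open>x\<close> lies in the gap of a
      generator strictly below \<open>m\<close> whose degree divides \<open>\<gamma>\<close>; by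
      leastness of \<open>m\<close> that generator is not bad.\<close>
    have base: "x \<in> S (?lt m)" if x: "x \<in> mid m" "x \<in> V \<gamma>" for x
    proof (cases "x \<in> B")
      case True then show ?thesis unfolding S_def by (rule pbw_span_B)
    next
      case False
      then obtain j where j: "j \<in> gens" "upper j \<subseteq> mid m" "x \<in> upper j" "x \<notin> mid j"
        using mid_cover[OF mg x(1) homog[OF x(2)]] by blast
      then have jY: "j \<in> Y" using down mY mid_upper by blast
      have "divisor (deg j) \<gamma>" using gap_divisor[OF j(1,3) _ x(2)] j(4) lower_mid by blast
      moreover have "j \<notin> bad"
        using m j(2) self_upper[of m] gens_mid(3)[OF mg] unfolding least_of_def gens_order_def by blast
      ultimately have "x \<in> S (?le j)" using jY j(3) x(2) unfolding bad_def by blast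
      moreover have "?le j \<subseteq> ?lt m" using j(2) by blast
      ultimately show ?thesis using S_mono by blast
    qed
    have lt_le: "S (?lt m) \<subseteq> S (?le m)" by (rule S_mono) (use mid_upper in blast)
    note mid_hom = gens_mid(1)[OF mg, unfolded homogeneous_subalgebra_def]
    have fil: "x \<in> S (?le m)" if "x \<in> filtration (mid m) m n" "x \<in> V \<gamma>" for x n
      using that
    proof (induction n arbitrary: x)
      case 0 then show ?case using subspace_0[OF S] by simp
    next
      case (Suc n)
      then obtain y e where ye: "x = y + e * m ^ n" "y \<in> filtration (mid m) m n" "e \<in> mid m" by auto
      have "component \<gamma> y \<in> filtration (mid m) m n"
        using filtration_component[OF subalgebra_mid _ gens_V[OF mg]] mid_hom ye(2) by blast
      then have 1: "component \<gamma> y \<in> S (?le m)" using Suc.IH component_in by blast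
      obtain \<beta> where \<beta>: "m ^ n \<in> V \<beta>" "n > 0 \<longrightarrow> \<beta> \<noteq> 0"
        using power_V[OF gens_V[OF mg]] gens_deg[OF mg] by blast
      have 2: "component \<gamma> (e * m ^ n) \<in> S (?le m)"
      proof (cases "n = 0")
        case True
        then show ?thesis using base[of "component \<gamma> e"] mid_hom ye(3) component_in lt_le by auto
      next
        case False
        show ?thesis
        proof (cases "divisor \<beta> \<gamma>")
          case False
          then show ?thesis using component_mult_right_0[OF \<beta>(1)] subspace_0[OF S] by simp
        next
          case True
          then obtain \<alpha> where \<gamma>: "\<gamma> = \<alpha> + \<beta>" unfolding divisor_def by (metis add.commute)
          \<comment> \<open>A positive power of \<open>m\<close> has nonzero degree, so the
            coefficient has smaller degree and the outer induction expands it in letters below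
            \<open>m\<close>.\<close>
          have "lt \<alpha> \<gamma>" unfolding \<gamma> by (rule lt_add_self) (use \<beta>(2) \<open>n \<noteq> 0\<close> in simp)
          let ?e = "component \<alpha> e"
          have eq: "component \<gamma> (e * m ^ n) = ?e * m ^ n"
            unfolding \<gamma> by (rule component_mult_right[OF \<beta>(1)])
          have "?e \<in> S (?lt m)"
            using IH[OF _ component_in mY \<open>lt \<alpha> \<gamma>\<close>] mid_hom ye(3) by blast
          then obtain y' where y': "y' \<in> S (?le m)" "?e * m ^ n - y' \<in> filtration (mid m) m n"
            using pbw_span_insert[OF r Y mY] \<open>n \<noteq> 0\<close> unfolding S_def by blast
          have "component \<gamma> (?e * m ^ n - y') \<in> filtration (mid m) m n"
            using filtration_component[OF subalgebra_mid _ gens_V[OF mg]] mid_hom y'(2) by blast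
          then have "component \<gamma> (?e * m ^ n - y') \<in> S (?le m)" using Suc.IH component_in by blast
          moreover have "component \<gamma> y' \<in> S (?le m)"
            using pbw_span_component y'(1) Y(2) unfolding S_def by blast
          ultimately have "component \<gamma> (?e * m ^ n - y') + component \<gamma> y' \<in> S (?le m)"
            by (rule subspace_add[OF S])
          then have "component \<gamma> (?e * m ^ n) \<in> S (?le m)" by (simp add: component_diff)
          then show ?thesis using component_V[OF component_in, of \<gamma> \<gamma> "e * m ^ n"] eq by simp
        qed
      qed
      have "x = component \<gamma> y + component \<gamma> (e * m ^ n)"
        using component_V[OF Suc.prems(2), of \<gamma>] by (simp add: ye(1) component_add)
      then show ?case using subspace_add[OF S 1 2] by simp
    qed
    have "x \<in> S (?le m)" if "x \<in> upper m" "x \<in> V \<gamma>" for x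
      using that fil unfolding upper_filtration by blast
    then show False using m unfolding least_of_def bad_def by blast
  qed
  show ?case
  proof (cases "x \<in> B")
    case True then show ?thesis by (rule pbw_span_B)
  next
    case False
    have kg: "k \<in> gens" using less.prems(1) Y(2) by blast
    then obtain j where j: "j \<in> gens" "x \<in> upper j" "x \<notin> mid j"
      using gens_cover[OF _ False homog[OF less.prems(3)]] gens_upper(3) less.prems(2) by blast
    have "upper j \<subseteq> upper k"
      using gens_compare[OF j(1) kg] j(3) less.prems(2) mid_upper by blast
    then have "j \<in> Y" using down j(1) less.prems(1) by blast
    moreover have "divisor (deg j) \<gamma>"
      using gap_divisor[OF j(1,2) _ less.prems(3)] j(3) lower_mid by blast
    ultimately have "x \<in> S (?le j)" using \<open>bad = {}\<close> j(2) less.prems(3) unfolding bad_def by blast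
    then show ?thesis using S_mono[of "?le j" "?le k"] \<open>upper j \<subseteq> upper k\<close> unfolding S_def by blast
  qed
qed

lemma pbw_span_upper:
  assumes r: "linear_order_on Z r" and Y: "Y \<subseteq> Z" "Y \<subseteq> gens"
    and down: "\<And>j k. j \<in> gens \<Longrightarrow> k \<in> Y \<Longrightarrow> upper j \<subseteq> upper k \<Longrightarrow> j \<in> Y"
    and x: "x \<in> B \<union> \<Union>(upper ` Y)"
  shows "x \<in> pbw_span s r Y"
proof (cases "x \<in> B")
  case True then show ?thesis by (rule pbw_span_B)
next
  case False
  then obtain k where k: "k \<in> Y" "x \<in> upper k" using x by blast
  show ?thesis
  proof (rule mem_subspace_components[OF pbw_span_subspace])
    fix \<gamma>
    have "component \<gamma> x \<in> upper k" using gens_upper(1) k Y(2) unfolding homogeneous_subalgebra_def by blast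
    then have "component \<gamma> x \<in> pbw_span s r {\<eta>\<in>Y. upper \<eta> \<subseteq> upper k}"
      by - (rule pbw_span_upper_homogeneous[OF r Y _ k(1) _ component_in], rule down)
    then show "component \<gamma> x \<in> pbw_span s r Y" using pbw_span_mono[of "{\<eta>\<in>Y. upper \<eta> \<subseteq> upper k}" Y] by blast
  qed
qed

lemma pbw_span_combination:
  assumes "x \<in> pbw_span s r X"
  shows "\<exists>F c. finite F \<and> F \<subseteq> pbw_exprs X r \<and> c ` F \<subseteq> B \<and> x = (\<Sum>es\<in>F. side_mult s (c es) (monomial es))"
    (is "?P x")
proof (rule pbw_span_induct[OF assms])
  show "subspace {x. ?P x}"
  proof (rule subspaceI)
    have "?P 0" by (intro exI[of _ "{}"] exI[of _ "\<lambda>_. 0"]) simp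
    then show "0 \<in> {x. ?P x}" by simp
    fix x assume "x \<in> {x. ?P x}"
    then obtain F c where F: "finite F" "F \<subseteq> pbw_exprs X r" "c ` F \<subseteq> B"
      "x = (\<Sum>es\<in>F. side_mult s (c es) (monomial es))" by blast
    have "scale a x = (\<Sum>es\<in>F. side_mult s (scale a (c es)) (monomial es))" for a
      unfolding F(4) scale_sum_right side_mult_scale ..
    moreover have "(\<lambda>es. scale a (c es)) ` F \<subseteq> B" for a
      using F(3) subalgebra_scale[OF subalgebra_B] by blast
    ultimately have "?P (scale a x)" for a
      using F(1,2) by (intro exI[of _ F] exI[of _ "\<lambda>es. scale a (c es)"] conjI)
    then show "scale a x \<in> {x. ?P x}" for a by simp
    fix y assume "y \<in> {x. ?P x}"
    then obtain G d where G: "finite G" "G \<subseteq> pbw_exprs X r" "d ` G \<subseteq> B"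
      "y = (\<Sum>es\<in>G. side_mult s (d es) (monomial es))" by blast
    let ?c = "\<lambda>es. if es \<in> F then c es else 0" and ?d = "\<lambda>es. if es \<in> G then d es else 0"
    have "x = (\<Sum>es\<in>F \<union> G. side_mult s (?c es) (monomial es))"
      unfolding F(4) by (rule sum.mono_neutral_cong_left) (use F(1) G(1) in auto)
    moreover have "y = (\<Sum>es\<in>F \<union> G. side_mult s (?d es) (monomial es))"
      unfolding G(4) by (rule sum.mono_neutral_cong_left) (use F(1) G(1) in auto)
    ultimately have "x + y = (\<Sum>es\<in>F \<union> G. side_mult s (?c es + ?d es) (monomial es))"
      by (simp add: side_mult_add sum.distrib)
    moreover have "(\<lambda>es. ?c es + ?d es) ` (F \<union> G) \<subseteq> B"
      using image_subset_iff[THEN iffD1, OF F(3)] image_subset_iff[THEN iffD1, OF G(3)]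
        subalgebra_add[OF subalgebra_B] subalgebra_zero[OF subalgebra_B] by auto
    ultimately have "?P (x + y)" using F(1,2) G(1,2)
      by (intro exI[of _ "F \<union> G"] exI[of _ "\<lambda>es. ?c es + ?d es"]) auto
    then show "x + y \<in> {x. ?P x}" by simp
  qed
  fix b es assume "b \<in> B" "es \<in> pbw_exprs X r"
  then show "?P (side_mult s b (monomial es))"
    by (intro exI[of _ "{es}"] exI[of _ "\<lambda>_. b"]) auto
qed

section \<open>Linear independence of PBW monomials\<close>

lemma gens_power_independent:
  "\<xi> \<in> gens \<Longrightarrow> e \<in> mid \<xi> \<Longrightarrow> e * \<xi> ^ n \<in> filtration (mid \<xi>) \<xi> n \<Longrightarrow> e = 0"
  using power_independent[OF subalgebra_mid gens_mid(2) mid_ad gens_primitive gens_mid(3)] by blast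

text \<open>Induction on the number of letters. The letter \<open>\<xi>\<close> split off is the
  largest for \<open>gens_order\<close>, whatever \<open>r\<close> is: the others lie in
  \<open>mid \<xi>\<close>, so modulo lower powers each term becomes an element of
  \<open>mid \<xi>\<close> times a power of \<open>\<xi>\<close>, and
  \<open>gens_power_independent\<close> applies.\<close>

lemma pbw_independent:
  assumes r: "antisym r"
  shows "finite L \<Longrightarrow> L \<subseteq> gens \<Longrightarrow> finite F \<Longrightarrow> F \<subseteq> pbw_exprs L r \<Longrightarrow> c ` F \<subseteq> B \<Longrightarrow>
    (\<Sum>es\<in>F. side_mult s (c es) (monomial es)) = 0 \<Longrightarrow> \<forall>es\<in>F. c es = 0"
proof (induction "card L" arbitrary: L F c)
  case 0
  then have "L = {}" by simp
  have "F \<subseteq> {[]}"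
  proof
    fix es assume "es \<in> F"
    then have "es \<in> pbw_exprs {} r" using 0 \<open>L = {}\<close> by blast
    then show "es \<in> {[]}" by (cases es) (auto simp: pbw_exprs_iff)
  qed
  then consider "F = {}" | "F = {[]}" by blast
  then show ?case using 0 by cases (auto simp: side_mult_def split: if_splits)
next
  case (Suc card_L)
  obtain \<xi> where \<xi>: "\<xi> \<in> L" "\<And>\<eta>. \<eta> \<in> L \<Longrightarrow> \<eta> \<noteq> \<xi> \<Longrightarrow> upper \<eta> \<subseteq> mid \<xi>"
  proof -
    have "\<exists>\<xi>\<in>M. \<forall>\<eta>\<in>M. (\<eta>, \<xi>) \<in> gens_order" if "finite M" "M \<noteq> {}" "M \<subseteq> gens" for M
      using that
    proof (induction M rule: finite_ne_induct)
      case (insert x M)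
      then obtain \<xi> where \<xi>: "\<xi> \<in> M" "\<forall>\<eta>\<in>M. (\<eta>, \<xi>) \<in> gens_order" by blast
      have "x \<in> gens" "\<xi> \<in> gens" "x \<noteq> \<xi>" using insert \<xi> by blast+
      then have "(x, \<xi>) \<in> gens_order \<or> (\<xi>, x) \<in> gens_order \<and> (x, x) \<in> gens_order"
        using gens_compare[of x \<xi>] gens_order_le[of x \<xi>] gens_order_le[of \<xi> x] gens_order_le[of x x]
        by blast
      then show ?case
      proof
        assume "(x, \<xi>) \<in> gens_order"
        then show ?thesis using \<xi> by (intro bexI[of _ \<xi>]) auto
      next
        assume "(\<xi>, x) \<in> gens_order \<and> (x, x) \<in> gens_order"
        then show ?thesis
          using \<xi>(2) transD[OF linear_order_onD(1)[OF linear_order_gens], of _ \<xi> x]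
          by (intro bexI[of _ x]) auto
      qed
    qed (auto simp: gens_order_def)
    moreover have "L \<noteq> {}" using Suc.hyps(2) by auto
    ultimately obtain \<xi> where "\<xi> \<in> L" "\<forall>\<eta>\<in>L. (\<eta>, \<xi>) \<in> gens_order"
      using Suc.prems(1,2) by meson
    then show thesis using that gens_order_le by blast
  qed
  have \<xi>g: "\<xi> \<in> gens" using \<xi>(1) Suc.prems(2) by blast
  let ?E = "mid \<xi>"
  note E = subalgebra_mid[of \<xi>]
  have BE: "B \<subseteq> ?E" using B_lower lower_mid by blast
  have rest: "monomial (remove_letter \<xi> es) \<in> ?E" if "es \<in> pbw_exprs L r" for es
    using monomial_mem[OF E remove_letter_pbw_exprs[OF that, of \<xi>]] \<xi>(2) self_upper by blast
  have lead: "side_mult s b (monomial es)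
      - side_mult s b (monomial (remove_letter \<xi> es)) * \<xi> ^ exponent \<xi> es
      \<in> filtration ?E \<xi> (exponent \<xi> es)" if es: "es \<in> pbw_exprs L r" and b: "b \<in> B" for es b
    using pbw_exprs_split[OF es, of \<xi>]
  proof
    assume "\<exists>es1 es2. es = es1 @ (\<xi>, exponent \<xi> es) # es2 \<and> remove_letter \<xi> es = es1 @ es2"
    then obtain es1 es2 where s: "es = es1 @ (\<xi>, exponent \<xi> es) # es2" "remove_letter \<xi> es = es1 @ es2"
      by blast
    have "es1 \<in> pbw_exprs (L - {\<xi>}) r" "es2 \<in> pbw_exprs (L - {\<xi>}) r"
      using remove_letter_pbw_exprs[OF es, of \<xi>] unfolding s(2)
      by (auto simp: pbw_exprs_iff sorted_wrt_append)
    then have m: "monomial es1 \<in> ?E" "monomial es2 \<in> ?E"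
      using monomial_mem[OF E] \<xi>(2) self_upper by blast+
    have "monomial es = monomial es1 * (\<xi> ^ exponent \<xi> es * monomial es2)" by (subst s(1)) simp
    then show ?thesis
      using side_mult_move[OF E mid_ad m, of b s "exponent \<xi> es"] b BE by (auto simp: s(2))
  next
    assume "exponent \<xi> es = 0 \<and> remove_letter \<xi> es = es"
    then show ?thesis by simp
  qed
  \<comment> \<open>Inner induction on a strict bound \<open>m\<close> for the exponents of
    \<open>\<xi>\<close>: the terms in \<open>?G\<close> with the top exponent are eliminated first,
    then those in \<open>?H\<close>.\<close>
  have "\<forall>es\<in>G. c es = 0"
    if "finite G" "G \<subseteq> pbw_exprs L r" "c ` G \<subseteq> B" "\<forall>es\<in>G. exponent \<xi> es < m"
      "(\<Sum>es\<in>G. side_mult s (c es) (monomial es)) = 0" for G m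
    using that
  proof (induction m arbitrary: G)
    case (Suc m)
    let ?G = "{es\<in>G. exponent \<xi> es = m}" and ?H = "{es\<in>G. exponent \<xi> es < m}"
    have G: "G = ?G \<union> ?H" "?G \<inter> ?H = {}" "finite ?G" "finite ?H" using Suc.prems by auto
    let ?t = "\<lambda>es. side_mult s (c es) (monomial es)"
    let ?q = "\<lambda>es. side_mult s (c es) (monomial (remove_letter \<xi> es))"
    have sum0: "sum ?t ?G + sum ?t ?H = 0"
      using sum.union_disjoint[OF G(3,4,2), of ?t] G(1) Suc.prems(5) by simp
    have q: "?q es \<in> ?E" if "es \<in> G" for es
      using that Suc.prems(2,3) BE by (intro side_mult_mem[OF E] rest) blast+
    have "?t es \<in> filtration ?E \<xi> m" if es: "es \<in> ?H" for es
    proof -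
      have "(?t es - ?q es * \<xi> ^ exponent \<xi> es) + ?q es * \<xi> ^ exponent \<xi> es
          \<in> filtration ?E \<xi> (Suc (exponent \<xi> es))"
        using es Suc.prems(2,3)
        by (intro filtration_add[OF E] filtration_top[OF E] q filtration_mono[OF E _ lead]) auto
      then have "?t es \<in> filtration ?E \<xi> (Suc (exponent \<xi> es))" by (simp only: diff_add_cancel)
      then show ?thesis by (rule filtration_mono[OF E, rotated]) (use es in simp)
    qed
    then have H: "sum ?t ?H \<in> filtration ?E \<xi> m" by (intro subspace_sum[OF filtration_subspace[OF E]])
    have "sum (\<lambda>es. ?t es - ?q es * \<xi> ^ m) ?G \<in> filtration ?E \<xi> m"
    proof (rule subspace_sum[OF filtration_subspace[OF E]])
      fix es assume "es \<in> ?G"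
      then show "?t es - ?q es * \<xi> ^ m \<in> filtration ?E \<xi> m"
        using lead[of es "c es"] Suc.prems(2,3) by auto
    qed
    then have "sum ?t ?G - sum ?q ?G * \<xi> ^ m \<in> filtration ?E \<xi> m"
      by (simp add: sum_subtractf sum_distrib_right)
    from filtration_add[OF E this H] have "- (sum ?q ?G * \<xi> ^ m) \<in> filtration ?E \<xi> m"
      using sum0 by (simp add: algebra_simps)
    then have "sum ?q ?G * \<xi> ^ m \<in> filtration ?E \<xi> m"
      using subspace_neg[OF filtration_subspace[OF E]] by fastforce
    moreover have "sum ?q ?G \<in> ?E" by (intro subspace_sum[OF subalgebra_subspace[OF E]] q) simp
    ultimately have q0: "sum ?q ?G = 0" using gens_power_independent[OF \<xi>g] by blast
    have inj: "inj_on (remove_letter \<xi>) ?G"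
      by (rule inj_onI, rule pbw_exprs_eqI[OF r, of _ L _ \<xi>]) (use Suc.prems(2) in auto)
    \<comment> \<open>The top coefficient \<open>sum ?q ?G\<close> is a relation between monomials
      without \<open>\<xi>\<close>. Since all expressions in \<open>?G\<close> have the same
      exponent of \<open>\<xi>\<close>, they are recovered from what remains, and their coefficients
      can be transported.\<close>
    let ?c = "\<lambda>es. c (the_inv_into ?G (remove_letter \<xi>) es)"
    have c: "?c (remove_letter \<xi> es) = c es" if "es \<in> ?G" for es
      using the_inv_into_f_f[OF inj that] by simp
    have "\<forall>es\<in>remove_letter \<xi> ` ?G. ?c es = 0"
    proof (rule Suc.hyps(1)[of "L - {\<xi>}"])
      show "card_L = card (L - {\<xi>})" using Suc.hyps(2) \<xi>(1) \<open>finite L\<close> by simp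
      show "finite (L - {\<xi>})" "L - {\<xi>} \<subseteq> gens" using \<open>finite L\<close> \<open>L \<subseteq> gens\<close> by auto
      show "finite (remove_letter \<xi> ` ?G)" using G(3) by simp
      show "remove_letter \<xi> ` ?G \<subseteq> pbw_exprs (L - {\<xi>}) r"
      proof
        fix fs assume "fs \<in> remove_letter \<xi> ` ?G"
        then obtain es where "es \<in> G" "fs = remove_letter \<xi> es" by blast
        then show "fs \<in> pbw_exprs (L - {\<xi>}) r" using remove_letter_pbw_exprs[of es L] Suc.prems(2) by blast
      qed
      show "?c ` remove_letter \<xi> ` ?G \<subseteq> B"
      proof
        fix b assume "b \<in> ?c ` remove_letter \<xi> ` ?G"
        then obtain es where es: "es \<in> ?G" and b: "b = ?c (remove_letter \<xi> es)" by blast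
        show "b \<in> B" unfolding b c[OF es] using es Suc.prems(3) by blast
      qed
      have "(\<Sum>es\<in>remove_letter \<xi> ` ?G. side_mult s (?c es) (monomial es))
          = (\<Sum>es\<in>?G. side_mult s (?c (remove_letter \<xi> es)) (monomial (remove_letter \<xi> es)))"
        by (simp add: sum.reindex[OF inj])
      also have "\<dots> = sum ?q ?G" by (rule sum.cong[OF refl]) (simp only: c)
      finally show "(\<Sum>es\<in>remove_letter \<xi> ` ?G. side_mult s (?c es) (monomial es)) = 0" using q0 by simp
    qed
    then have cG: "\<forall>es\<in>?G. c es = 0" using c by (metis (no_types, lifting) imageI)
    then have "sum ?t ?G = 0" by (intro sum.neutral) auto
    then have "sum ?t ?H = 0" using sum0 by simp
    then have "\<forall>es\<in>?H. c es = 0" using Suc.prems(2,3) by (intro Suc.IH) (use G(4) in auto)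
    then show ?case using cG G(1) by blast
  qed simp
  from this[of F "Suc (Max (exponent \<xi> ` F))"] show ?case
    using Suc.prems by (simp add: le_imp_less_Suc)
qed

lemma pbw_side_basis:
  assumes r: "linear_order_on Z r" and Y: "Y \<subseteq> Z" "Y \<subseteq> gens"
    and down: "\<And>j k. j \<in> gens \<Longrightarrow> k \<in> Y \<Longrightarrow> upper j \<subseteq> upper k \<Longrightarrow> j \<in> Y"
    and K: "subalgebra scale K" "K = B \<union> \<Union>(upper ` Y)"
  shows "side_basis s B K (pbw_exprs Y r) monomial"
  unfolding side_basis_def
proof (intro conjI ballI allI impI)
  have "Y \<subseteq> K" using K(2) self_upper by blast
  then show "monomial ` pbw_exprs Y r \<subseteq> K" using monomial_mem[OF K(1)] by blast
  show "\<exists>F c. finite F \<and> F \<subseteq> pbw_exprs Y r \<and> c ` F \<subseteq> B \<and>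
      a = (\<Sum>i\<in>F. side_mult s (c i) (monomial i))" if "a \<in> K" for a
    by (rule pbw_span_combination, rule pbw_span_upper[OF r Y]) (use that K(2) down in blast)+
  fix F c es
  assume F: "finite F" "F \<subseteq> pbw_exprs Y r" "c ` F \<subseteq> B" "es \<in> F"
    "(\<Sum>i\<in>F. side_mult s (c i) (monomial i)) = 0"
  \<comment> \<open>Only finitely many letters occur in a given relation, as the induction on the
    number of letters requires.\<close>
  let ?L = "\<Union>es\<in>F. fst ` set es"
  have "?L \<subseteq> gens"
  proof
    fix \<eta> assume "\<eta> \<in> ?L"
    then obtain es p where "es \<in> pbw_exprs Y r" "p \<in> set es" "\<eta> = fst p" using F(2) by blast
    then show "\<eta> \<in> gens" using Y(2) by (auto simp: pbw_exprs_iff)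
  qed
  moreover have "F \<subseteq> pbw_exprs ?L r" using F(2) by (force simp: pbw_exprs_iff)
  ultimately have "\<forall>es\<in>F. c es = 0"
    using pbw_independent[OF linear_order_onD(2)[OF r], of ?L F c s] F by simp
  then show "c es = 0" using F(4) by blast
qed

end

section \<open>From Hopf algebras to bialgebras with tensor lists\<close>

lemma free_expansion: "t = (\<Sum>p\<in>Poly_Mapping.keys t. free_scale (Poly_Mapping.lookup t p) (basis_vec p))"
proof (rule poly_mapping_eqI)
  fix q
  have "(\<Sum>p\<in>Poly_Mapping.keys t. Poly_Mapping.lookup t p * (1 when p = q)) = Poly_Mapping.lookup t q"
    by (simp add: when_def in_keys_iff sum.delta' if_distrib cong: if_cong)
  then show "Poly_Mapping.lookup t q =
      Poly_Mapping.lookup (\<Sum>p\<in>Poly_Mapping.keys t. free_scale (Poly_Mapping.lookup t p) (basis_vec p)) q"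
    by (simp add: lookup_sum lookup_free_scale basis_vec_def lookup_single)
qed

context vector_space
begin

lemma lin_ext_superset:
  assumes "finite G" "Poly_Mapping.keys t \<subseteq> G"
  shows "lin_ext scale f t = (\<Sum>p\<in>G. scale (Poly_Mapping.lookup t p) (f p))"
  unfolding lin_ext_def using assms by (intro sum.mono_neutral_left) (auto simp: in_keys_iff)

lemma lin_ext_add: "lin_ext scale f (t + u) = lin_ext scale f t + lin_ext scale f u"
proof -
  let ?G = "Poly_Mapping.keys t \<union> Poly_Mapping.keys u"
  show ?thesis
    using lin_ext_superset[of ?G "t + u" f] lin_ext_superset[of ?G t f] lin_ext_superset[of ?G u f]
      keys_add[of t u]
    by (simp add: lookup_add scale_left_distrib sum.distrib)
qed

lemma lin_ext_scale: "lin_ext scale f (free_scale c t) = scale c (lin_ext scale f t)"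
proof -
  have "Poly_Mapping.keys (free_scale c t) \<subseteq> Poly_Mapping.keys t"
    by (auto simp: in_keys_iff lookup_free_scale)
  then show ?thesis
    using lin_ext_superset[of "Poly_Mapping.keys t" "free_scale c t" f]
    by (simp add: lookup_free_scale lin_ext_def scale_sum_right)
qed

lemma lin_ext_zero: "lin_ext scale f 0 = 0"
  by (simp add: lin_ext_def)

lemma lin_ext_diff: "lin_ext scale f (t - u) = lin_ext scale f t - lin_ext scale f u"
  using lin_ext_add[of f "t - u" u] by simp

lemma lin_ext_basis_vec: "lin_ext scale f (basis_vec p) = f p"
  by (simp add: lin_ext_def basis_vec_def)

lemma lin_ext_sum: "lin_ext scale f (sum t I) = (\<Sum>i\<in>I. lin_ext scale f (t i))"
  by (induction I rule: infinite_finite_induct) (simp_all add: lin_ext_add lin_ext_zero)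

lemma lin_ext_lin_ext:
  "lin_ext scale f (lin_ext free_scale F t) = lin_ext scale (\<lambda>p. lin_ext scale f (F p)) t"
proof -
  have "lin_ext scale f (lin_ext free_scale F t)
      = (\<Sum>p\<in>Poly_Mapping.keys t. lin_ext scale f (free_scale (Poly_Mapping.lookup t p) (F p)))"
    unfolding lin_ext_def[of free_scale] by (rule lin_ext_sum)
  then show ?thesis by (simp add: lin_ext_scale lin_ext_def[of scale "\<lambda>p. lin_ext scale f (F p)"])
qed

end

context algebra_over_field
begin

lemma lin_ext_null:
  assumes \<beta>: "bilinear_map scale \<beta>" and t: "t \<in> tensor2_null scale"
  shows "lin_ext scale (\<lambda>(a, b). \<beta> a b) t = 0"
proof -
  interpret fs: vector_space "free_scale :: 'k \<Rightarrow> ('h \<times> 'h \<Rightarrow>\<^sub>0 'k) \<Rightarrow> _" by (rule vector_space_free_scale)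
  show ?thesis
    using t unfolding tensor2_null_def
  proof (rule fs.span_induct)
    show "fs.subspace {t. lin_ext scale (\<lambda>(a, b). \<beta> a b) t = 0}"
      by (rule fs.subspaceI) (simp_all add: lin_ext_zero lin_ext_add lin_ext_scale)
    show "lin_ext scale (\<lambda>(a, b). \<beta> a b) x = 0"
      if "x \<in> (\<Union>b. slot_rels scale (\<lambda>x. (x, b)) \<union> slot_rels scale (\<lambda>x. (b, x)))" for x
      using that
      by (auto simp: slot_rels_def lin_ext_diff lin_ext_scale lin_ext_basis_vec bilinear_mapD[OF \<beta>])
  qed
qed

lemma tensor2_eq_lin_ext:
  "bilinear_map scale \<beta> \<Longrightarrow> tensor2_eq scale t u \<Longrightarrow>
    lin_ext scale (\<lambda>(a, b). \<beta> a b) t = lin_ext scale (\<lambda>(a, b). \<beta> a b) u"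
  using lin_ext_null[of \<beta> "t - u"] by (simp add: tensor2_eq_def lin_ext_diff)

text \<open>A form on the free space vanishing on the relations is a bilinear form on \<open>H\<close>.\<close>

lemma tensor2_eqI:
  assumes eq: "\<And>\<beta>. bilinear_map scale \<beta> \<Longrightarrow>
    lin_ext scale (\<lambda>(a, b). \<beta> a b) t = lin_ext scale (\<lambda>(a, b). \<beta> a b) u"
  shows "tensor2_eq scale t u"
  unfolding tensor2_eq_def
proof (rule ccontr)
  interpret fs: vector_space "free_scale :: 'k \<Rightarrow> ('h \<times> 'h \<Rightarrow>\<^sub>0 'k) \<Rightarrow> _" by (rule vector_space_free_scale)
  assume "t - u \<notin> tensor2_null scale"
  moreover have "fs.subspace (tensor2_null scale)" unfolding tensor2_null_def by (rule fs.subspace_span)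
  ultimately obtain \<phi> where \<phi>: "linear_form free_scale \<phi>" "\<And>v. v \<in> tensor2_null scale \<Longrightarrow> \<phi> v = 0"
    "\<phi> (t - u) \<noteq> 0" using fs.separating_form by metis
  let ?rels = "\<Union>b. slot_rels scale (\<lambda>x. (x, b)) \<union> slot_rels scale (\<lambda>x. (b, x))"
  have rel: "\<phi> v = 0" if "v \<in> ?rels" for v
    using \<phi>(2) fs.span_base[OF that] unfolding tensor2_null_def by blast
  have add: "\<phi> (basis_vec (\<iota> (x + y))) = \<phi> (basis_vec (\<iota> x)) + \<phi> (basis_vec (\<iota> y))"
    and scl: "\<phi> (basis_vec (\<iota> (scale c x))) = c * \<phi> (basis_vec (\<iota> x))"
    if "slot_rels scale \<iota> \<subseteq> ?rels" for \<iota> x y c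
  proof -
    have "\<phi> (basis_vec (\<iota> (x + y)) - basis_vec (\<iota> x) - basis_vec (\<iota> y)) = 0"
      by (rule rel, rule subsetD[OF that]) (auto simp: slot_rels_def)
    then show "\<phi> (basis_vec (\<iota> (x + y))) = \<phi> (basis_vec (\<iota> x)) + \<phi> (basis_vec (\<iota> y))"
      by (simp add: linear_form_diff[OF \<phi>(1)] diff_eq_eq add.commute)
    have "\<phi> (basis_vec (\<iota> (scale c x)) - free_scale c (basis_vec (\<iota> x))) = 0"
      by (rule rel, rule subsetD[OF that]) (auto simp: slot_rels_def)
    then show "\<phi> (basis_vec (\<iota> (scale c x))) = c * \<phi> (basis_vec (\<iota> x))"
      by (simp add: linear_form_diff[OF \<phi>(1)] linear_formD[OF \<phi>(1)])
  qed
  have slots: "slot_rels scale (\<lambda>x. (x, b)) \<subseteq> ?rels" "slot_rels scale (\<lambda>x. (b, x)) \<subseteq> ?rels" for b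
    by blast+
  \<comment> \<open>The bilinear form induced by \<open>\<phi>\<close> is embedded in
    \<open>H\<close> as a multiple of 1; since \<open>1 \<noteq> 0\<close> its values can be
    recovered.\<close>
  define \<beta> where "\<beta> a b = scale (\<phi> (basis_vec (a, b))) (1 :: 'h)" for a b
  have \<beta>: "bilinear_map scale \<beta>"
    by (rule bilinear_mapI)
      (simp_all add: \<beta>_def add[OF slots(1)] add[OF slots(2)] scl[OF slots(1)] scl[OF slots(2)]
        scale_left_distrib)
  have sum: "\<phi> (sum g I) = (\<Sum>i\<in>I. \<phi> (g i))" for g and I :: "('h \<times> 'h) set"
    by (induction I rule: infinite_finite_induct)
      (simp_all add: linear_form_0[OF \<phi>(1)] linear_formD[OF \<phi>(1)])
  have "lin_ext scale (\<lambda>(a, b). \<beta> a b) v = scale (\<phi> v) 1" for v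
  proof -
    have "lin_ext scale (\<lambda>(a, b). \<beta> a b) v
        = (\<Sum>p\<in>Poly_Mapping.keys v. scale (Poly_Mapping.lookup v p * \<phi> (basis_vec p)) 1)"
      by (simp add: lin_ext_def \<beta>_def case_prod_unfold)
    also have "\<dots> = scale (\<Sum>p\<in>Poly_Mapping.keys v.
        \<phi> (free_scale (Poly_Mapping.lookup v p) (basis_vec p))) 1"
      by (simp add: scale_sum_left linear_formD[OF \<phi>(1)])
    also have "\<dots> = scale (\<phi> v) 1" by (subst (2) free_expansion[of v]) (simp only: sum)
    finally show ?thesis .
  qed
  then have "scale (\<phi> t - \<phi> u) 1 = (0 :: 'h)" using eq[OF \<beta>] by (simp add: scale_left_diff_distrib)
  then show False using \<phi>(3) by (simp add: linear_form_diff[OF \<phi>(1)])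
qed

text \<open>Coefficients are absorbed into the first factors. The enumeration of the support is an
  arbitrary choice that no bilinear map can see.\<close>

definition tensor_list :: "('h \<times> 'h \<Rightarrow>\<^sub>0 'k) \<Rightarrow> ('h \<times> 'h) list"
  where "tensor_list t = map (\<lambda>p. (scale (Poly_Mapping.lookup t p) (fst p), snd p))
    (SOME ps. distinct ps \<and> set ps = Poly_Mapping.keys t)"

lemma some_keys_list:
  "distinct (SOME ps. distinct ps \<and> set ps = Poly_Mapping.keys t) \<and>
    set (SOME ps. distinct ps \<and> set ps = Poly_Mapping.keys t) = Poly_Mapping.keys t"
  by (rule someI_ex) (metis finite_distinct_list finite_keys)

lemma tensor_eval_tensor_list:
  assumes \<beta>: "bilinear_map scale \<beta>"
  shows "tensor_eval \<beta> (tensor_list t) = lin_ext scale (\<lambda>(a, b). \<beta> a b) t"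
proof -
  have "tensor_eval \<beta> (tensor_list t)
      = (\<Sum>p\<in>Poly_Mapping.keys t. \<beta> (scale (Poly_Mapping.lookup t p) (fst p)) (snd p))"
    unfolding tensor_eval_def tensor_list_def
    using some_keys_list[of t] by (simp add: comp_def sum_list_distinct_conv_sum_set)
  then show ?thesis by (simp add: lin_ext_def bilinear_mapD[OF \<beta>] case_prod_unfold)
qed

text \<open>The scalar \<open>c\<close> stays visible because \<open>P\<close> need not be closed
  under scaling.\<close>

lemma tensor_span_list:
  assumes "t \<in> tensor_span scale P"
  obtains us where "tensor_equiv scale (tensor_list t) us"
    "\<And>a b. (a, b) \<in> set us \<Longrightarrow> \<exists>c a'. a = scale c a' \<and> (a', b) \<in> P"
proof -
  obtain u where u: "tensor2_eq scale t u" "Poly_Mapping.keys u \<subseteq> P"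
    using assms unfolding tensor_span_def by blast
  have "tensor_equiv scale (tensor_list t) (tensor_list u)"
    using tensor2_eq_lin_ext[OF _ u(1)] by (simp add: tensor_equiv_def tensor_eval_tensor_list)
  moreover have "\<exists>c a'. a = scale c a' \<and> (a', b) \<in> P" if ab: "(a, b) \<in> set (tensor_list u)" for a b
  proof -
    obtain p where p: "p \<in> Poly_Mapping.keys u" "a = scale (Poly_Mapping.lookup u p) (fst p)" "b = snd p"
      using ab some_keys_list[of u] unfolding tensor_list_def by force
    then have "(fst p, b) \<in> P" using u(2) by auto
    then show ?thesis using p(2) by blast
  qed
  ultimately show thesis using that by blast
qed

lemma tensor_spanI:
  assumes us: "tensor_equiv scale (tensor_list t) us" and P: "set us \<subseteq> P"
  shows "t \<in> tensor_span scale P"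
proof -
  let ?u = "\<Sum>p\<leftarrow>us. basis_vec p :: 'h \<times> 'h \<Rightarrow>\<^sub>0 'k"
  have list: "lin_ext scale (\<lambda>(a, b). \<beta> a b) (\<Sum>p\<leftarrow>vs. basis_vec p) = tensor_eval \<beta> vs" for \<beta> vs
    by (induction vs) (auto simp: lin_ext_zero lin_ext_add lin_ext_basis_vec)
  have "tensor2_eq scale t ?u"
  proof (rule tensor2_eqI)
    fix \<beta> assume \<beta>: "bilinear_map scale \<beta>"
    show "lin_ext scale (\<lambda>(a, b). \<beta> a b) t = lin_ext scale (\<lambda>(a, b). \<beta> a b) ?u"
      unfolding list using tensor_equivD[OF us \<beta>] tensor_eval_tensor_list[OF \<beta>, of t] by simp
  qed
  moreover have "Poly_Mapping.keys (\<Sum>p\<leftarrow>vs. basis_vec p :: 'h \<times> 'h \<Rightarrow>\<^sub>0 'k) \<subseteq> set vs" for vs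
  proof (induction vs)
    case (Cons p vs)
    have "Poly_Mapping.keys (basis_vec p :: 'h \<times> 'h \<Rightarrow>\<^sub>0 'k) \<subseteq> {p}" by (simp add: basis_vec_def)
    then show ?case
      using Cons keys_add[of "basis_vec p :: 'h \<times> 'h \<Rightarrow>\<^sub>0 'k" "\<Sum>p\<leftarrow>vs. basis_vec p"] by fastforce
  qed simp
  ultimately show ?thesis using P unfolding tensor_span_def by blast
qed

end

context graded_bialgebra
begin

lemma graded_bialgebra_swap: "graded_bialgebra scale le lt V (\<lambda>x. map prod.swap (cop x)) \<epsilon>"
proof unfold_locales
  fix x \<gamma> assume x: "x \<in> V \<gamma>"
  obtain us where us: "tensor_equiv scale (cop x) us"
    "\<And>a b. (a, b) \<in> set us \<Longrightarrow> \<exists>\<alpha> \<beta>. a \<in> V \<alpha> \<and> b \<in> V \<beta> \<and> \<alpha> + \<beta> = \<gamma>"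
    using cop_graded[OF x] by blast
  have "tensor_equiv scale (map prod.swap (cop x)) (map prod.swap us)"
    using us(1) by (simp add: tensor_equiv_def tensor_eval_swap bilinear_map_flip)
  moreover have "\<exists>\<alpha> \<beta>. a \<in> V \<alpha> \<and> b \<in> V \<beta> \<and> \<alpha> + \<beta> = \<gamma>" if "(a, b) \<in> set (map prod.swap us)" for a b
  proof -
    have "(b, a) \<in> set us" using that by auto
    from us(2)[OF this] show ?thesis by (metis add.commute)
  qed
  ultimately show "\<exists>us. tensor_equiv scale (map prod.swap (cop x)) us \<and>
      (\<forall>(a, b)\<in>set us. \<exists>\<alpha> \<beta>. a \<in> V \<alpha> \<and> b \<in> V \<beta> \<and> \<alpha> + \<beta> = \<gamma>)" by blast
next
  fix \<beta> x y assume \<beta>: "bilinear_map scale \<beta>"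
  note [simp] = cop_add[OF bilinear_map_flip[OF \<beta>]] cop_scale[OF bilinear_map_flip[OF \<beta>]]
    cop_one[OF bilinear_map_flip[OF \<beta>]] tensor_eval_swap
  show "tensor_eval \<beta> (map prod.swap (cop (x + y)))
      = tensor_eval \<beta> (map prod.swap (cop x)) + tensor_eval \<beta> (map prod.swap (cop y))"
    "tensor_eval \<beta> (map prod.swap (cop (scale c x))) = scale c (tensor_eval \<beta> (map prod.swap (cop x)))"
    "tensor_eval \<beta> (map prod.swap (cop 1)) = \<beta> 1 1" for c
    by simp_all
  show "tensor_eval \<beta> (map prod.swap (cop (x * y))) = tensor_eval (\<lambda>a b. tensor_eval (\<lambda>c d. \<beta> (a * c) (b * d))
      (map prod.swap (cop y))) (map prod.swap (cop x))"
    using cop_mult[OF bilinear_map_flip[OF \<beta>]] by simp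
qed (simp_all add: counit_form counit_one counit_graded tensor_eval_swap counit_left counit_right)

text \<open>Reduce twice. The first reduction moves the second factors into \<open>K\<close>; the
  reduction of the swapped list does the same for the others, while \<open>tensor_reduce\<close>
  keeps the factors already treated in their span, hence in \<open>K\<close>.\<close>

lemma ex_rep_two_sided:
  assumes K: "subspace K" and left: "stable K"
    and right: "graded_bialgebra.stable scale (\<lambda>x. map prod.swap (cop x)) K" and x: "x \<in> K"
  obtains us where "tensor_equiv scale (cop x) us" "set us \<subseteq> K \<times> K"
proof -
  interpret sw: graded_bialgebra scale le lt V "\<lambda>x. map prod.swap (cop x)" \<epsilon>
    by (rule graded_bialgebra_swap)
  obtain us where us: "tensor_equiv scale (cop x) us" "\<And>a b. (a, b) \<in> set us \<Longrightarrow> b \<in> K"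
    using ex_rep_stable[OF K] stableD[OF left x] by blast
  have "tensor_eval (\<lambda>a b. scale (f a) b) (map prod.swap us) \<in> K" if f: "linear_form scale f" for f
    using sw.stableD[OF right x f] tensor_equivD[OF us(1) bilinear_map_flip[OF form_pairing_bilinear[OF f]]]
    by (simp add: sw.slice_def tensor_eval_swap)
  from tensor_reduce[OF K this] obtain vs where
    vs: "\<And>\<beta>. bilinear_map scale \<beta> \<Longrightarrow> tensor_eval \<beta> (map prod.swap us) = tensor_eval \<beta> vs"
      "\<And>a b. (a, b) \<in> set vs \<Longrightarrow> a \<in> span (fst ` set (map prod.swap us)) \<and> b \<in> K" by metis
  have "fst ` set (map prod.swap us) \<subseteq> K" using us(2) by force
  then have "span (fst ` set (map prod.swap us)) \<subseteq> K" using K by (rule span_minimal)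
  then have "set (map prod.swap vs) \<subseteq> K \<times> K" using vs(2) by force
  moreover have "tensor_equiv scale (cop x) (map prod.swap vs)"
    unfolding tensor_equiv_def
  proof (intro allI impI)
    fix \<beta> assume \<beta>: "bilinear_map scale \<beta>"
    show "tensor_eval \<beta> (cop x) = tensor_eval \<beta> (map prod.swap vs)"
      using tensor_equivD[OF us(1) \<beta>] vs(1)[OF bilinear_map_flip[OF \<beta>]] by (simp add: tensor_eval_swap)
  qed
  ultimately show thesis using that by blast
qed

section \<open>The antipode on stable homogeneous subalgebras\<close>

lemma counit_component: "\<epsilon> (component 0 x) = \<epsilon> x"
proof -
  have sum: "\<epsilon> (sum g I) = (\<Sum>i\<in>I. \<epsilon> (g i))" for g and I :: "'g set"
    by (induction I rule: infinite_finite_induct)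
      (simp_all add: linear_form_0[OF counit_form] linear_formD[OF counit_form])
  let ?G = "insert 0 {\<gamma>. component \<gamma> x \<noteq> 0}"
  have fin: "finite ?G" using finite_support by simp
  have "\<epsilon> x = (\<Sum>\<gamma>\<in>?G. \<epsilon> (component \<gamma> x))"
    by (subst sum_component_superset[OF fin, of x, symmetric]) (auto simp: sum)
  also have "\<dots> = (\<Sum>\<gamma>\<in>?G. if \<gamma> = 0 then \<epsilon> (component 0 x) else 0)"
    by (rule sum.cong[OF refl]) (use counit_graded[OF component_in] in auto)
  also have "\<dots> = \<epsilon> (component 0 x)" using fin by (simp add: sum.delta)
  finally show ?thesis by simp
qed

lemma component_0_counit: "component 0 x = scale (\<epsilon> x) 1"
proof -
  obtain c where c: "component 0 x = scale c 1" using V_0_scalar component_in by blast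
  then have "\<epsilon> x = c" using counit_component[of x] by (simp add: linear_formD(2)[OF counit_form] counit_one)
  then show ?thesis using c by simp
qed

text \<open>In degree \<open>\<gamma> \<noteq> 0\<close> the antipode axiom reads \<open>S x = - \<Sum> S x\<^sub>1 x\<^sub>2\<close> over the parts with
  \<open>deg x\<^sub>1 < \<gamma>\<close>.\<close>

lemma antipode_closed:
  assumes S: "\<And>x y. S (x + y) = S x + S y" "\<And>c x. S (scale c x) = scale c (S x)"
    and anti: "\<And>x. tensor_eval (\<lambda>a b. S a * b) (cop x) = scale (\<epsilon> x) 1"
    and K: "homogeneous_subalgebra K" "stable K"
      "graded_bialgebra.stable scale (\<lambda>x. map prod.swap (cop x)) K"
    and x: "x \<in> K"
  shows "S x \<in> K"
proof -
  have sK: "subalgebra scale K" and hK: "\<And>x \<gamma>. x \<in> K \<Longrightarrow> component \<gamma> x \<in> K"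
    using K(1) unfolding homogeneous_subalgebra_def by blast+
  note K_sub = subalgebra_subspace[OF sK]
  have S0: "S 0 = 0" using S(2)[of 0 0] by simp
  have S_sum: "S (sum g I) = (\<Sum>i\<in>I. S (g i))" for g and I :: "'g set"
    by (induction I rule: infinite_finite_induct) (simp_all add: S S0)
  have SB: "bilinear_map scale (\<lambda>a b. S (component \<alpha> a) * component \<beta> b)" for \<alpha> \<beta>
    by (rule bilinear_mapI)
      (simp_all add: component_add component_scale S distrib_left distrib_right
        flip: scale_mult_left scale_mult_right)
  have "S x \<in> K" if "x \<in> K" "x \<in> V \<gamma>" for x \<gamma>
    using that
  proof (induction \<gamma> arbitrary: x rule: ord.less_induct)
    case (less \<gamma>)
    show ?case
    proof (cases "\<gamma> = 0")
      case True
      have "bilinear_map scale (\<lambda>a b. S a * b)"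
        by (rule bilinear_mapI)
          (simp_all add: S distrib_left distrib_right flip: scale_mult_left scale_mult_right)
      then have "S 1 = 1" using anti[of 1] cop_one by (simp add: counit_one)
      moreover obtain c where "x = scale c 1" using V_0_scalar less.prems(2) True by blast
      ultimately show ?thesis using subalgebra_scale[OF sK subalgebra_one[OF sK]] by (simp add: S)
    next
      case False
      obtain us where us: "tensor_equiv scale (cop x) us" "set us \<subseteq> K \<times> K"
        using ex_rep_two_sided[OF K_sub K(2,3) less.prems(1)] by blast
      obtain vs where vs: "tensor_equiv scale (cop x) vs"
        "\<And>a b. (a, b) \<in> set vs \<Longrightarrow> \<exists>\<alpha> \<beta>. a \<in> V \<alpha> \<and> b \<in> V \<beta> \<and> \<alpha> + \<beta> = \<gamma>"
        using cop_graded[OF less.prems(2)] by blast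
      \<comment> \<open>The factors of \<open>us\<close> lie in \<open>K\<close> but need not be
        homogeneous, those of \<open>vs\<close> conversely. Summing the projections onto the
        finitely many bidegrees of total degree \<open>\<gamma>\<close> is a bilinear map, so the
        antipode axiom is carried from \<open>vs\<close> to \<open>us\<close>.\<close>
      define G where "G = {p. fst p + snd p = \<gamma>}"
      have "G \<subseteq> {\<alpha>. divisor \<alpha> \<gamma>} \<times> {\<alpha>. divisor \<alpha> \<gamma>}"
        unfolding G_def divisor_def by (auto, metis add.commute)
      then have fin: "finite G" using finite_divisors finite_subset by blast
      let ?t = "\<lambda>p a b. S (component (fst p) a) * component (snd p) b"
      let ?\<beta> = "\<lambda>a b. \<Sum>p\<in>G. ?t p a b"
      have \<beta>: "bilinear_map scale ?\<beta>"
        by (rule bilinear_mapI)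
          (simp_all add: bilinear_mapD[OF SB] sum.distrib scale_sum_right)
      have "tensor_eval ?\<beta> us = tensor_eval ?\<beta> vs"
        using tensor_equivD[OF us(1) \<beta>] tensor_equivD[OF vs(1) \<beta>] by simp
      also have "\<dots> = tensor_eval (\<lambda>a b. S a * b) vs"
      proof (rule tensor_eval_cong)
        fix a b assume "(a, b) \<in> set vs"
        then obtain \<alpha> \<beta> where ab: "a \<in> V \<alpha>" "b \<in> V \<beta>" "\<alpha> + \<beta> = \<gamma>" using vs(2) by blast
        have "?\<beta> a b = (\<Sum>p\<in>G. if p = (\<alpha>, \<beta>) then S a * b else 0)"
          by (rule sum.cong[OF refl]) (auto simp: component_V[OF ab(1)] component_V[OF ab(2)] S0)
        then show "?\<beta> a b = S a * b" using fin ab(3) by (simp add: sum.delta G_def)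
      qed
      also have "\<dots> = tensor_eval (\<lambda>a b. S a * b) (cop x)"
        by (rule tensor_equivD[OF vs(1), symmetric], rule bilinear_mapI)
          (simp_all add: S distrib_left distrib_right flip: scale_mult_left scale_mult_right)
      also have "\<dots> = 0" using anti counit_graded[OF less.prems(2) False] by simp
      finally have zero: "(\<Sum>p\<in>G. tensor_eval (?t p) us) = 0" by (simp only: tensor_eval_sum_fun)
      \<comment> \<open>By connectedness the part of degree 0 of a second factor \<open>b\<close> is
        \<open>\<epsilon> b\<close> times 1, so the right counit axiom leaves
        \<open>S x\<close>.\<close>
      have top: "tensor_eval (?t (\<gamma>, 0)) us = S x"
      proof -
        have "tensor_eval (?t (\<gamma>, 0)) ws
            = S (component \<gamma> (tensor_eval (\<lambda>a b. scale (\<epsilon> b) a) ws))" for ws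
          by (induction ws)
            (auto simp: S0 S component_add component_scale component_0_counit simp flip: scale_mult_right)
        moreover have "tensor_eval (\<lambda>a b. scale (\<epsilon> b) a) us = x"
          using tensor_equivD[OF us(1) bilinear_map_flip[OF form_pairing_bilinear[OF counit_form]]]
          by (simp add: counit_right)
        ultimately show ?thesis using component_V[OF less.prems(2)] by simp
      qed
      have rest: "(\<Sum>p\<in>G - {(\<gamma>, 0)}. tensor_eval (?t p) us) \<in> K"
      proof (intro subspace_sum[OF K_sub] tensor_eval_mem[OF K_sub])
        fix p a b assume p: "p \<in> G - {(\<gamma>, 0)}" and "(a, b) \<in> set us"
        then have ab: "a \<in> K" "b \<in> K" using us(2) by blast+
        have sum: "fst p + snd p = \<gamma>" using p by (simp add: G_def)
        then have "snd p \<noteq> 0" using p by (cases p) auto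
        then have "lt (fst p) \<gamma>" using lt_add_self[of "snd p" "fst p"] sum by simp
        then have "S (component (fst p) a) \<in> K" using less.IH hK[OF ab(1)] component_in by blast
        then show "?t p a b \<in> K" using subalgebra_mult[OF sK] hK[OF ab(2)] by blast
      qed
      have "(\<gamma>, 0) \<in> G" by (simp add: G_def)
      then have "S x + (\<Sum>p\<in>G - {(\<gamma>, 0)}. tensor_eval (?t p) us) = 0"
        using zero sum.remove[OF fin, of "(\<gamma>, 0)" "\<lambda>p. tensor_eval (?t p) us"] top by simp
      then have "S x = - (\<Sum>p\<in>G - {(\<gamma>, 0)}. tensor_eval (?t p) us)"
        by (simp add: eq_neg_iff_add_eq_0)
      then show ?thesis using subspace_neg[OF K_sub rest] by simp
    qed
  qed
  then have "S (component \<gamma> x) \<in> K" for \<gamma> using hK[OF x] component_in by blast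
  then have "(\<Sum>\<gamma>\<in>{\<gamma>. component \<gamma> x \<noteq> 0}. S (component \<gamma> x)) \<in> K" by (intro subspace_sum[OF K_sub])
  then have "S (\<Sum>\<gamma>\<in>{\<gamma>. component \<gamma> x \<noteq> 0}. component \<gamma> x) \<in> K" by (simp only: S_sum)
  then show ?thesis by (simp only: sum_component)
qed

end

section \<open>PBW generators of a coideal subalgebra\<close>

context graded_bialgebra
begin

lemma left_coideal_iff:
  assumes cop: "cop = (\<lambda>x. tensor_list (\<Delta> x))"
  shows "left_coideal scale \<Delta> K \<longleftrightarrow> subspace K \<and> stable K"
proof
  assume K: "left_coideal scale \<Delta> K"
  then have sub: "subspace K" by (simp add: left_coideal_def)
  have "slice f x \<in> K" if x: "x \<in> K" and f: "linear_form scale f" for f x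
  proof -
    have span: "\<Delta> x \<in> tensor_span scale (UNIV \<times> K)" using K x by (simp add: left_coideal_def)
    obtain us where us: "tensor_equiv scale (tensor_list (\<Delta> x)) us"
      "\<And>a b. (a, b) \<in> set us \<Longrightarrow> \<exists>c a'. a = scale c a' \<and> (a', b) \<in> UNIV \<times> K"
      using tensor_span_list[OF span] by blast
    have "slice f x = tensor_eval (\<lambda>a b. scale (f a) b) us"
      unfolding slice_def unfolding cop by (rule tensor_equivD[OF us(1) form_pairing_bilinear[OF f]])
    also have "\<dots> \<in> K" using us(2) by (intro tensor_eval_mem[OF sub] subspace_scale[OF sub]) blast
    finally show ?thesis .
  qed
  then show "subspace K \<and> stable K" using sub by (simp add: stable_def)
next
  assume K: "subspace K \<and> stable K"
  have "\<Delta> x \<in> tensor_span scale (UNIV \<times> K)" if x: "x \<in> K" for x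
  proof -
    obtain us where us: "tensor_equiv scale (cop x) us" "\<And>a b. (a, b) \<in> set us \<Longrightarrow> b \<in> K"
      using ex_rep_stable[of K x] K x stableD by blast
    show ?thesis by (rule tensor_spanI[of _ us]) (use us cop in auto)
  qed
  then show "left_coideal scale \<Delta> K" using K by (simp add: left_coideal_def)
qed

lemma right_coideal_iff:
  assumes cop: "cop = (\<lambda>x. tensor_list (\<Delta> x))"
  shows "right_coideal scale \<Delta> K \<longleftrightarrow>
    subspace K \<and> graded_bialgebra.stable scale (\<lambda>x. map prod.swap (cop x)) K"
proof -
  interpret sw: graded_bialgebra scale le lt V "\<lambda>x. map prod.swap (cop x)" \<epsilon>
    by (rule graded_bialgebra_swap)
  show ?thesis
  proof
    assume K: "right_coideal scale \<Delta> K"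
    then have sub: "subspace K" by (simp add: right_coideal_def)
    have "sw.slice f x \<in> K" if x: "x \<in> K" and f: "linear_form scale f" for f x
    proof -
      have span: "\<Delta> x \<in> tensor_span scale (K \<times> UNIV)" using K x by (simp add: right_coideal_def)
      obtain us where us: "tensor_equiv scale (tensor_list (\<Delta> x)) us"
        "\<And>a b. (a, b) \<in> set us \<Longrightarrow> \<exists>c a'. a = scale c a' \<and> (a', b) \<in> K \<times> UNIV"
        using tensor_span_list[OF span] by blast
      have "sw.slice f x = tensor_eval (\<lambda>a b. scale (f b) a) us"
        unfolding sw.slice_def unfolding cop tensor_eval_swap
        by (rule tensor_equivD[OF us(1) bilinear_map_flip[OF form_pairing_bilinear[OF f]]])
      also have "\<dots> \<in> K"
      proof (intro tensor_eval_mem[OF sub] subspace_scale[OF sub])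
        fix a b assume "(a, b) \<in> set us"
        then obtain c a' where "a = scale c a'" "a' \<in> K" using us(2) by blast
        then show "a \<in> K" using subspace_scale[OF sub] by simp
      qed
      finally show ?thesis .
    qed
    then show "subspace K \<and> sw.stable K" using sub by (simp add: sw.stable_def)
  next
    assume K: "subspace K \<and> sw.stable K"
    have "\<Delta> x \<in> tensor_span scale (K \<times> UNIV)" if x: "x \<in> K" for x
    proof -
      obtain us where us: "tensor_equiv scale (map prod.swap (cop x)) us"
        "\<And>a b. (a, b) \<in> set us \<Longrightarrow> b \<in> K"
        using sw.ex_rep_stable[of K x] K x sw.stableD by blast
      have "tensor_equiv scale (cop x) (map prod.swap us)"
        unfolding tensor_equiv_def
      proof (intro allI impI)
        fix \<beta> assume "bilinear_map scale \<beta>"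
        from tensor_equivD[OF us(1) bilinear_map_flip[OF this]]
        show "tensor_eval \<beta> (cop x) = tensor_eval \<beta> (map prod.swap us)"
          by (simp add: tensor_eval_swap)
      qed
      then show ?thesis by (intro tensor_spanI[of _ "map prod.swap us"]) (use us(2) cop in auto)
    qed
    then show "right_coideal scale \<Delta> K" using K by (simp add: right_coideal_def)
  qed
qed

lemma tensor_span_two_sided:
  assumes cop: "cop = (\<lambda>x. tensor_list (\<Delta> x))"
    and "subspace K" "stable K" "graded_bialgebra.stable scale (\<lambda>x. map prod.swap (cop x)) K" "x \<in> K"
  shows "\<Delta> x \<in> tensor_span scale (K \<times> K)"
proof -
  obtain us where us: "tensor_equiv scale (cop x) us" "set us \<subseteq> K \<times> K"
    using ex_rep_two_sided[OF assms(2-5)] by blast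
  then show ?thesis by (intro tensor_spanI[of _ us]) (simp_all add: cop)
qed

end

context coideal_pair
begin

lemma A_eq_Union: "A = B \<union> \<Union>(upper ` gens)"
proof
  show "B \<union> \<Union>(upper ` gens) \<subseteq> A" using B_A gens_upper(3) by blast
  have "\<Union>(insert B (upper ` gens)) = B \<union> \<Union>(upper ` gens)" by simp
  moreover have "subalgebra scale (\<Union>(insert B (upper ` gens)))"
  proof (rule subalgebra_chain_Union)
    show "subalgebra scale K" if "K \<in> insert B (upper ` gens)" for K
      using that subalgebra_B subalgebra_upper by blast
    fix K L assume "K \<in> insert B (upper ` gens)" "L \<in> insert B (upper ` gens)"
    moreover have "B \<subseteq> upper i" for i using B_lower lower_mid mid_upper by blast
    moreover have "upper i \<subseteq> upper j \<or> upper j \<subseteq> upper i" if "i \<in> gens" "j \<in> gens" for i j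
      using gens_compare[OF that] mid_upper by blast
    ultimately show "K \<subseteq> L \<or> L \<subseteq> K" by blast
  qed simp
  ultimately have sub: "subalgebra scale (B \<union> \<Union>(upper ` gens))" by simp
  show "A \<subseteq> B \<union> \<Union>(upper ` gens)"
  proof
    fix x assume x: "x \<in> A"
    show "x \<in> B \<union> \<Union>(upper ` gens)"
    proof (rule mem_subspace_components[OF subalgebra_subspace[OF sub]])
      fix \<gamma>
      have "component \<gamma> x \<in> A" using hom_A x unfolding homogeneous_subalgebra_def by blast
      moreover have "homogeneous_element V (component \<gamma> x)"
        using component_in unfolding homogeneous_element_def by blast
      ultimately show "component \<gamma> x \<in> B \<union> \<Union>(upper ` gens)" using gens_cover by blast
    qed
  qed
qed

lemma upper_eq_Union:
  assumes "\<xi> \<in> gens"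
  shows "upper \<xi> = B \<union> \<Union>(upper ` {\<eta>\<in>gens. (\<eta>, \<xi>) \<in> gens_order})"
proof -
  have "B \<subseteq> upper \<xi>" using B_lower lower_mid mid_upper by blast
  then show ?thesis using assms unfolding gens_order_def by auto
qed

lemma pbw_basis_A:
  "linear_order_on gens r \<Longrightarrow> side_basis s B A (pbw_exprs gens r) monomial"
  by (rule pbw_side_basis[OF _ order_refl order_refl _ subalgebra_A A_eq_Union])

lemma pbw_basis_upper:
  assumes "\<xi> \<in> gens"
  shows "side_basis s B (upper \<xi>) (pbw_exprs {\<eta>\<in>gens. (\<eta>, \<xi>) \<in> gens_order} gens_order) monomial"
  by (rule pbw_side_basis[OF linear_order_gens _ _ _ subalgebra_upper upper_eq_Union[OF assms]])
    (auto simp: gens_order_def)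

text \<open>The generated subalgebra reaches all of \<open>upper \<xi>\<close> because the PBW basis
  writes its elements in terms of \<open>B\<close> and the generators up to
  \<open>\<xi>\<close>.\<close>

lemma subalgebra_upto_eq:
  assumes \<xi>: "\<xi> \<in> gens"
  shows "subalgebra_upto scale B gens (\<lambda>x. x) gens_order \<xi> = upper \<xi>"
proof
  let ?Y = "{\<eta>\<in>gens. (\<eta>, \<xi>) \<in> gens_order}"
  let ?H = "subalgebra_upto scale B gens (\<lambda>x. x) gens_order \<xi>"
  have H: "subalgebra scale ?H" "B \<union> ?Y \<subseteq> ?H"
    unfolding subalgebra_upto_def using subalgebra_hull hull_subset[of "B \<union> ?Y"] by simp_all
  show "?H \<subseteq> upper \<xi>"
    unfolding subalgebra_upto_def
  proof (rule hull_minimal)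
    show "subalgebra scale (upper \<xi>)" by (rule subalgebra_upper)
    show "B \<union> (\<lambda>x. x) ` ?Y \<subseteq> upper \<xi>"
      using B_lower[of \<xi>] lower_mid[of \<xi>] mid_upper[of \<xi>] self_upper unfolding gens_order_def by auto
  qed
  show "upper \<xi> \<subseteq> ?H"
  proof
    fix x assume x: "x \<in> upper \<xi>"
    obtain F c where F: "finite F" "F \<subseteq> pbw_exprs ?Y gens_order" "c ` F \<subseteq> B"
      "x = (\<Sum>i\<in>F. side_mult True (c i) (monomial i))"
      by (rule side_basis_expansion[OF pbw_basis_upper[OF \<xi>] x])
    have "side_mult True (c i) (monomial i) \<in> ?H" if "i \<in> F" for i
      using that F(2,3) H(2) by (intro side_mult_mem[OF H(1)] monomial_mem[OF H(1), of i ?Y gens_order]) blast+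
    then show "x \<in> ?H" unfolding F(4) by (rule subspace_sum[OF subalgebra_subspace[OF H(1)]])
  qed
qed

lemma gens_plus_part:
  assumes \<xi>: "\<xi> \<in> gens"
  shows "\<xi> \<in> plus_part V A"
proof -
  have "homogeneous_decomposition (\<lambda>\<gamma>. A \<inter> V \<gamma>) \<xi> (Poly_Mapping.single (deg \<xi>) \<xi>)"
    using \<xi> gens_nonzero[OF \<xi>] gens_V[OF \<xi>] gens_iff[of \<xi>] subspace_0[OF subspace_V]
      subalgebra_zero[OF subalgebra_A]
    by (simp add: homogeneous_decomposition_def lookup_single when_def)
  moreover have "Poly_Mapping.lookup (Poly_Mapping.single (deg \<xi>) \<xi>) 0 = 0"
    using gens_deg[OF \<xi>] by (simp add: lookup_single when_def)
  ultimately show ?thesis unfolding plus_part_def by blast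
qed

text \<open>\<open>mid \<xi>\<close> is closed under \<open>ad \<xi>\<close>, and the commutator is
  homogeneous; outside \<open>B\<close> it therefore lies in the gap of a generator strictly below
  \<open>\<xi>\<close>, and inside \<open>B\<close> already in \<open>upper \<eta>\<close>.\<close>

lemma gens_commutator:
  assumes \<xi>: "\<xi> \<in> gens" and \<eta>: "\<eta> \<in> gens" and less: "(\<eta>, \<xi>) \<in> gens_order - Id"
  shows "\<xi> * \<eta> - \<eta> * \<xi> \<in> (\<Union>\<delta>\<in>{\<delta>\<in>gens. (\<delta>, \<xi>) \<in> gens_order - Id}. upper \<delta>)"
proof (cases "\<xi> * \<eta> - \<eta> * \<xi> \<in> B")
  case True
  then have "\<xi> * \<eta> - \<eta> * \<xi> \<in> upper \<eta>" using B_lower lower_mid mid_upper by blast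
  then show ?thesis using \<eta> less by blast
next
  case False
  have "\<eta> \<in> mid \<xi>" using less self_upper unfolding gens_order_strict by blast
  then have mid: "\<xi> * \<eta> - \<eta> * \<xi> \<in> mid \<xi>" by (rule mid_ad)
  have "\<xi> * \<eta> - \<eta> * \<xi> \<in> V (deg \<xi> + deg \<eta>)"
    using mult_V[OF gens_V[OF \<xi>] gens_V[OF \<eta>]] mult_V[OF gens_V[OF \<eta>] gens_V[OF \<xi>]]
    by (intro subspace_diff[OF subspace_V]) (simp_all add: add.commute)
  then have "homogeneous_element V (\<xi> * \<eta> - \<eta> * \<xi>)" unfolding homogeneous_element_def by blast
  then obtain j where "j \<in> gens" "upper j \<subseteq> mid \<xi>" "\<xi> * \<eta> - \<eta> * \<xi> \<in> upper j"
    using mid_cover[OF \<xi> mid _ False] by blast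
  then show ?thesis using gens_order_strict[of j \<xi>] \<xi> by blast
qed

lemma pbw_system:
  "\<forall>\<xi>\<in>gens. \<xi> \<in> plus_part V A \<and> homogeneous_element V \<xi>"
  "linear_order_on gens gens_order"
  "\<forall>r. linear_order_on gens r \<longrightarrow> pbw_generators B A gens (\<lambda>x. x) r"
  "\<forall>\<xi>\<in>gens.
     left_module_basis B (subalgebra_upto scale B gens (\<lambda>x. x) gens_order \<xi>)
       (pbw_exprs {\<eta>\<in>gens. (\<eta>, \<xi>) \<in> gens_order} gens_order) monomial \<and>
     right_module_basis B (subalgebra_upto scale B gens (\<lambda>x. x) gens_order \<xi>)
       (pbw_exprs {\<eta>\<in>gens. (\<eta>, \<xi>) \<in> gens_order} gens_order) monomial"
  "\<forall>\<xi>\<in>gens. \<forall>\<eta>\<in>gens. (\<eta>, \<xi>) \<in> gens_order - Id \<longrightarrow>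
     \<xi> * \<eta> - \<eta> * \<xi> \<in> (\<Union>\<delta>\<in>{\<delta>\<in>gens. (\<delta>, \<xi>) \<in> gens_order - Id}.
       subalgebra_upto scale B gens (\<lambda>x. x) gens_order \<delta>)"
proof -
  note B0 = subalgebra_zero[OF subalgebra_B]
  show "\<forall>\<xi>\<in>gens. \<xi> \<in> plus_part V A \<and> homogeneous_element V \<xi>"
    using gens_plus_part gens_iff by blast
  show "linear_order_on gens gens_order" by (rule linear_order_gens)
  show "\<forall>r. linear_order_on gens r \<longrightarrow> pbw_generators B A gens (\<lambda>x. x) r"
  proof (intro allI impI)
    fix r assume r: "linear_order_on gens r"
    have "gens \<subseteq> A" using gens_iff by blast
    then show "pbw_generators B A gens (\<lambda>x. x) r"
      using left_module_basis_side[OF pbw_basis_A[OF r] B0]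
        right_module_basis_side[OF pbw_basis_A[OF r] B0] r
      by (simp add: pbw_generators_def)
  qed
  show "\<forall>\<xi>\<in>gens.
     left_module_basis B (subalgebra_upto scale B gens (\<lambda>x. x) gens_order \<xi>)
       (pbw_exprs {\<eta>\<in>gens. (\<eta>, \<xi>) \<in> gens_order} gens_order) monomial \<and>
     right_module_basis B (subalgebra_upto scale B gens (\<lambda>x. x) gens_order \<xi>)
       (pbw_exprs {\<eta>\<in>gens. (\<eta>, \<xi>) \<in> gens_order} gens_order) monomial"
    using left_module_basis_side[OF pbw_basis_upper B0] right_module_basis_side[OF pbw_basis_upper B0]
    by (simp add: subalgebra_upto_eq)
  have "(\<Union>\<delta>\<in>{\<delta>\<in>gens. (\<delta>, \<xi>) \<in> gens_order - Id}. subalgebra_upto scale B gens (\<lambda>x. x) gens_order \<delta>)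
      = (\<Union>\<delta>\<in>{\<delta>\<in>gens. (\<delta>, \<xi>) \<in> gens_order - Id}. upper \<delta>)" for \<xi>
    by (rule SUP_cong[OF refl]) (simp add: subalgebra_upto_eq)
  then show "\<forall>\<xi>\<in>gens. \<forall>\<eta>\<in>gens. (\<eta>, \<xi>) \<in> gens_order - Id \<longrightarrow>
     \<xi> * \<eta> - \<eta> * \<xi> \<in> (\<Union>\<delta>\<in>{\<delta>\<in>gens. (\<delta>, \<xi>) \<in> gens_order - Id}.
       subalgebra_upto scale B gens (\<lambda>x. x) gens_order \<delta>)"
    using gens_commutator by simp
qed

end

lemma wellorder_admissible:
  assumes "admissible_well_order r"
  shows "class.wellorder (\<lambda>a b. (a, b) \<in> r) (\<lambda>a b. (a, b) \<in> r - Id)"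
proof -
  have wo: "well_order_on UNIV r" using assms by (simp add: admissible_well_order_def)
  then have lin: "refl_on UNIV r" "trans r" "antisym r" "total_on UNIV r" and wf: "wf (r - Id)"
    by (simp_all add: well_order_on_def linear_order_on_def partial_order_on_def preorder_on_def)
  show ?thesis
  proof unfold_locales
    show "(x, y) \<in> r - Id \<longleftrightarrow> (x, y) \<in> r \<and> (y, x) \<notin> r" for x y
      using lin(1,3) by (auto simp: refl_on_def antisym_def)
    show "(x, x) \<in> r" for x using lin(1) by (simp add: refl_on_def)
    show "(x, y) \<in> r \<Longrightarrow> (y, z) \<in> r \<Longrightarrow> (x, z) \<in> r" for x y z using lin(2) by (rule transD)
    show "(x, y) \<in> r \<Longrightarrow> (y, x) \<in> r \<Longrightarrow> x = y" for x y using lin(3) by (rule antisymD)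
    show "(x, y) \<in> r \<or> (y, x) \<in> r" for x y
      using lin(1,4) by (cases "x = y") (auto simp: refl_on_def total_on_def)
    show "P a" if "\<And>x. (\<And>y. (y, x) \<in> r - Id \<Longrightarrow> P y) \<Longrightarrow> P x" for P a
      using wf that by (rule wf_induct_rule)
  qed
qed

lemma (in connected_graded_hopf_algebra) V_0_eq: "V 0 = span {1}"
proof -
  obtain X where X: "X \<subseteq> V 0" "independent X" "V 0 \<subseteq> span X" "card X = dim (V 0)"
    using basis_exists by blast
  then obtain b where b: "X = {b}" using connected card_1_singletonE by metis
  have "1 \<in> span {b}" using X b graded_one by blast
  then obtain c where c: "1 = scale c b" by (auto simp: span_singleton)
  then have "c \<noteq> 0" by auto
  then have "b = scale (inverse c) 1" by (simp add: c)
  then have "b \<in> span {1}" by (metis span_base span_scale singletonI)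
  then have "span {b} \<subseteq> span {1}" by (intro span_minimal subspace_span) simp
  moreover have "span {1} \<subseteq> V 0" using graded_one by (intro span_minimal subspace_component) simp
  ultimately show ?thesis using X b by blast
qed

lemma graded_bialgebra_hopf:
  fixes scale :: "'k::field_char_0 \<Rightarrow> 'h::ring_1 \<Rightarrow> 'h" and V :: "'g::comm_monoid_add \<Rightarrow> 'h set"
  assumes H: "connected_graded_hopf_algebra scale \<Delta> \<epsilon> S V" and r: "admissible_well_order r"
  shows "graded_bialgebra scale (\<lambda>a b. (a, b) \<in> r) (\<lambda>a b. (a, b) \<in> r - Id) V
    (\<lambda>x. algebra_over_field.tensor_list scale (\<Delta> x)) \<epsilon>"
proof -
  interpret H: connected_graded_hopf_algebra scale \<Delta> \<epsilon> S V by (rule H)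
  interpret wo: wellorder "\<lambda>a b. (a, b) \<in> r" "\<lambda>a b. (a, b) \<in> r - Id"
    by (rule wellorder_admissible[OF r])
  interpret G: graded_algebra scale "\<lambda>a b. (a, b) \<in> r" "\<lambda>a b. (a, b) \<in> r - Id" V
  proof unfold_locales
    show "(\<alpha>, \<beta>) \<in> r - Id \<Longrightarrow> (\<gamma> + \<alpha>, \<gamma> + \<beta>) \<in> r - Id" for \<alpha> \<beta> \<gamma>
      using r unfolding admissible_well_order_def by blast
  qed (simp_all add: H.subspace_component H.direct_sum H.graded_one H.graded_mult H.V_0_eq H.span_base)
  note eval = H.tensor_eval_tensor_list
  have form: "linear_form scale \<epsilon>"
  proof -
    interpret l: Vector_Spaces.linear scale "(*)" \<epsilon> by (rule H.counit_linear)
    show ?thesis by (simp add: linear_form_def l.add l.scale)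
  qed
  show ?thesis
  proof unfold_locales
    fix \<beta> x y assume \<beta>: "bilinear_map scale \<beta>"
    show "tensor_eval \<beta> (H.tensor_list (\<Delta> (x + y)))
        = tensor_eval \<beta> (H.tensor_list (\<Delta> x)) + tensor_eval \<beta> (H.tensor_list (\<Delta> y))"
      using H.tensor2_eq_lin_ext[OF \<beta> H.comult_add] by (simp add: eval[OF \<beta>] H.lin_ext_add)
    show "tensor_eval \<beta> (H.tensor_list (\<Delta> (scale c x))) = scale c (tensor_eval \<beta> (H.tensor_list (\<Delta> x)))" for c
      using H.tensor2_eq_lin_ext[OF \<beta> H.comult_scale] by (simp add: eval[OF \<beta>] H.lin_ext_scale)
    show "tensor_eval \<beta> (H.tensor_list (\<Delta> 1)) = \<beta> 1 1"
      using H.tensor2_eq_lin_ext[OF \<beta> H.comult_one] by (simp add: eval[OF \<beta>] H.lin_ext_basis_vec)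
    have inner: "bilinear_map scale (\<lambda>c d. \<beta> (a * c) (b * d))" for a b
      by (rule bilinear_mapI)
        (simp_all add: distrib_left bilinear_mapD[OF \<beta>] flip: H.scale_mult_right)
    have outer: "bilinear_map scale (\<lambda>a b. tensor_eval (\<lambda>c d. \<beta> (a * c) (b * d)) us)" for us
      by (rule bilinear_mapI)
        (simp_all add: distrib_right bilinear_mapD[OF \<beta>] H.tensor_eval_add_fun H.tensor_eval_scale_fun
          flip: H.scale_mult_left)
    have "lin_ext scale (\<lambda>(a, b). \<beta> a b) (tensor_mult (\<Delta> x) (\<Delta> y)) = lin_ext scale
        (\<lambda>(a, b). lin_ext scale (\<lambda>(c, d). \<beta> (a * c) (b * d)) (\<Delta> y)) (\<Delta> x)"
      by (simp add: tensor_mult_def H.lin_ext_lin_ext H.lin_ext_basis_vec case_prod_unfold)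
    then show "tensor_eval \<beta> (H.tensor_list (\<Delta> (x * y))) =
        tensor_eval (\<lambda>a b. tensor_eval (\<lambda>c d. \<beta> (a * c) (b * d)) (H.tensor_list (\<Delta> y)))
          (H.tensor_list (\<Delta> x))"
      using H.tensor2_eq_lin_ext[OF \<beta> H.comult_mult, of x y]
      by (subst eval[OF outer]) (simp add: eval[OF \<beta>] eval[OF inner])
  next
    show "linear_form scale \<epsilon>" by (rule form)
    show "\<epsilon> 1 = 1" by (rule H.counit_one)
    show "tensor_eval (\<lambda>a b. scale (\<epsilon> a) b) (H.tensor_list (\<Delta> x)) = x" for x
      using H.counit_left by (simp add: eval[OF H.form_pairing_bilinear[OF form]])
    show "tensor_eval (\<lambda>a b. scale (\<epsilon> b) a) (H.tensor_list (\<Delta> x)) = x" for x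
      using H.counit_right by (simp add: eval[OF bilinear_map_flip[OF H.form_pairing_bilinear[OF form]]])
    show "x \<in> V \<gamma> \<Longrightarrow> \<gamma> \<noteq> 0 \<Longrightarrow> \<epsilon> x = 0" for x \<gamma> by (rule H.graded_counit)
    fix x \<gamma> assume "x \<in> V \<gamma>"
    then obtain us where us: "tensor_equiv scale (H.tensor_list (\<Delta> x)) us"
      "\<And>a b. (a, b) \<in> set us \<Longrightarrow> \<exists>c a'. a = scale c a' \<and> (a', b) \<in> \<Union>{V \<alpha> \<times> V \<beta> | \<alpha> \<beta>. \<alpha> + \<beta> = \<gamma>}"
      using H.tensor_span_list[OF H.graded_comult] by blast
    have "\<exists>\<alpha> \<beta>. a \<in> V \<alpha> \<and> b \<in> V \<beta> \<and> \<alpha> + \<beta> = \<gamma>" if ab: "(a, b) \<in> set us" for a b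
    proof -
      obtain c a' \<alpha> \<beta> where "a = scale c a'" "a' \<in> V \<alpha>" "b \<in> V \<beta>" "\<alpha> + \<beta> = \<gamma>"
        using us(2)[OF ab] by blast
      then show ?thesis using H.subspace_scale[OF H.subspace_component] by blast
    qed
    then show "\<exists>us. tensor_equiv scale (H.tensor_list (\<Delta> x)) us \<and>
        (\<forall>(a, b)\<in>set us. \<exists>\<alpha> \<beta>. a \<in> V \<alpha> \<and> b \<in> V \<beta> \<and> \<alpha> + \<beta> = \<gamma>)" using us(1) by blast
  qed
qed

lemma (in graded_algebra) homogeneous_subalgebraI:
  assumes "subalgebra scale K" "homogeneous_subset V K"
  shows "homogeneous_subalgebra K"
proof -
  have "component \<gamma> x \<in> K" if x: "x \<in> K" for x \<gamma>
  proof -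
    obtain f where f: "homogeneous_decomposition (\<lambda>\<gamma>. K \<inter> V \<gamma>) x f"
      using assms(2) x unfolding homogeneous_subset_def by blast
    then have "homogeneous_decomposition V x f" by (simp add: homogeneous_decomposition_def)
    then have "component \<gamma> x = Poly_Mapping.lookup f \<gamma>" by (rule component_decomposition)
    moreover have "Poly_Mapping.lookup f \<gamma> \<in> K" using f by (simp add: homogeneous_decomposition_def)
    ultimately show ?thesis by simp
  qed
  then show ?thesis using assms(1) by (simp add: homogeneous_subalgebra_def)
qed

theorem theorem6p1:
  fixes scale :: "'k::field_char_0 \<Rightarrow> 'h::ring_1 \<Rightarrow> 'h"
    and \<Delta> :: "'h \<Rightarrow> ('h \<times> 'h \<Rightarrow>\<^sub>0 'k)"
    and \<epsilon> :: "'h \<Rightarrow> 'k"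
    and S :: "'h \<Rightarrow> 'h"
    and V :: "'g::comm_monoid_add \<Rightarrow> 'h set"
    and A B :: "'h set"
    and coideal :: "'h set \<Rightarrow> bool"
  assumes "connected_graded_hopf_algebra scale \<Delta> \<epsilon> S V"
    and "\<exists>\<gamma>::'g. \<gamma> \<noteq> 0"
    and "\<exists>r::'g rel. admissible_well_order r"
    and "coideal = left_coideal scale \<Delta> \<or> coideal = right_coideal scale \<Delta>"
    and "subalgebra scale A" and "coideal A" and "homogeneous_subset V A"
    and "subalgebra scale B" and "coideal B" and "homogeneous_subset V B"
    and "B \<subseteq> A"
  shows "\<exists>(\<Xi>::'h set) (z::'h \<Rightarrow> 'h) (ord::'h rel).
    (\<forall>\<xi>\<in>\<Xi>. z \<xi> \<in> plus_part V A \<and> homogeneous_element V (z \<xi>)) \<and>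
    linear_order_on \<Xi> ord \<and>
    (\<forall>r. linear_order_on \<Xi> r \<longrightarrow> pbw_generators B A \<Xi> z r) \<and>
    (\<forall>\<xi>\<in>\<Xi>.
       left_module_basis B (subalgebra_upto scale B \<Xi> z ord \<xi>)
         (pbw_exprs {\<eta>\<in>\<Xi>. (\<eta>, \<xi>) \<in> ord} ord) (pbw_monomial z) \<and>
       right_module_basis B (subalgebra_upto scale B \<Xi> z ord \<xi>)
         (pbw_exprs {\<eta>\<in>\<Xi>. (\<eta>, \<xi>) \<in> ord} ord) (pbw_monomial z)) \<and>
    (\<forall>\<xi>\<in>\<Xi>. coideal (subalgebra_upto scale B \<Xi> z ord \<xi>)) \<and>
    (hopf_subalgebra scale \<Delta> S A \<and> hopf_subalgebra scale \<Delta> S B \<longrightarrow>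
       (\<forall>\<xi>\<in>\<Xi>. hopf_subalgebra scale \<Delta> S (subalgebra_upto scale B \<Xi> z ord \<xi>))) \<and>
    (\<forall>\<xi>\<in>\<Xi>. \<forall>\<eta>\<in>\<Xi>. (\<eta>, \<xi>) \<in> ord - Id \<longrightarrow>
       z \<xi> * z \<eta> - z \<eta> * z \<xi> \<in>
         (\<Union>\<delta>\<in>{\<delta>\<in>\<Xi>. (\<delta>, \<xi>) \<in> ord - Id}. subalgebra_upto scale B \<Xi> z ord \<delta>))"
proof -
  obtain r :: "'g rel" where r: "admissible_well_order r" using assms(3) by blast
  interpret H: connected_graded_hopf_algebra scale \<Delta> \<epsilon> S V by (rule assms(1))
  let ?le = "\<lambda>a b. (a, b) \<in> r" and ?lt = "\<lambda>a b. (a, b) \<in> r - Id"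
  let ?cop = "\<lambda>x. H.tensor_list (\<Delta> x)"
  interpret G: graded_bialgebra scale ?le ?lt V ?cop \<epsilon>
    by (rule graded_bialgebra_hopf[OF assms(1) r])
  interpret sw: graded_bialgebra scale ?le ?lt V "\<lambda>x. map prod.swap (?cop x)" \<epsilon>
    by (rule G.graded_bialgebra_swap)
  \<comment> \<open>Generators and chain are fixed here, before a side is chosen, so they are shared
    by the comultiplication and its opposite.\<close>
  interpret P: subalgebra_pair scale ?le ?lt V A B
    by unfold_locales (use assms G.homogeneous_subalgebraI in auto)
  note left = G.left_coideal_iff[where \<Delta> = \<Delta>, OF refl]
  note right = G.right_coideal_iff[where \<Delta> = \<Delta>, OF refl]
  note upper_sub = G.subalgebra_subspace[OF P.subalgebra_upper]
  have L: "coideal_pair scale ?le ?lt V ?cop \<epsilon> A B" if "G.stable A" "G.stable B"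
    using that by (intro coideal_pair.intro coideal_pair_axioms.intro G.graded_bialgebra_axioms
        P.subalgebra_pair_axioms)
  have R: "coideal_pair scale ?le ?lt V (\<lambda>x. map prod.swap (?cop x)) \<epsilon> A B"
    if "sw.stable A" "sw.stable B"
    using that by (intro coideal_pair.intro coideal_pair_axioms.intro sw.graded_bialgebra_axioms
        P.subalgebra_pair_axioms)
  have "\<exists>cop. coideal_pair scale ?le ?lt V cop \<epsilon> A B \<and> (\<forall>\<xi>\<in>P.gens. coideal (P.upper \<xi>))"
    using assms(4)
  proof
    assume c: "coideal = left_coideal scale \<Delta>"
    then have C: "coideal_pair scale ?le ?lt V ?cop \<epsilon> A B" using assms(6,9) left by (intro L) simp_all
    then show ?thesis using coideal_pair.gens_upper(2)[OF C] upper_sub unfolding c left by blast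
  next
    assume c: "coideal = right_coideal scale \<Delta>"
    then have C: "coideal_pair scale ?le ?lt V (\<lambda>x. map prod.swap (?cop x)) \<epsilon> A B"
      using assms(6,9) right by (intro R) simp_all
    then show ?thesis using coideal_pair.gens_upper(2)[OF C] upper_sub unfolding c right by blast
  qed
  then obtain cop where C: "coideal_pair scale ?le ?lt V cop \<epsilon> A B"
    and coid: "\<forall>\<xi>\<in>P.gens. coideal (P.upper \<xi>)" by blast
  interpret C: coideal_pair scale ?le ?lt V cop \<epsilon> A B by (rule C)
  have S_add: "S (x + y) = S x + S y" and S_scale: "S (scale c x) = scale c (S x)" for x y c
  proof -
    interpret l: Vector_Spaces.linear scale scale S by (rule H.antipode_linear)
    show "S (x + y) = S x + S y" "S (scale c x) = scale c (S x)" by (rule l.add l.scale)+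
  qed
  have anti: "tensor_eval (\<lambda>a b. S a * b) (?cop x) = scale (\<epsilon> x) 1" for x
  proof -
    have "bilinear_map scale (\<lambda>a b. S a * b)"
      by (rule bilinear_mapI)
        (simp_all add: S_add S_scale distrib_left distrib_right flip: H.scale_mult_left H.scale_mult_right)
    then show ?thesis using H.antipode_left by (simp add: H.tensor_eval_tensor_list)
  qed
  have two_sided: "G.stable K \<and> sw.stable K" if K: "hopf_subalgebra scale \<Delta> S K" for K
  proof -
    have "tensor_span scale (K \<times> K) \<subseteq> tensor_span scale (UNIV \<times> K) \<inter> tensor_span scale (K \<times> UNIV)"
      unfolding tensor_span_def by blast
    then have "left_coideal scale \<Delta> K" "right_coideal scale \<Delta> K"
      using K unfolding hopf_subalgebra_def left_coideal_def right_coideal_def subalgebra_def by blast+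
    then show ?thesis using left right by blast
  qed
  have hopf: "hopf_subalgebra scale \<Delta> S (P.upper \<xi>)"
    if "hopf_subalgebra scale \<Delta> S A" "hopf_subalgebra scale \<Delta> S B" and \<xi>: "\<xi> \<in> P.gens" for \<xi>
  proof -
    \<comment> \<open>\<open>A\<close> and \<open>B\<close> are stable on both sides, so the left
      and the right instance apply to the same chain and make its members two-sided.\<close>
    have st: "G.stable (P.upper \<xi>)" "sw.stable (P.upper \<xi>)"
      using coideal_pair.gens_upper(2)[OF L \<xi>] coideal_pair.gens_upper(2)[OF R \<xi>]
        two_sided[OF that(1)] two_sided[OF that(2)] by blast+
    show ?thesis
      unfolding hopf_subalgebra_def
      using P.subalgebra_upper G.tensor_span_two_sided[OF refl upper_sub st]
        G.antipode_closed[OF S_add S_scale anti C.gens_upper(1)[OF \<xi>] st] by blast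
  qed
  note upto = C.subalgebra_upto_eq
  show ?thesis
  proof (intro exI[of _ P.gens] exI[of _ "\<lambda>x. x"] exI[of _ P.gens_order] conjI)
    show "\<forall>\<xi>\<in>P.gens. coideal (subalgebra_upto scale B P.gens (\<lambda>x. x) P.gens_order \<xi>)"
      using coid upto by simp
    show "hopf_subalgebra scale \<Delta> S A \<and> hopf_subalgebra scale \<Delta> S B \<longrightarrow>
       (\<forall>\<xi>\<in>P.gens. hopf_subalgebra scale \<Delta> S (subalgebra_upto scale B P.gens (\<lambda>x. x) P.gens_order \<xi>))"
      using hopf upto by simp
  qed (rule C.pbw_system)+
qed

end
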